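(* For $m\in\{6,7,8\}$ let $E_m$ be the tree on $m$ vertices consisting of a path $p_1-p_2-\cdots-p_{m-1}$ together with one extra vertex $q$ joined to $p_3$. Then all relations among the edge generators of $\mathcal E_{E_m}$ are generated by the quadratic relations ($X_e^2$ for edges $e$, $X_eX_f-X_fX_e$ for disjoint edges), the braid relations $X_{ja}X_{jb}X_{ja}+X_{jb}X_{ja}X_{jb}$ (edges $\{j,a\},\{j,b\}$ sharing $j$) and the claw relations $X_{ja}X_{jb}X_{jc}X_{ja}+X_{jb}X_{jc}X_{ja}X_{jb}+X_{jc}X_{ja}X_{jb}X_{jc}$ (edges $\{j,a\},\{j,b\},\{j,c\}$ sharing $j$), where $X_{ja}$ denotes the generator $x_{ja}$. Moreover $$\mathcal H_{E_6}(t)=\frac{[4][5][6]^2[8][9]}{[3]},\quad \mathcal H_{E_7}(t)=\frac{[6]^2[8][9][10][12][14]}{[3]},\quad \mathcal H_{E_8}(t)=\frac{[6][8][10][12][14][15][18][20][24]}{[3][5]}.$$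
   Context: Let $n\ge 1$. The Fomin–Kirillov algebra $\mathcal E_n$ is the associative $\mathbb Q$-algebra with generators $x_{ij}$ for ordered pairs of distinct $i,j\in[n]$, subject to $x_{ij}=-x_{ji}$, $x_{ij}^2=0$, $x_{ij}x_{kl}=x_{kl}x_{ij}$ for distinct $i,j,k,l$, and $x_{ij}x_{jk}+x_{jk}x_{ki}+x_{ki}x_{ij}=0$ for distinct $i,j,k$. It is graded by degree. For a simple graph $G$ on vertex set identified with $[n]$, $\mathcal E_G$ is the subalgebra of $\mathcal E_n$ generated by the $x_{ij}$ with $\{i,j\}$ an edge of $G$; "all relations are generated by" means the kernel of the surjection from the free algebra on one symbol per edge onto $\mathcal E_G$ is generated as a two-sided ideal by the listed elements. $\mathcal H_G(t)=\sum_d\dim\mathcal E_G^d\,t^d$ and $[k]=1+t+\cdots+t^{k-1}$. *)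

theory Defs
  imports Main "HOL-Computational_Algebra.Formal_Power_Series"
begin

text \<open>Free associative Q-algebra on a letter type 'g: elements are functions from
words to rat (finitely supported ones are the polynomials).\<close>

type_synonym 'g fa = "'g list \<Rightarrow> rat"

definition fin_supp :: "'g fa \<Rightarrow> bool" where
  "fin_supp p \<longleftrightarrow> finite {w. p w \<noteq> 0}"

definition fzero :: "'g fa" where "fzero = (\<lambda>w. 0)"
definition fadd :: "'g fa \<Rightarrow> 'g fa \<Rightarrow> 'g fa" where "fadd p q = (\<lambda>w. p w + q w)"
definition fsc :: "rat \<Rightarrow> 'g fa \<Rightarrow> 'g fa" where "fsc c p = (\<lambda>w. c * p w)"
definition fneg :: "'g fa \<Rightarrow> 'g fa" where "fneg p = fsc (-1) p"
definition fmul :: "'g fa \<Rightarrow> 'g fa \<Rightarrow> 'g fa" where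
  "fmul p q = (\<lambda>w. \<Sum>k\<in>{0..length w}. p (take k w) * q (drop k w))"
definition gen :: "'g \<Rightarrow> 'g fa" where "gen x = (\<lambda>w. if w = [x] then 1 else 0)"

inductive_set gen_ideal :: "'g set \<Rightarrow> 'g fa set \<Rightarrow> 'g fa set" for L R where
  gi_gen: "r \<in> R \<Longrightarrow> r \<in> gen_ideal L R"
| gi_zero: "fzero \<in> gen_ideal L R"
| gi_add: "p \<in> gen_ideal L R \<Longrightarrow> q \<in> gen_ideal L R \<Longrightarrow> fadd p q \<in> gen_ideal L R"
| gi_sc: "p \<in> gen_ideal L R \<Longrightarrow> fsc c p \<in> gen_ideal L R"
| gi_left: "p \<in> gen_ideal L R \<Longrightarrow> x \<in> L \<Longrightarrow> fmul (gen x) p \<in> gen_ideal L R"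
| gi_right: "p \<in> gen_ideal L R \<Longrightarrow> x \<in> L \<Longrightarrow> fmul p (gen x) \<in> gen_ideal L R"

text \<open>Fomin--Kirillov algebra E_n: letters (i,j), i,j in [n] distinct, x_ij = gen (i,j).\<close>
definition FKL :: "nat \<Rightarrow> (nat \<times> nat) set" where
  "FKL n = {(i,j). i \<in> {1..n} \<and> j \<in> {1..n} \<and> i \<noteq> j}"

definition FK_rels :: "nat \<Rightarrow> (nat \<times> nat) fa set" where
  "FK_rels n =
     {fadd (gen (i,j)) (gen (j,i)) | i j. (i,j) \<in> FKL n}
   \<union> {fmul (gen (i,j)) (gen (i,j)) | i j. (i,j) \<in> FKL n}
   \<union> {fadd (fmul (gen (i,j)) (gen (k,l))) (fneg (fmul (gen (k,l)) (gen (i,j)))) | i j k l.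
        i \<in> {1..n} \<and> j \<in> {1..n} \<and> k \<in> {1..n} \<and> l \<in> {1..n} \<and> distinct [i,j,k,l]}
   \<union> {fadd (fadd (fmul (gen (i,j)) (gen (j,k))) (fmul (gen (j,k)) (gen (k,i))))
          (fmul (gen (k,i)) (gen (i,j))) | i j k.
        i \<in> {1..n} \<and> j \<in> {1..n} \<and> k \<in> {1..n} \<and> distinct [i,j,k]}"

text \<open>A simple graph on [n] is given by its set of edges oriented as (i,j) with i < j.
The free algebra on its edge generators is the free algebra on these letters;
the generator of edge {i,j} is sent to x_ij in E_n (inclusion of letters).
X i j is the (signed) edge generator x_ij = - x_ji.\<close>
definition X :: "nat \<Rightarrow> nat \<Rightarrow> (nat \<times> nat) fa" where
  "X i j = (if i < j then gen (i,j) else fneg (gen (j,i)))"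

definition adj :: "(nat \<times> nat) set \<Rightarrow> nat \<Rightarrow> nat \<Rightarrow> bool" where
  "adj E a b \<longleftrightarrow> (a,b) \<in> E \<or> (b,a) \<in> E"

definition G_rels :: "(nat \<times> nat) set \<Rightarrow> (nat \<times> nat) fa set" where
  "G_rels E =
     {fmul (X a b) (X a b) | a b. (a,b) \<in> E}
   \<union> {fadd (fmul (X a b) (X c d)) (fneg (fmul (X c d) (X a b))) | a b c d.
        (a,b) \<in> E \<and> (c,d) \<in> E \<and> {a,b} \<inter> {c,d} = {}}
   \<union> {fadd (fmul (X j a) (fmul (X j b) (X j a))) (fmul (X j b) (fmul (X j a) (X j b))) | j a b.
        adj E j a \<and> adj E j b \<and> a \<noteq> b}
   \<union> {fadd (fadd (fmul (X j a) (fmul (X j b) (fmul (X j c) (X j a))))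
                 (fmul (X j b) (fmul (X j c) (fmul (X j a) (X j b)))))
          (fmul (X j c) (fmul (X j a) (fmul (X j b) (X j c)))) | j a b c.
        adj E j a \<and> adj E j b \<and> adj E j c \<and> distinct [a,b,c]}"

definition fk_kernel :: "(nat \<times> nat) set \<Rightarrow> nat \<Rightarrow> (nat \<times> nat) fa set" where
  "fk_kernel E n = {p. fin_supp p \<and> (\<forall>w. p w \<noteq> 0 \<longrightarrow> set w \<subseteq> E)
                        \<and> p \<in> gen_ideal (FKL n) (FK_rels n)}"

definition lin_comb :: "'g fa set \<Rightarrow> ('g fa \<Rightarrow> rat) \<Rightarrow> 'g fa" where
  "lin_comb S c = (\<lambda>w. \<Sum>v\<in>S. c v * v w)"

definition indep_mod :: "'g fa set \<Rightarrow> 'g fa set \<Rightarrow> bool" where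
  "indep_mod I S \<longleftrightarrow> finite S \<and> (\<forall>c. lin_comb S c \<in> I \<longrightarrow> (\<forall>v\<in>S. c v = 0))"

definition dim_quot :: "'g fa set \<Rightarrow> 'g fa set \<Rightarrow> nat" where
  "dim_quot V I = Max {card S | S. S \<subseteq> V \<and> indep_mod I S}"

text \<open>Degree d part of the free algebra on the edge letters of E; E_G^d is its image
in E_n, i.e. the quotient by the FK ideal.\<close>
definition deg_part :: "(nat \<times> nat) set \<Rightarrow> nat \<Rightarrow> (nat \<times> nat) fa set" where
  "deg_part E d = {p. fin_supp p \<and> (\<forall>w. p w \<noteq> 0 \<longrightarrow> set w \<subseteq> E \<and> length w = d)}"

definition hdim :: "(nat \<times> nat) set \<Rightarrow> nat \<Rightarrow> nat \<Rightarrow> nat" where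
  "hdim E n d = dim_quot (deg_part E d) (gen_ideal (FKL n) (FK_rels n))"

definition hilb :: "(nat \<times> nat) set \<Rightarrow> nat \<Rightarrow> rat fps" where
  "hilb E n = Abs_fps (\<lambda>d. of_nat (hdim E n d))"

definition qint :: "nat \<Rightarrow> rat fps" where
  "qint k = (\<Sum>i<k. fps_X ^ i)"

definition Em_edges :: "nat \<Rightarrow> (nat \<times> nat) set" where
  "Em_edges m = {(i, i+1) | i. 1 \<le> i \<and> i \<le> m - 2} \<union> {(3, m)}"

end

theory Submission
  imports Defs "HOL-Library.Function_Algebras"
begin

text \<open>
  Let \<open>A\<^sub>k\<close> be the algebra defined by the relations on the first \<open>k\<close> edges of the tree, added one at a
  time, and let \<open>K\<^sub>k\<close> be the quotient of \<open>A\<^sub>k\<close> by the left ideal generated by the first \<open>k - 1\<close> edges.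
  Left multiplication tables, in which every entry follows from a single relation, show that \<open>K\<^sub>k\<close> is
  spanned by an explicit finite set \<open>M\<^sub>k\<close> of words (of size 2, 3, 4, 20, 36, 84, 480), hence \<open>A\<^sub>k\<close> by
  \<open>M\<^sub>k \<cdot> M\<^sub>k\<^sub>-\<^sub>1 \<cdots> M\<^sub>1\<close>. For the independence of these products in the Fomin--Kirillov algebra, the
  generators act by braided derivations on functions on words in the pairs of vertices; this gives a
  pairing of words that respects the Fomin--Kirillov relations in its second argument. If \<open>l\<close> is the vertex
  added last, the pairing of words in the letters \<open>(i, l)\<close> with \<open>M\<^sub>k\<close> is nondegenerate, because the
  right derivations with respect to these letters are jointly injective in positive degrees, and the
  pairing is multiplicative for the factorisation of the words. So the two algebras have the same
  basis, whose generating function is the product of those of the \<open>M\<^sub>k\<close>.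
\<close>

section \<open>Functionals on the free algebra\<close>

definition fa_eval :: "('g list \<Rightarrow> rat) \<Rightarrow> 'g fa \<Rightarrow> rat" where
  "fa_eval \<phi> p = (\<Sum>w | p w \<noteq> 0. p w * \<phi> w)"

definition fword :: "'g list \<Rightarrow> 'g fa" where
  "fword u = (\<lambda>w. if w = u then 1 else 0)"

lemma fa_eval_superset:
  assumes "finite A" "{w. p w \<noteq> 0} \<subseteq> A"
  shows "fa_eval \<phi> p = (\<Sum>w\<in>A. p w * \<phi> w)"
  unfolding fa_eval_def by (rule sum.mono_neutral_left) (use assms in auto)

lemma fin_supp_fzero [simp]: "fin_supp fzero"
  by (simp add: fin_supp_def fzero_def)

lemma fin_supp_fword [simp]: "fin_supp (fword u)"
  by (simp add: fin_supp_def fword_def)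

lemma fin_supp_fadd [simp]: "fin_supp p \<Longrightarrow> fin_supp q \<Longrightarrow> fin_supp (fadd p q)"
  unfolding fin_supp_def fadd_def
  by (rule finite_subset[of _ "{w. p w \<noteq> 0} \<union> {w. q w \<noteq> 0}"]) auto

lemma fin_supp_fsc [simp]: "fin_supp p \<Longrightarrow> fin_supp (fsc c p)"
  unfolding fin_supp_def fsc_def by (rule finite_subset[of _ "{w. p w \<noteq> 0}"]) auto

lemma fmul_gen_left:
  "fmul (gen x) p w = (case w of [] \<Rightarrow> 0 | y # v \<Rightarrow> if y = x then p v else 0)"
proof (cases w)
  case Nil
  then show ?thesis by (simp add: fmul_def gen_def)
next
  case (Cons y v)
  have "fmul (gen x) p w = (\<Sum>k\<in>{1::nat}. gen x (take k w) * p (drop k w))"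
    unfolding fmul_def
  proof (rule sum.mono_neutral_right)
    show "\<forall>i\<in>{0..length w} - {1}. gen x (take i w) * p (drop i w) = 0"
    proof
      fix i assume i: "i \<in> {0..length w} - {1}"
      then have "length (take i w) \<noteq> length [x]" by simp
      then have "take i w \<noteq> [x]" by metis
      then show "gen x (take i w) * p (drop i w) = 0" by (simp add: gen_def)
    qed
  qed (use Cons in auto)
  then show ?thesis using Cons by (simp add: gen_def)
qed

lemma fmul_gen_right:
  "fmul p (gen x) w = (if w \<noteq> [] \<and> last w = x then p (butlast w) else 0)"
proof (cases w rule: rev_cases)
  case Nil
  then show ?thesis by (simp add: fmul_def gen_def)
next
  case (snoc v y)
  have "fmul p (gen x) w = (\<Sum>k\<in>{length v}. p (take k w) * gen x (drop k w))"
    unfolding fmul_def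
  proof (rule sum.mono_neutral_right)
    show "\<forall>i\<in>{0..length w} - {length v}. p (take i w) * gen x (drop i w) = 0"
    proof
      fix i assume i: "i \<in> {0..length w} - {length v}"
      then have "length (drop i w) \<noteq> length [x]" using snoc by auto
      then have "drop i w \<noteq> [x]" by metis
      then show "p (take i w) * gen x (drop i w) = 0" by (simp add: gen_def)
    qed
  qed (use snoc in auto)
  then show ?thesis using snoc by (simp add: gen_def)
qed

lemma supp_fmul_gen_left: "{w. fmul (gen x) p w \<noteq> 0} = (#) x ` {w. p w \<noteq> 0}"
proof (intro set_eqI iffI)
  fix w assume "w \<in> {w. fmul (gen x) p w \<noteq> 0}"
  then show "w \<in> (#) x ` {w. p w \<noteq> 0}"
    by (cases w) (auto simp: fmul_gen_left split: if_splits)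
qed (auto simp: fmul_gen_left)

lemma supp_fmul_gen_right: "{w. fmul p (gen x) w \<noteq> 0} = (\<lambda>w. w @ [x]) ` {w. p w \<noteq> 0}"
proof (intro set_eqI iffI)
  fix w assume "w \<in> {w. fmul p (gen x) w \<noteq> 0}"
  then show "w \<in> (\<lambda>w. w @ [x]) ` {w. p w \<noteq> 0}"
    by (cases w rule: rev_cases) (auto simp: fmul_gen_right split: if_splits)
qed (auto simp: fmul_gen_right)

lemma fin_supp_fmul_gen [simp]:
  "fin_supp p \<Longrightarrow> fin_supp (fmul (gen x) p)" "fin_supp p \<Longrightarrow> fin_supp (fmul p (gen x))"
  unfolding fin_supp_def supp_fmul_gen_left supp_fmul_gen_right by auto

lemma fa_eval_fzero [simp]: "fa_eval \<phi> fzero = 0"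
  by (simp add: fa_eval_def fzero_def)

lemma fa_eval_fword [simp]: "fa_eval \<phi> (fword u) = \<phi> u"
  by (subst fa_eval_superset[of "{u}"]) (auto simp: fword_def)

lemma fa_eval_fadd [simp]:
  assumes "fin_supp p" "fin_supp q"
  shows "fa_eval \<phi> (fadd p q) = fa_eval \<phi> p + fa_eval \<phi> q"
proof -
  let ?A = "{w. p w \<noteq> 0} \<union> {w. q w \<noteq> 0}"
  have fin: "finite ?A" using assms by (simp add: fin_supp_def)
  have "fa_eval \<phi> (fadd p q) = (\<Sum>w\<in>?A. fadd p q w * \<phi> w)"
    by (rule fa_eval_superset[OF fin]) (auto simp: fadd_def)
  also have "\<dots> = (\<Sum>w\<in>?A. p w * \<phi> w) + (\<Sum>w\<in>?A. q w * \<phi> w)"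
    by (simp add: fadd_def algebra_simps sum.distrib)
  also have "\<dots> = fa_eval \<phi> p + fa_eval \<phi> q"
    by (subst (1 2) fa_eval_superset[OF fin]) auto
  finally show ?thesis .
qed

lemma fa_eval_fsc [simp]:
  assumes "fin_supp p"
  shows "fa_eval \<phi> (fsc c p) = c * fa_eval \<phi> p"
proof -
  have fin: "finite {w. p w \<noteq> 0}" using assms by (simp add: fin_supp_def)
  have "fa_eval \<phi> (fsc c p) = (\<Sum>w | p w \<noteq> 0. fsc c p w * \<phi> w)"
    by (rule fa_eval_superset[OF fin]) (auto simp: fsc_def)
  then show ?thesis by (simp add: fa_eval_def fsc_def sum_distrib_left mult.assoc)
qed

lemma fa_eval_gen_left [simp]:
  "fa_eval \<phi> (fmul (gen x) p) = fa_eval (\<lambda>w. \<phi> (x # w)) p"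
  unfolding fa_eval_def supp_fmul_gen_left
  by (subst sum.reindex) (auto simp: fmul_gen_left)

lemma fa_eval_gen_right [simp]:
  "fa_eval \<phi> (fmul p (gen x)) = fa_eval (\<lambda>w. \<phi> (w @ [x])) p"
  unfolding fa_eval_def supp_fmul_gen_right
  by (subst sum.reindex) (auto simp: fmul_gen_right inj_on_def)

lemma gen_ideal_fin_supp:
  assumes "\<And>r. r \<in> R \<Longrightarrow> fin_supp r" "p \<in> gen_ideal L R"
  shows "fin_supp p"
  using assms(2) by induction (use assms(1) in auto)

definition annihilates :: "'g set \<Rightarrow> 'g fa set \<Rightarrow> ('g list \<Rightarrow> rat) \<Rightarrow> bool" where
  "annihilates L R \<phi> \<longleftrightarrow> (\<forall>r\<in>R. \<forall>u\<in>lists L. \<forall>v\<in>lists L. fa_eval (\<lambda>w. \<phi> (u @ w @ v)) r = 0)"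

lemma annihilates_Cons:
  assumes "annihilates L R \<phi>" "x \<in> L"
  shows "annihilates L R (\<lambda>w. \<phi> (x # w))"
  unfolding annihilates_def
proof (intro ballI)
  fix r u v assume "r \<in> R" "u \<in> lists L" "v \<in> lists L"
  moreover have "x # u \<in> lists L" using \<open>u \<in> lists L\<close> assms by simp
  ultimately have "fa_eval (\<lambda>w. \<phi> ((x # u) @ w @ v)) r = 0"
    using assms(1) unfolding annihilates_def by blast
  then show "fa_eval (\<lambda>w. \<phi> (x # u @ w @ v)) r = 0" by simp
qed

lemma annihilates_snoc:
  assumes "annihilates L R \<phi>" "x \<in> L"
  shows "annihilates L R (\<lambda>w. \<phi> (w @ [x]))"
  unfolding annihilates_def
proof (intro ballI)
  fix r u v assume "r \<in> R" "u \<in> lists L" "v \<in> lists L"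
  moreover have "v @ [x] \<in> lists L" using \<open>v \<in> lists L\<close> assms by auto
  ultimately have "fa_eval (\<lambda>w. \<phi> (u @ w @ v @ [x])) r = 0"
    using assms(1) unfolding annihilates_def by blast
  then show "fa_eval (\<lambda>w. \<phi> ((u @ w @ v) @ [x])) r = 0" by simp
qed

lemma fa_eval_gen_ideal:
  assumes "\<And>r. r \<in> R \<Longrightarrow> fin_supp r" "p \<in> gen_ideal L R" "annihilates L R \<phi>"
  shows "fa_eval \<phi> p = 0"
  using assms(2,3)
proof (induction arbitrary: \<phi>)
  case (gi_gen r)
  then have "fa_eval (\<lambda>w. \<phi> ([] @ w @ [])) r = 0"
    unfolding annihilates_def by blast
  then show ?case by simp
next
  case (gi_add p q)
  then show ?case using gen_ideal_fin_supp[OF assms(1)] by simp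
next
  case (gi_sc p c)
  then show ?case using gen_ideal_fin_supp[OF assms(1)] by simp
qed (simp_all add: annihilates_Cons annihilates_snoc)

lemma fadd_eq_plus: "fadd p q = p + q"
  by (simp add: fadd_def plus_fun_def)

interpretation fa: vector_space "fsc :: rat \<Rightarrow> 'g fa \<Rightarrow> 'g fa"
  by unfold_locales (auto simp: fsc_def algebra_simps plus_fun_def)

lemma subspace_gen_ideal: "fa.subspace (gen_ideal L R)"
proof (rule fa.subspaceI)
  show "0 \<in> gen_ideal L R"
    using gi_zero[of L R] by (simp add: fzero_def zero_fun_def)
next
  show "p + q \<in> gen_ideal L R" if "p \<in> gen_ideal L R" "q \<in> gen_ideal L R" for p q
    using gi_add[OF that] by (simp add: fadd_eq_plus)
next
  show "fsc c p \<in> gen_ideal L R" if "p \<in> gen_ideal L R" for c p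
    using that by (rule gi_sc)
qed

lemma linear_eq_fa_eval:
  assumes "Vector_Spaces.linear fsc (*) f" "fin_supp p"
  shows "f p = fa_eval (\<lambda>w. f (fword w)) p"
proof -
  interpret Vector_Spaces.linear "fsc :: rat \<Rightarrow> 'a fa \<Rightarrow> 'a fa" "(*) :: rat \<Rightarrow> rat \<Rightarrow> rat" f
    by (rule assms)
  have fin: "finite {w. p w \<noteq> 0}" using assms(2) by (simp add: fin_supp_def)
  have "p = (\<Sum>w | p w \<noteq> 0. fsc (p w) (fword w))"
  proof
    fix v
    have "(\<Sum>w | p w \<noteq> 0. fsc (p w) (fword w)) v = (\<Sum>w | p w \<noteq> 0. fsc (p w) (fword w) v)"
      using fin by (induction rule: finite_induct) auto
    also have "\<dots> = (\<Sum>w | p w \<noteq> 0. if w = v then p w else 0)"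
      by (rule sum.cong) (auto simp: fsc_def fword_def)
    also have "\<dots> = p v" using fin by (simp add: sum.delta)
    finally show "p v = (\<Sum>w | p w \<noteq> 0. fsc (p w) (fword w)) v" by simp
  qed
  then have "f p = f (\<Sum>w | p w \<noteq> 0. fsc (p w) (fword w))" by simp
  also have "\<dots> = (\<Sum>w | p w \<noteq> 0. p w * f (fword w))"
    by (simp add: sum scale)
  finally show ?thesis by (simp add: fa_eval_def)
qed

lemma gen_ideal_span_separation:
  assumes R: "\<And>r. r \<in> R \<Longrightarrow> fin_supp r" and p: "fin_supp p"
    and ann: "\<And>\<phi>. annihilates L R \<phi> \<Longrightarrow> (\<And>w. w \<in> N \<Longrightarrow> \<phi> w = 0) \<Longrightarrow> fa_eval \<phi> p = 0"
  shows "p \<in> fa.span (gen_ideal L R \<union> fword ` N)"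
proof (rule ccontr)
  interpret fa_pair: vector_space_pair "fsc :: rat \<Rightarrow> 'a fa \<Rightarrow> 'a fa" "(*) :: rat \<Rightarrow> rat \<Rightarrow> rat"
    by unfold_locales (simp_all add: algebra_simps)
  let ?G = "gen_ideal L R \<union> fword ` N"
  assume np: "p \<notin> fa.span ?G"
  obtain B where B: "B \<subseteq> ?G" "fa.independent B" "?G \<subseteq> fa.span B"
    using fa.maximal_independent_subset by blast
  have pB: "p \<notin> fa.span B" using np B(1) fa.span_mono by blast
  then have ind: "fa.independent (insert p B)"
    using B(2) by (simp add: fa.independent_insert fa.span_base)
  obtain f where f: "Vector_Spaces.linear fsc (*) f"
      "\<And>x. x \<in> insert p B \<Longrightarrow> f x = (if x = p then 1 else 0 :: rat)"
    using fa_pair.linear_independent_extend[OF ind, of "\<lambda>x. if x = p then 1 else 0"] by blast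
  have "p \<notin> B" using pB by (blast intro: fa.span_base)
  then have "\<And>x. x \<in> B \<Longrightarrow> f x = 0" using f(2) by auto
  then have f0: "f q = 0" if "q \<in> ?G" for q
    using fa_pair.linear_eq_0_on_span[OF f(1), of B q] that B(3) by blast
  define \<phi> where "\<phi> w = f (fword w)" for w
  have base: "fa_eval \<phi> q = 0" if "q \<in> gen_ideal L R" for q
    using linear_eq_fa_eval[OF f(1) gen_ideal_fin_supp[OF R that]] f0 that
    unfolding \<phi>_def by simp
  have right: "fa_eval (\<lambda>w. \<phi> (w @ v)) q = 0" if "q \<in> gen_ideal L R" "v \<in> lists L" for q v
    using that
  proof (induction v arbitrary: q)
    case (Cons x v)
    then have "fmul q (gen x) \<in> gen_ideal L R" "v \<in> lists L"
      by (simp_all add: gi_right)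
    then have "fa_eval (\<lambda>w. \<phi> (w @ v)) (fmul q (gen x)) = 0"
      by (rule Cons.IH)
    then show ?case by simp
  qed (simp add: base)
  have left: "fa_eval (\<lambda>w. \<phi> (u @ w @ v)) q = 0"
    if "q \<in> gen_ideal L R" "u \<in> lists L" "v \<in> lists L" for q u v
    using that
  proof (induction u arbitrary: q rule: rev_induct)
    case (snoc x u)
    then have "fmul (gen x) q \<in> gen_ideal L R" "u \<in> lists L"
      by (simp_all add: gi_left)
    then have "fa_eval (\<lambda>w. \<phi> (u @ w @ v)) (fmul (gen x) q) = 0"
      using snoc.IH snoc.prems(3) by blast
    then show ?case by simp
  qed (simp add: right)
  have "annihilates L R \<phi>"
    unfolding annihilates_def using left gi_gen by blast
  then have "fa_eval \<phi> p = 0" by (rule ann) (use f0 in \<open>auto simp: \<phi>_def\<close>)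
  moreover have "fa_eval \<phi> p = f p"
    using linear_eq_fa_eval[OF f(1) p] unfolding \<phi>_def by simp
  ultimately show False using f(2)[of p] by simp
qed

lemma gen_ideal_separation:
  assumes "\<And>r. r \<in> R \<Longrightarrow> fin_supp r" "fin_supp p" "\<And>\<phi>. annihilates L R \<phi> \<Longrightarrow> fa_eval \<phi> p = 0"
  shows "p \<in> gen_ideal L R"
proof -
  have "p \<in> fa.span (gen_ideal L R)"
    using gen_ideal_span_separation[of R p L "{}"] assms by simp
  then show ?thesis using fa.span_minimal[OF subset_refl subspace_gen_ideal[of L R]] by blast
qed

section \<open>Braided derivations and the word pairing\<close>

definition swapv :: "'a \<times> 'a \<Rightarrow> 'a \<Rightarrow> 'a" where
  "swapv f x = (if x = fst f then snd f else if x = snd f then fst f else x)"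

definition refl_pair :: "'a \<times> 'a \<Rightarrow> 'a \<times> 'a \<Rightarrow> 'a \<times> 'a" where
  "refl_pair f e = (swapv f (fst e), swapv f (snd e))"

definition br :: "'a \<times> 'a \<Rightarrow> 'a \<times> 'a \<Rightarrow> int" where
  "br e f = (if e = f then 1 else if e = (snd f, fst f) then -1 else 0)"

lemma swapv_eq_iff [simp]: "swapv f x = swapv f y \<longleftrightarrow> x = y"
  by (auto simp: swapv_def)

lemma swapv_swapv [simp]: "swapv f (swapv f x) = x"
  by (auto simp: swapv_def)

text \<open>The operators representing the generators \<open>x\<^sub>i\<^sub>j\<close> on functions on words in the vertex pairs:
  \<open>Dop e\<close> deletes, in all possible ways, a letter equal to \<open>\<plusminus>e\<close> after \<open>e\<close> has been moved past the
  letters in front of it, each of which acts on \<open>e\<close> as a transposition of the vertices.\<close>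

fun Dop :: "'a \<times> 'a \<Rightarrow> (('a \<times> 'a) list \<Rightarrow> rat) \<Rightarrow> ('a \<times> 'a) list \<Rightarrow> rat" where
  "Dop e \<phi> [] = 0"
| "Dop e \<phi> (f # u) = of_int (br e f) * \<phi> u + Dop (refl_pair f e) (\<lambda>v. \<phi> (f # v)) u"

lemma Dop_local:
  assumes "\<And>v. set v \<subseteq> set u \<Longrightarrow> Suc (length v) = length u \<Longrightarrow> \<phi> v = \<psi> v"
  shows "Dop e \<phi> u = Dop e \<psi> u"
  using assms
proof (induction u arbitrary: e \<phi> \<psi>)
  case (Cons f u)
  have "Dop (refl_pair f e) (\<lambda>v. \<phi> (f # v)) u = Dop (refl_pair f e) (\<lambda>v. \<psi> (f # v)) u"
    by (rule Cons.IH, rule Cons.prems) auto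
  moreover have "\<phi> u = \<psi> u" by (rule Cons.prems) auto
  ultimately show ?case by simp
qed simp

lemma Dop_zero [simp]: "Dop e (\<lambda>v. 0) u = 0"
  by (induction u arbitrary: e) auto

lemma Dop_add: "Dop e (\<lambda>v. \<phi> v + \<psi> v) u = Dop e \<phi> u + Dop e \<psi> u"
  by (induction u arbitrary: e \<phi> \<psi>) (auto simp: algebra_simps)

lemma Dop_scale: "Dop e (\<lambda>v. c * \<phi> v) u = c * Dop e \<phi> u"
  by (induction u arbitrary: e \<phi>) (simp_all add: distrib_left mult.left_commute)

lemma Dop_scale_right: "Dop e (\<lambda>v. \<phi> v * c) u = Dop e \<phi> u * c"
  by (induction u arbitrary: e \<phi>) (simp_all add: distrib_right)

lemma br_swap: "i \<noteq> j \<Longrightarrow> br (j, i) f = - br (i, j) f"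
proof -
  assume "i \<noteq> j"
  moreover have "br (i, j) f = (if f = (i, j) then 1 else if f = (j, i) then -1 else 0)" for i j
    unfolding br_def by (cases f) auto
  ultimately show ?thesis by simp
qed

lemma Dop_swap: "i \<noteq> j \<Longrightarrow> Dop (j, i) \<phi> u = - Dop (i, j) \<phi> u"
proof (induction u arbitrary: i j \<phi>)
  case (Cons f u)
  have "br (j, i) f = - br (i, j) f" using Cons.prems by (rule br_swap)
  moreover have "Dop (swapv f j, swapv f i) (\<lambda>v. \<phi> (f # v)) u
      = - Dop (swapv f i, swapv f j) (\<lambda>v. \<phi> (f # v)) u"
    by (rule Cons.IH) (use Cons.prems in simp)
  ultimately show ?case by (simp add: refl_pair_def)
qed simp

lemma Dop_nilpotent: "i \<noteq> j \<Longrightarrow> Dop (i, j) (Dop (i, j) \<phi>) u = 0"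
proof (induction u arbitrary: i j \<phi>)
  case (Cons f u)
  have "of_int (br (i, j) f) * (Dop (i, j) \<phi> u + Dop (refl_pair f (i, j)) \<phi> u) = 0"
  proof (cases "br (i, j) f = 0")
    case False
    then have "f = (i, j) \<or> f = (j, i)" by (cases f) (auto simp: br_def split: if_splits)
    then have "refl_pair f (i, j) = (j, i)" by (auto simp: refl_pair_def swapv_def)
    then show ?thesis using Dop_swap[OF Cons.prems] by simp
  qed simp
  then show ?case
    using Cons by (simp add: Dop_add Dop_scale refl_pair_def distrib_left)
qed simp

lemma br_refl_pair_disjoint:
  assumes "{i, j} \<inter> {k, l} = {}" "br (i, j) f \<noteq> 0"
  shows "refl_pair f (k, l) = (k, l)"
  using assms by (cases f) (auto simp: br_def refl_pair_def swapv_def split: if_splits)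

lemma Dop_commute:
  "{i, j} \<inter> {k, l} = {} \<Longrightarrow> Dop (i, j) (Dop (k, l) \<phi>) u = Dop (k, l) (Dop (i, j) \<phi>) u"
proof (induction u arbitrary: i j k l \<phi>)
  case (Cons f u)
  have 1: "of_int (br (i, j) f) * Dop (refl_pair f (k, l)) \<phi> u = of_int (br (i, j) f) * Dop (k, l) \<phi> u"
    using br_refl_pair_disjoint[OF Cons.prems, of f] by (cases "br (i, j) f = 0") simp_all
  have "{k, l} \<inter> {i, j} = {}" using Cons.prems by blast
  then have 2: "of_int (br (k, l) f) * Dop (refl_pair f (i, j)) \<phi> u = of_int (br (k, l) f) * Dop (i, j) \<phi> u"
    using br_refl_pair_disjoint[of k l i j f] by (cases "br (k, l) f = 0") simp_all
  have "{swapv f i, swapv f j} \<inter> {swapv f k, swapv f l} = {}" using Cons.prems by auto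
  then have "Dop (refl_pair f (i, j)) (Dop (refl_pair f (k, l)) (\<lambda>v. \<phi> (f # v))) u
      = Dop (refl_pair f (k, l)) (Dop (refl_pair f (i, j)) (\<lambda>v. \<phi> (f # v))) u"
    unfolding refl_pair_def fst_conv snd_conv by (rule Cons.IH)
  then show ?case by (simp add: Dop_add Dop_scale 1 2)
qed simp

lemma br_three_term:
  assumes "distinct [i, j, k]"
  shows "of_int (br (i, j) f) * (Dop (j, k) \<phi> u + Dop (refl_pair f (k, i)) \<phi> u) = 0"
proof (cases "br (i, j) f = 0")
  case False
  then have "f = (i, j) \<or> f = (j, i)" by (cases f) (auto simp: br_def split: if_splits)
  then have "refl_pair f (k, i) = (k, j)" using assms by (auto simp: refl_pair_def swapv_def)
  then show ?thesis using Dop_swap[of k j \<phi> u] assms by auto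
qed simp

lemma Dop_three_term:
  "distinct [i, j, k] \<Longrightarrow> Dop (i, j) (Dop (j, k) \<phi>) u + Dop (j, k) (Dop (k, i) \<phi>) u
     + Dop (k, i) (Dop (i, j) \<phi>) u = 0"
proof (induction u arbitrary: i j k \<phi>)
  case (Cons f u)
  have d: "distinct [swapv f i, swapv f j, swapv f k]" "distinct [j, k, i]" "distinct [k, i, j]"
    using Cons.prems by auto
  show ?case
    using Cons.IH[OF d(1), of "\<lambda>v. \<phi> (f # v)"] br_three_term[OF Cons.prems, of f \<phi> u]
      br_three_term[OF d(2), of f \<phi> u] br_three_term[OF d(3), of f \<phi> u]
    by (simp add: Dop_add Dop_scale refl_pair_def distrib_left)
qed simp

definition Dops :: "('a \<times> 'a) list \<Rightarrow> (('a \<times> 'a) list \<Rightarrow> rat) \<Rightarrow> ('a \<times> 'a) list \<Rightarrow> rat" where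
  "Dops w \<phi> = foldr Dop w \<phi>"

lemma Dops_simps [simp]: "Dops [] \<phi> = \<phi>" "Dops (e # w) \<phi> = Dop e (Dops w \<phi>)"
  "Dops (v @ w) \<phi> = Dops v (Dops w \<phi>)"
  by (auto simp: Dops_def)

lemma Dops_zero: "Dops w (\<lambda>v. 0) u = 0"
proof (induction w arbitrary: u)
  case (Cons e w)
  have "Dops w (\<lambda>v. 0) = (\<lambda>v. 0)" by (rule ext, rule Cons.IH)
  then show ?case by simp
qed simp

lemma Dops_add: "Dops w (\<lambda>v. \<phi> v + \<psi> v) u = Dops w \<phi> u + Dops w \<psi> u"
proof (induction w arbitrary: u)
  case (Cons e w)
  have "Dops w (\<lambda>v. \<phi> v + \<psi> v) = (\<lambda>v. Dops w \<phi> v + Dops w \<psi> v)" by (rule ext, rule Cons.IH)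
  then show ?case by (simp add: Dop_add)
qed simp

lemma Dops_scale: "Dops w (\<lambda>v. c * \<phi> v) u = c * Dops w \<phi> u"
proof (induction w arbitrary: u)
  case (Cons e w)
  have "Dops w (\<lambda>v. c * \<phi> v) = (\<lambda>v. c * Dops w \<phi> v)" by (rule ext, rule Cons.IH)
  then show ?case by (simp add: Dop_scale)
qed simp

definition pairing :: "('a \<times> 'a) list \<Rightarrow> ('a \<times> 'a) list \<Rightarrow> rat" where
  "pairing u w = Dops w (\<lambda>v. if v = [] then 1 else 0) u"

lemma pairing_Nil [simp]: "pairing u [] = (if u = [] then 1 else 0)"
  by (simp add: pairing_def)

lemma pairing_Cons: "pairing u (e # w) = Dop e (\<lambda>v. pairing v w) u"
  by (simp add: pairing_def)

lemma pairing_append: "pairing u (v @ w) = Dops v (\<lambda>x. pairing x w) u"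
  by (simp add: pairing_def)

lemma pairing_length: "length u \<noteq> length w \<Longrightarrow> pairing u w = 0"
proof (induction w arbitrary: u)
  case (Cons e w)
  have "Dop e (\<lambda>v. pairing v w) u = Dop e (\<lambda>v. 0) u"
    by (rule Dop_local, rule Cons.IH) (use Cons.prems in auto)
  then show ?case by (simp add: pairing_Cons)
qed simp

subsection \<open>Functionals on the Fomin--Kirillov algebra\<close>

definition offdiag :: "'a set \<Rightarrow> ('a \<times> 'a) set" where
  "offdiag V = {(i, j). i \<in> V \<and> j \<in> V \<and> i \<noteq> j}"

definition FK_fun :: "'a set \<Rightarrow> (('a \<times> 'a) list \<Rightarrow> rat) \<Rightarrow> bool" where
  "FK_fun V \<phi> \<longleftrightarrow>
    (\<forall>A B i j. A \<in> lists (offdiag V) \<longrightarrow> B \<in> lists (offdiag V) \<longrightarrow> i \<in> V \<longrightarrow> j \<in> V \<longrightarrow> i \<noteq> j \<longrightarrow>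
        \<phi> (A @ [(j, i)] @ B) = - \<phi> (A @ [(i, j)] @ B) \<and> \<phi> (A @ [(i, j), (i, j)] @ B) = 0) \<and>
    (\<forall>A B i j k l. A \<in> lists (offdiag V) \<longrightarrow> B \<in> lists (offdiag V) \<longrightarrow> {i, j, k, l} \<subseteq> V \<longrightarrow> distinct [i, j, k, l] \<longrightarrow>
        \<phi> (A @ [(i, j), (k, l)] @ B) = \<phi> (A @ [(k, l), (i, j)] @ B)) \<and>
    (\<forall>A B i j k. A \<in> lists (offdiag V) \<longrightarrow> B \<in> lists (offdiag V) \<longrightarrow> {i, j, k} \<subseteq> V \<longrightarrow> distinct [i, j, k] \<longrightarrow>
        \<phi> (A @ [(i, j), (j, k)] @ B) + \<phi> (A @ [(j, k), (k, i)] @ B) + \<phi> (A @ [(k, i), (i, j)] @ B) = 0)"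

lemma FK_fun_pairing: "FK_fun UNIV (pairing u)"
  unfolding FK_fun_def
proof (intro conjI allI impI)
  fix A B :: "('a \<times> 'a) list" and i j k l :: 'a
  assume d: "distinct [i, j, k, l]"
  have "Dop (i, j) (Dop (k, l) (\<lambda>x. pairing x B)) = Dop (k, l) (Dop (i, j) (\<lambda>x. pairing x B))"
    by (rule ext, rule Dop_commute) (use d in auto)
  then show "pairing u (A @ [(i, j), (k, l)] @ B) = pairing u (A @ [(k, l), (i, j)] @ B)"
    by (simp add: pairing_append pairing_Cons)
next
  fix A B :: "('a \<times> 'a) list" and i j :: 'a
  assume d: "i \<noteq> j"
  have "Dop (j, i) (\<lambda>x. pairing x B) = (\<lambda>v. - 1 * Dop (i, j) (\<lambda>x. pairing x B) v)"
    by (rule ext) (simp add: Dop_swap[OF d])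
  then show "pairing u (A @ [(j, i)] @ B) = - pairing u (A @ [(i, j)] @ B)"
    using Dops_scale[of A "- 1" "Dop (i, j) (\<lambda>x. pairing x B)" u]
    by (simp add: pairing_append pairing_Cons)
  have "Dop (i, j) (Dop (i, j) (\<lambda>x. pairing x B)) = (\<lambda>v. 0)"
    by (rule ext) (rule Dop_nilpotent[OF d])
  then show "pairing u (A @ [(i, j), (i, j)] @ B) = 0"
    by (simp add: pairing_append pairing_Cons Dops_zero)
next
  fix A B :: "('a \<times> 'a) list" and i j k :: 'a
  assume d: "distinct [i, j, k]"
  let ?\<phi> = "\<lambda>x. pairing x B"
  have "(\<lambda>v. Dop (i, j) (Dop (j, k) ?\<phi>) v + Dop (j, k) (Dop (k, i) ?\<phi>) v
     + Dop (k, i) (Dop (i, j) ?\<phi>) v) = (\<lambda>v. 0)"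
    by (rule ext) (rule Dop_three_term[OF d])
  then have "Dops A (\<lambda>v. Dop (i, j) (Dop (j, k) ?\<phi>) v + Dop (j, k) (Dop (k, i) ?\<phi>) v
     + Dop (k, i) (Dop (i, j) ?\<phi>) v) u = 0"
    by (simp add: Dops_zero)
  then show "pairing u (A @ [(i, j), (j, k)] @ B) + pairing u (A @ [(j, k), (k, i)] @ B)
      + pairing u (A @ [(k, i), (i, j)] @ B) = 0"
    by (simp add: pairing_append pairing_Cons Dops_add)
qed

lemma FK_fun_D:
  assumes "FK_fun V \<phi>" "A \<in> lists (offdiag V)" "B \<in> lists (offdiag V)"
  shows "i \<in> V \<Longrightarrow> j \<in> V \<Longrightarrow> i \<noteq> j \<Longrightarrow> \<phi> (A @ [(j, i)] @ B) = - \<phi> (A @ [(i, j)] @ B)"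
    and "i \<in> V \<Longrightarrow> j \<in> V \<Longrightarrow> i \<noteq> j \<Longrightarrow> \<phi> (A @ [(i, j), (i, j)] @ B) = 0"
    and "{i, j, k, l} \<subseteq> V \<Longrightarrow> distinct [i, j, k, l] \<Longrightarrow>
      \<phi> (A @ [(i, j), (k, l)] @ B) = \<phi> (A @ [(k, l), (i, j)] @ B)"
    and "{i, j, k} \<subseteq> V \<Longrightarrow> distinct [i, j, k] \<Longrightarrow> \<phi> (A @ [(i, j), (j, k)] @ B)
      + \<phi> (A @ [(j, k), (k, i)] @ B) + \<phi> (A @ [(k, i), (i, j)] @ B) = 0"
  using assms unfolding FK_fun_def by blast+

lemma FK_fun_triangle:
  assumes F: "FK_fun V \<phi>" and A: "A \<in> lists (offdiag V)" and B: "B \<in> lists (offdiag V)"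
    and V: "{j, a, b} \<subseteq> V" "distinct [j, a, b]"
  shows "\<phi> (A @ [(a, b), (j, a)] @ B) = \<phi> (A @ [(j, a), (j, b)] @ B) + \<phi> (A @ [(j, b), (a, b)] @ B)"
proof -
  have mem: "A @ [x] \<in> lists (offdiag V)" "[x] @ B \<in> lists (offdiag V)" if "x \<in> offdiag V" for x
    using A B that by auto
  have V': "(j, a) \<in> offdiag V" "(j, b) \<in> offdiag V" "(b, a) \<in> offdiag V"
    using V by (auto simp: offdiag_def)
  have 1: "\<phi> (A @ [(a, j), (j, b)] @ B) + \<phi> (A @ [(j, b), (b, a)] @ B) + \<phi> (A @ [(b, a), (a, j)] @ B) = 0"
    by (rule FK_fun_D(4)[OF F A B]) (use V in auto)
  have 2: "\<phi> (A @ [(a, j)] @ ([(j, b)] @ B)) = - \<phi> (A @ [(j, a)] @ ([(j, b)] @ B))"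
    by (rule FK_fun_D(1)[OF F A mem(2)[OF V'(2)]]) (use V in auto)
  have 3: "\<phi> ((A @ [(j, b)]) @ [(b, a)] @ B) = - \<phi> ((A @ [(j, b)]) @ [(a, b)] @ B)"
    by (rule FK_fun_D(1)[OF F mem(1)[OF V'(2)] B]) (use V in auto)
  have 4: "\<phi> ((A @ [(b, a)]) @ [(a, j)] @ B) = - \<phi> ((A @ [(b, a)]) @ [(j, a)] @ B)"
    by (rule FK_fun_D(1)[OF F mem(1)[OF V'(3)] B]) (use V in auto)
  have 5: "\<phi> (A @ [(b, a)] @ ([(j, a)] @ B)) = - \<phi> (A @ [(a, b)] @ ([(j, a)] @ B))"
    by (rule FK_fun_D(1)[OF F A mem(2)[OF V'(1)]]) (use V in auto)
  show ?thesis using 1 2 3 4 5 by simp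
qed

lemma FK_fun_braid:
  assumes F: "FK_fun V \<phi>" and A: "A \<in> lists (offdiag V)" and B: "B \<in> lists (offdiag V)"
    and V: "{j, a, b} \<subseteq> V" "distinct [j, a, b]"
  shows "\<phi> (A @ [(j, a), (j, b), (j, a)] @ B) + \<phi> (A @ [(j, b), (j, a), (j, b)] @ B) = 0"
proof -
  have V': "(j, a) \<in> offdiag V" "(j, b) \<in> offdiag V" "(a, b) \<in> offdiag V"
    using V by (auto simp: offdiag_def)
  have "[(j, a)] @ B \<in> lists (offdiag V)" using B V' by auto
  note 1 = FK_fun_triangle[OF F A this V]
  have m: "A @ [(j, b)] \<in> lists (offdiag V)" using A V' by auto
  note 2 = FK_fun_triangle[OF F m B V]
  have 3: "\<phi> ((A @ [(a, b)]) @ [(j, a), (j, a)] @ B) = 0"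
    by (rule FK_fun_D(2)[OF F _ B]) (use A V V' in auto)
  have 4: "\<phi> (A @ [(j, b), (j, b)] @ ([(a, b)] @ B)) = 0"
    by (rule FK_fun_D(2)[OF F A]) (use B V V' in auto)
  show ?thesis using 1 2 3 4 by simp
qed

lemma FK_fun_claw:
  assumes F: "FK_fun V \<phi>" and A: "A \<in> lists (offdiag V)" and B: "B \<in> lists (offdiag V)"
    and V: "{j, a, b, c} \<subseteq> V" "distinct [j, a, b, c]"
  shows "\<phi> (A @ [(j, a), (j, b), (j, c), (j, a)] @ B) + \<phi> (A @ [(j, b), (j, c), (j, a), (j, b)] @ B)
     + \<phi> (A @ [(j, c), (j, a), (j, b), (j, c)] @ B) = 0"
proof -
  let ?P = "(j, a)" and ?Q = "(j, b)" and ?S = "(j, c)" and ?R = "(a, b)"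
  have L: "?P \<in> offdiag V" "?Q \<in> offdiag V" "?S \<in> offdiag V" "?R \<in> offdiag V"
    using V by (auto simp: offdiag_def)
  have V1: "{j, a, b} \<subseteq> V" "distinct [j, a, b]" "{j, a, c} \<subseteq> V" "distinct [j, a, c]"
    "{j, b, c} \<subseteq> V" "distinct [j, b, c]" "{a, b, j, c} \<subseteq> V" "distinct [a, b, j, c]"
    using V by auto
  have m: "[?S, ?P] @ B \<in> lists (offdiag V)" "A @ [?Q, ?S] \<in> lists (offdiag V)"
    "A @ [?S] \<in> lists (offdiag V)" "[?S] @ B \<in> lists (offdiag V)" "A @ [?Q] \<in> lists (offdiag V)"
    "[?P] @ B \<in> lists (offdiag V)" "[?P, ?S] @ B \<in> lists (offdiag V)" "A @ [?R] \<in> lists (offdiag V)"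
    "A @ [?S, ?Q] \<in> lists (offdiag V)" "[?R] @ B \<in> lists (offdiag V)"
    using A B L by auto
  note tri = FK_fun_triangle[OF F A m(1) V1(1,2)] FK_fun_triangle[OF F m(2) B V1(1,2)]
    FK_fun_triangle[OF F m(3,4) V1(1,2)]
  note com = FK_fun_D(3)[OF F m(5,6) V1(7,8)] FK_fun_D(3)[OF F A m(7) V1(7,8)]
    FK_fun_D(3)[OF F m(9) B V1(7,8)]
  note braid = FK_fun_braid[OF F m(8) B V1(3,4)] FK_fun_braid[OF F A m(10) V1(5,6)]
  show ?thesis using tri com braid by simp
qed

subsection \<open>Permutations, last letters and products in the pairing\<close>

fun word_perm :: "('a \<times> 'a) list \<Rightarrow> 'a \<Rightarrow> 'a" where
  "word_perm [] x = x"
| "word_perm (f # u) x = word_perm u (swapv f x)"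

lemma swapv_conj: "swapv f (swapv (refl_pair f e) (swapv f x)) = swapv e x"
  by (auto simp: swapv_def refl_pair_def)

lemma Dop_word_perm:
  assumes "\<And>v. \<phi> v \<noteq> 0 \<Longrightarrow> word_perm v = \<pi>" "Dop e \<phi> u \<noteq> 0"
  shows "word_perm u x = \<pi> (swapv e x)"
  using assms
proof (induction u arbitrary: e \<phi> \<pi> x)
  case (Cons f u)
  show ?case
  proof (cases "of_int (br e f) * \<phi> u = 0")
    case False
    then have "e = f \<or> e = (snd f, fst f)" "\<phi> u \<noteq> 0" by (auto simp: br_def split: if_splits)
    moreover from this(1) have "swapv f = swapv e" by (auto simp: swapv_def)
    ultimately show ?thesis using Cons.prems(1)[of u] by simp
  next
    case True
    then have nz: "Dop (refl_pair f e) (\<lambda>v. \<phi> (f # v)) u \<noteq> 0" using Cons.prems(2) by auto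
    have *: "word_perm v = (\<lambda>x. \<pi> (swapv f x))" if "\<phi> (f # v) \<noteq> 0" for v
    proof
      fix x show "word_perm v x = \<pi> (swapv f x)"
        using Cons.prems(1)[OF that, symmetric] by simp
    qed
    have "word_perm u (swapv f x) = \<pi> (swapv f (swapv (refl_pair f e) (swapv f x)))"
      by (rule Cons.IH[OF * nz])
    then show ?thesis by (simp add: swapv_conj)
  qed
qed simp

lemma pairing_word_perm: "pairing u w \<noteq> 0 \<Longrightarrow> word_perm u = word_perm w"
proof (induction w arbitrary: u)
  case Nil
  then show ?case by (auto split: if_splits)
next
  case (Cons e w)
  show ?case
  proof
    fix x
    have "word_perm u x = word_perm w (swapv e x)"
      by (rule Dop_word_perm[OF Cons.IH]) (use Cons.prems in \<open>auto simp: pairing_Cons\<close>)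
    then show "word_perm u x = word_perm (e # w) x" by simp
  qed
qed

lemma Dop_append:
  "Dop e \<phi> (u @ v) = Dop e (\<lambda>x. \<phi> (x @ v)) u
     + Dop (word_perm u (fst e), word_perm u (snd e)) (\<lambda>x. \<phi> (u @ x)) v"
  by (induction u arbitrary: e \<phi>) (auto simp: refl_pair_def)

lemma pairing_snoc_Cons:
  "pairing (u @ [f]) (e # w) = Dop e (\<lambda>x. pairing (x @ [f]) w) u
     + of_int (br (word_perm w (fst e), word_perm w (snd e)) f) * pairing u w"
  using pairing_word_perm[of u w] by (cases "pairing u w = 0") (simp_all add: pairing_Cons Dop_append)

lemma pairing_avoid:
  assumes "\<And>e. e \<in> set w \<Longrightarrow> fst e \<noteq> snd f \<and> snd e \<noteq> snd f"
  shows "pairing (f # u) w = 0"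
  using assms
proof (induction w arbitrary: u)
  case (Cons e w)
  then have "(\<lambda>v. pairing (f # v) w) = (\<lambda>v. 0)" by simp
  moreover have "br e f = 0" using Cons.prems[of e] by (auto simp: br_def)
  ultimately show ?case by (simp add: pairing_Cons)
qed simp

lemma pairing_product:
  assumes "\<And>e. e \<in> set b \<Longrightarrow> fst e \<noteq> l \<and> snd e \<noteq> l"
    and "\<And>f. f \<in> set u \<Longrightarrow> snd f = l" and "length y \<le> length u"
  shows "pairing (u @ v) (y @ b) = pairing u y * pairing v b"
  using assms(2,3)
proof (induction y arbitrary: u v)
  case Nil
  show ?case
  proof (cases u)
    case (Cons f u')
    then show ?thesis using pairing_avoid[of b f "u' @ v"] assms(1) Nil.prems(1)[of f] by simp
  qed simp
next
  case (Cons e y)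
  have 1: "pairing (u @ x) (y @ b) = 0" for x
    using Cons.IH[of u x] Cons.prems pairing_length[of u y] by simp
  have "Dop e (\<lambda>x. pairing (x @ v) (y @ b)) u = Dop e (\<lambda>x. pairing x y * pairing v b) u"
    by (rule Dop_local, rule Cons.IH) (use Cons.prems in auto)
  then show ?case
    using 1 by (simp add: pairing_Cons Dop_append Dop_scale_right)
qed

lemma pairing_snoc_avoid:
  assumes "fst h \<noteq> l" "snd h \<noteq> l" "\<And>f. f \<in> set u \<Longrightarrow> snd f = l"
  shows "pairing u (y @ [h]) = 0"
proof (cases "length u = Suc (length y)")
  case True
  then show ?thesis
    using pairing_product[of "[h]" l u y "[]"] pairing_length[of u y] assms by simp
next
  case False
  then show ?thesis by (simp add: pairing_length)
qed

section \<open>Certificates\<close>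

text \<open>The letters \<open>e = 0, 1, 2, \<dots>\<close> are the edges \<open>edge e\<close>. A certificate for \<open>k\<close> describes the quotient of the
  algebra on the letters below \<open>k\<close> by the left ideal generated by the letters below \<open>k - 1\<close>, degree by
  degree. A level consists of one \<open>step\<close> for each letter \<open>e\<close> and each basis word \<open>w\<^sub>i\<close> of the current degree,
  which says how to obtain \<open>e w\<^sub>i\<close>: it is a new basis word (\<open>New\<close>), it lies in the left ideal (\<open>Kill\<close>,
  in degree 0 only), or it is solved for in the relation of \<open>e\<close> and \<open>f\<close>, or a claw relation, multiplied
  on the right by the basis word with the given index in the appropriate lower degree. The argument
  \<open>hs\<close> holds the tables of left multiplication in the previous degrees, the latest first. The second
  component of a level lists pivots \<open>(i, f, t)\<close> which show that the right derivations with respect to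
  the letters \<open>(f, k)\<close> are jointly injective on the new degree.\<close>

definition edge :: "nat \<Rightarrow> nat \<times> nat" where
  "edge e = (if e = 3 then (2, 4) else (e, Suc e))"

definition disjoint_edges :: "nat \<Rightarrow> nat \<Rightarrow> bool" where
  "disjoint_edges e f \<longleftrightarrow> fst (edge e) \<noteq> fst (edge f) \<and> fst (edge e) \<noteq> snd (edge f)
     \<and> snd (edge e) \<noteq> fst (edge f) \<and> snd (edge e) \<noteq> snd (edge f)"

definition pair_rel :: "nat \<Rightarrow> nat \<Rightarrow> (int \<times> nat list) list" where
  "pair_rel e f =
     (if e = f then [(1, [e, e])]
      else if disjoint_edges e f then [(1, [e, f]), (-1, [f, e])]
      else [(1, [e, f, e]), (if fst (edge e) = fst (edge f) then 1 else -1, [f, e, f])])"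

definition claw_rel :: "bool \<Rightarrow> (int \<times> nat list) list" where
  "claw_rel b = (if b then [(1, [1,2,3,1]), (-1, [2,3,1,2]), (-1, [3,1,2,3])]
                 else [(1, [1,3,2,1]), (-1, [3,2,1,3]), (-1, [2,1,3,2])])"

type_synonym vec = "(int \<times> nat) list"

datatype step = New | Rel nat nat | Claw bool nat | Kill

type_synonym certificate = "(step list list \<times> (nat \<times> nat \<times> nat) list) list"

fun vec_ins :: "int \<Rightarrow> nat \<Rightarrow> vec \<Rightarrow> vec" where
  "vec_ins c j [] = (if c = 0 then [] else [(c, j)])"
| "vec_ins c j (x # v) =
     (if j = snd x then (if c + fst x = 0 then v else (c + fst x, j) # v) else x # vec_ins c j v)"

fun vec_add :: "int \<Rightarrow> vec \<Rightarrow> vec \<Rightarrow> vec" where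
  "vec_add c [] w = w"
| "vec_add c (x # v) w = vec_ins (c * fst x) (snd x) (vec_add c v w)"

fun row_app :: "vec list \<Rightarrow> vec \<Rightarrow> vec" where
  "row_app r [] = []"
| "row_app r (x # v) = vec_add (fst x) (r ! snd x) (row_app r v)"

fun word_app :: "vec list list list \<Rightarrow> nat list \<Rightarrow> nat \<Rightarrow> vec" where
  "word_app hs [] w = [(1, w)]"
| "word_app [] (a # as) w = []"
| "word_app (T # hs) (a # as) w = row_app (T ! a) (word_app hs as w)"

fun expand :: "vec list list list \<Rightarrow> (int \<times> nat list) list \<Rightarrow> nat \<Rightarrow> (int \<times> nat \<times> nat) list" where
  "expand hs [] w = []"
| "expand hs (t # r) w =
     map (\<lambda>x. (fst t * fst x, hd (snd t), snd x)) (word_app hs (tl (snd t)) w) @ expand hs r w"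

fun coeff_at :: "(int \<times> nat \<times> nat) list \<Rightarrow> nat \<Rightarrow> nat \<Rightarrow> int" where
  "coeff_at [] e i = 0"
| "coeff_at (t # ts) e i = (if fst (snd t) = e \<and> snd (snd t) = i then fst t + coeff_at ts e i else coeff_at ts e i)"

fun solve :: "vec list list \<Rightarrow> vec list \<Rightarrow> nat \<Rightarrow> int \<Rightarrow> (int \<times> nat \<times> nat) list \<Rightarrow> nat \<Rightarrow> vec option" where
  "solve rows cur e s [] i = Some []"
| "solve rows cur e s (t # ts) i =
    (case solve rows cur e s ts i of None \<Rightarrow> None | Some v \<Rightarrow>
      (if fst (snd t) = e then
         (if snd (snd t) = i then Some v
          else if snd (snd t) < i then Some (vec_add (- s * fst t) (cur ! snd (snd t)) v)
          else None)
       else if fst (snd t) < e then Some (vec_add (- s * fst t) (rows ! fst (snd t) ! snd (snd t)) v)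
       else None))"

definition rel_entry :: "vec list list list \<Rightarrow> vec list list \<Rightarrow> vec list \<Rightarrow> nat \<Rightarrow> nat \<Rightarrow> (int \<times> nat list) list \<Rightarrow> nat \<Rightarrow> vec option" where
  "rel_entry hs rows cur e i r w =
     (let L = length (snd (hd r)) in
      if L - 2 < length hs \<and> w < length (hd (hs ! (L - 2))) then
      (let tot = expand hs r w; s = coeff_at tot e i in
       if s = 1 \<or> s = -1 then solve rows cur e s tot i else None) else None)"

fun step_entry :: "nat \<Rightarrow> vec list list list \<Rightarrow> vec list list \<Rightarrow> vec list \<Rightarrow> nat \<Rightarrow> nat \<Rightarrow> nat \<Rightarrow> step \<Rightarrow> vec option" where
  "step_entry k hs rows cur e i nb New = Some [(1, nb)]"
| "step_entry k hs rows cur e i nb Kill = (if hs = [] \<and> Suc e < k then Some [] else None)"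
| "step_entry k hs rows cur e i nb (Rel f w) = (if f < k then rel_entry hs rows cur e i (pair_rel e f) w else None)"
| "step_entry k hs rows cur e i nb (Claw b w) = (if 3 < k then rel_entry hs rows cur e i (claw_rel b) w else None)"

fun build_row :: "nat \<Rightarrow> vec list list list \<Rightarrow> vec list list \<Rightarrow> nat \<Rightarrow> vec list \<Rightarrow> nat \<Rightarrow> nat \<Rightarrow> step list \<Rightarrow> (vec list \<times> nat) option" where
  "build_row k hs rows e cur i nb [] = Some (cur, nb)"
| "build_row k hs rows e cur i nb (st # sts) =
     (case step_entry k hs rows cur e i nb st of None \<Rightarrow> None
      | Some v \<Rightarrow> build_row k hs rows e (cur @ [v]) (Suc i) (if st = New then Suc nb else nb) sts)"

fun build_rows :: "nat \<Rightarrow> vec list list list \<Rightarrow> nat \<Rightarrow> vec list list \<Rightarrow> nat \<Rightarrow> nat \<Rightarrow> step list list \<Rightarrow> vec list list option" where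
  "build_rows k hs n rows e nb [] = (if e = k then Some rows else None)"
| "build_rows k hs n rows e nb (sts # r) =
     (if length sts = n then
       (case build_row k hs rows e [] 0 nb sts of None \<Rightarrow> None
        | Some p \<Rightarrow> build_rows k hs n (rows @ [fst p]) (Suc e) (snd p) r) else None)"

fun row_news :: "nat \<Rightarrow> nat \<Rightarrow> step list \<Rightarrow> (nat \<times> nat) list" where
  "row_news e i [] = []"
| "row_news e i (st # sts) = (if st = New then (e, i) # row_news e (Suc i) sts else row_news e (Suc i) sts)"

fun level_news :: "nat \<Rightarrow> step list list \<Rightarrow> (nat \<times> nat) list" where
  "level_news e [] = []"
| "level_news e (sts # r) = row_news e 0 sts @ level_news (Suc e) r"

definition swap_list :: "nat list \<Rightarrow> nat \<Rightarrow> nat list" where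
  "swap_list p e = p[fst (edge e) := p ! snd (edge e), snd (edge e) := p ! fst (edge e)]"

definition table_row :: "vec list list list \<Rightarrow> nat \<Rightarrow> vec list" where
  "table_row hs e = (case hs of [] \<Rightarrow> [] | T # hs' \<Rightarrow> T ! e)"

definition delta_row :: "nat \<Rightarrow> vec list list list \<Rightarrow> vec list \<Rightarrow> nat list list \<Rightarrow> (nat \<times> nat) list \<Rightarrow> nat \<Rightarrow> vec list" where
  "delta_row k hs Df ps news f = map (\<lambda>x. vec_ins (br (ps ! snd x ! fst (edge (fst x)), ps ! snd x ! snd (edge (fst x))) (f, k)) (snd x)
      (row_app (table_row hs (fst x)) (Df ! snd x))) news"

fun delta_rows :: "nat \<Rightarrow> vec list list list \<Rightarrow> vec list list \<Rightarrow> nat list list \<Rightarrow> (nat \<times> nat) list \<Rightarrow> nat \<Rightarrow> vec list list" where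
  "delta_rows k hs [] ps news f = []"
| "delta_rows k hs (Df # D) ps news f = delta_row k hs Df ps news f # delta_rows k hs D ps news (Suc f)"

fun vec_at :: "vec \<Rightarrow> nat \<Rightarrow> int" where
  "vec_at [] t = 0"
| "vec_at (x # v) t = (if snd x = t then fst x + vec_at v t else vec_at v t)"

fun pivots_ok :: "nat \<Rightarrow> vec list list \<Rightarrow> (nat \<times> nat \<times> nat) list \<Rightarrow> bool" where
  "pivots_ok k D [] = True"
| "pivots_ok k D (p # ps) = (fst (snd p) < k \<and>
      vec_at (D ! fst (snd p) ! fst p) (snd (snd p)) \<noteq> 0 \<and>
      list_all (\<lambda>q. vec_at (D ! fst (snd p) ! fst q) (snd (snd p)) = 0) ps \<and> pivots_ok k D ps)"

fun run :: "nat \<Rightarrow> vec list list list \<Rightarrow> nat \<Rightarrow> vec list list \<Rightarrow> nat list list \<Rightarrow> certificate \<Rightarrow> bool" where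
  "run k hs n D ps [] = (n = 0)"
| "run k hs n D ps (l # ls) =
    (case build_rows k hs n [] 0 0 (fst l) of None \<Rightarrow> False
     | Some T \<Rightarrow>
       (let news = level_news 0 (fst l); D' = delta_rows k hs D ps news 0 in
         pivots_ok k D' (snd l) \<and> list_all (\<lambda>i. i \<in> set (map fst (snd l))) [0..<length news]
         \<and> run k (T # take 2 hs) (length news) D' (map (\<lambda>x. swap_list (ps ! snd x) (fst x)) news) ls))"

definition check :: "nat \<Rightarrow> certificate \<Rightarrow> bool" where
  "check k ls = run k [] 1 (replicate k [[]]) [[0..<Suc k]] ls"

section \<open>Soundness of the certificates\<close>

definition rel_eval :: "(nat list \<Rightarrow> rat) \<Rightarrow> (int \<times> nat list) list \<Rightarrow> nat list \<Rightarrow> rat" where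
  "rel_eval \<phi> r v = (\<Sum>t\<leftarrow>r. of_int (fst t) * \<phi> (snd t @ v))"

definition ann_rel :: "nat \<Rightarrow> (nat list \<Rightarrow> rat) \<Rightarrow> bool" where
  "ann_rel k \<phi> \<longleftrightarrow> (\<forall>u\<in>lists {..<k}. \<forall>v\<in>lists {..<k}.
     (\<forall>e<k. \<forall>f<k. rel_eval (\<lambda>w. \<phi> (u @ w)) (pair_rel e f) v = 0) \<and>
     (3 < k \<longrightarrow> (\<forall>b. rel_eval (\<lambda>w. \<phi> (u @ w)) (claw_rel b) v = 0)))"

text \<open>Functionals on the quotient of the algebra on the letters below \<open>k\<close> by the left ideal generated
  by the letters below \<open>k - 1\<close>.\<close>

definition ann_left :: "nat \<Rightarrow> (nat list \<Rightarrow> rat) \<Rightarrow> bool" where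
  "ann_left k \<phi> \<longleftrightarrow> ann_rel k \<phi> \<and> (\<forall>u\<in>lists {..<k}. \<forall>h. Suc h < k \<longrightarrow> \<phi> (u @ [h]) = 0)"

lemma ann_rel_Cons:
  assumes "ann_rel k \<phi>" "e < k"
  shows "ann_rel k (\<lambda>w. \<phi> (e # w))"
  unfolding ann_rel_def
proof (intro ballI)
  fix u v assume "u \<in> lists {..<k}" "v \<in> lists {..<k}"
  moreover from this(1) have "e # u \<in> lists {..<k}" using assms by simp
  ultimately have "(\<forall>e'<k. \<forall>f<k. rel_eval (\<lambda>w. \<phi> ((e # u) @ w)) (pair_rel e' f) v = 0) \<and>
     (3 < k \<longrightarrow> (\<forall>b. rel_eval (\<lambda>w. \<phi> ((e # u) @ w)) (claw_rel b) v = 0))"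
    using assms(1) unfolding ann_rel_def by blast
  then show "(\<forall>e'<k. \<forall>f<k. rel_eval (\<lambda>w. \<phi> (e # u @ w)) (pair_rel e' f) v = 0) \<and>
     (3 < k \<longrightarrow> (\<forall>b. rel_eval (\<lambda>w. \<phi> (e # u @ w)) (claw_rel b) v = 0))"
    by simp
qed

lemma ann_left_Cons:
  assumes "ann_left k \<phi>" "e < k"
  shows "ann_left k (\<lambda>w. \<phi> (e # w))"
  unfolding ann_left_def
proof (intro conjI ballI allI impI)
  show "ann_rel k (\<lambda>w. \<phi> (e # w))"
    using assms by (auto simp: ann_left_def intro: ann_rel_Cons)
  fix u h assume "u \<in> lists {..<k}" "Suc h < k"
  then have "e # u \<in> lists {..<k}" using assms by simp
  then have "\<phi> ((e # u) @ [h]) = 0"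
    using assms(1) \<open>Suc h < k\<close> unfolding ann_left_def by blast
  then show "\<phi> (e # u @ [h]) = 0" by simp
qed

definition vec_eval :: "(nat \<Rightarrow> rat) \<Rightarrow> vec \<Rightarrow> rat" where
  "vec_eval g v = (\<Sum>x\<leftarrow>v. of_int (fst x) * g (snd x))"

lemma vec_eval_simps [simp]:
  "vec_eval g [] = 0" "vec_eval g (x # v) = of_int (fst x) * g (snd x) + vec_eval g v"
  by (simp_all add: vec_eval_def)

lemma vec_eval_ins [simp]: "vec_eval g (vec_ins c j v) = of_int c * g j + vec_eval g v"
proof (induction v)
  case (Cons x v)
  show ?case
  proof (cases "j = snd x \<and> c + fst x = 0")
    case True
    then have c: "c = - fst x" and j: "j = snd x" by auto
    show ?thesis unfolding c j by simp
  next
    case False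
    then show ?thesis using Cons by (auto simp: distrib_right)
  qed
qed simp

lemma vec_eval_add [simp]: "vec_eval g (vec_add c v w) = of_int c * vec_eval g v + vec_eval g w"
  by (induction v) (simp_all add: distrib_left mult.assoc)

lemma vec_eval_row_app: "vec_eval g (row_app r v) = vec_eval (\<lambda>j. vec_eval g (r ! j)) v"
  by (induction v) auto

lemma vec_eval_cong:
  assumes "\<And>j. j \<in> snd ` set v \<Longrightarrow> g j = h j"
  shows "vec_eval g v = vec_eval h v"
  using assms by (induction v) auto

lemma vec_ins_bound: "j < n \<Longrightarrow> snd ` set v \<subseteq> {..<n} \<Longrightarrow> snd ` set (vec_ins c j v) \<subseteq> {..<n}"
  by (induction v) auto

lemma vec_add_bound:
  "snd ` set v \<subseteq> {..<n} \<Longrightarrow> snd ` set w \<subseteq> {..<n} \<Longrightarrow> snd ` set (vec_add c v w) \<subseteq> {..<n}"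
  by (induction v) (simp_all add: vec_ins_bound)

lemma row_app_bound:
  assumes "\<And>j. j \<in> snd ` set v \<Longrightarrow> snd ` set (r ! j) \<subseteq> {..<n}"
  shows "snd ` set (row_app r v) \<subseteq> {..<n}"
  using assms by (induction v) (simp_all add: vec_add_bound)

lemma vec_at_outside: "snd ` set v \<subseteq> {..<n} \<Longrightarrow> vec_at v t \<noteq> 0 \<Longrightarrow> t < n"
  by (induction v) (auto split: if_splits)

lemma vec_eval_vec_at:
  assumes "snd ` set v \<subseteq> {..<n}"
  shows "vec_eval g v = (\<Sum>t<n. of_int (vec_at v t) * g t)"
  using assms
proof (induction v)
  case (Cons x v)
  have "(\<Sum>t<n. of_int (vec_at (x # v) t) * g t)
      = (\<Sum>t<n. (if snd x = t then of_int (fst x) * g t else 0) + of_int (vec_at v t) * g t)"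
    by (rule sum.cong) (auto simp: algebra_simps)
  also have "\<dots> = of_int (fst x) * g (snd x) + (\<Sum>t<n. of_int (vec_at v t) * g t)"
    using Cons.prems by (simp add: sum.distrib sum.delta)
  finally show ?case using Cons by simp
qed simp

subsection \<open>Left multiplication tables\<close>

definition entry_ok :: "nat \<Rightarrow> nat list list \<Rightarrow> nat list list \<Rightarrow> nat \<Rightarrow> nat \<Rightarrow> vec \<Rightarrow> bool" where
  "entry_ok k W W' e i v \<longleftrightarrow> snd ` set v \<subseteq> {..<length W'} \<and>
     (\<forall>\<phi>. ann_left k \<phi> \<longrightarrow> \<phi> (e # W ! i) = vec_eval (\<lambda>j. \<phi> (W' ! j)) v)"

definition table_ok :: "nat \<Rightarrow> nat list list \<Rightarrow> nat list list \<Rightarrow> vec list list \<Rightarrow> bool" where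
  "table_ok k W W' T \<longleftrightarrow> length T = k \<and>
     (\<forall>e<k. length (T ! e) = length W \<and> (\<forall>i<length W. entry_ok k W W' e i (T ! e ! i)))"

fun hist_ok :: "nat \<Rightarrow> vec list list list \<Rightarrow> nat list list list \<Rightarrow> bool" where
  "hist_ok k [] Ws \<longleftrightarrow> Ws \<noteq> []"
| "hist_ok k (T # hs) (W' # W # Ws) \<longleftrightarrow> table_ok k W W' T \<and> hist_ok k hs (W # Ws)"
| "hist_ok k (T # hs) Ws \<longleftrightarrow> False"

lemma hist_ok_take: "hist_ok k hs Ws \<Longrightarrow> hist_ok k (take n hs) Ws"
proof (induction k hs Ws arbitrary: n rule: hist_ok.induct)
  case (2 k T hs W' W Ws)
  then show ?case by (cases n) auto
qed auto

lemma hist_ok_nonempty: "hist_ok k hs Ws \<Longrightarrow> Ws \<noteq> []"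
  by (induction k hs Ws rule: hist_ok.induct) auto

lemma hist_ok_nth:
  "hist_ok k hs Ws \<Longrightarrow> n < length hs \<Longrightarrow> table_ok k (Ws ! Suc n) (Ws ! n) (hs ! n)"
proof (induction k hs Ws arbitrary: n rule: hist_ok.induct)
  case (2 k T hs W' W Ws)
  then show ?case by (cases n) auto
qed auto

lemma word_app_sound:
  assumes "hist_ok k hs Ws" "length as \<le> length hs" "set as \<subseteq> {..<k}" "w < length (Ws ! length as)"
  shows "snd ` set (word_app hs as w) \<subseteq> {..<length (hd Ws)} \<and> (\<forall>\<phi>. ann_left k \<phi> \<longrightarrow>
    \<phi> (as @ Ws ! length as ! w) = vec_eval (\<lambda>j. \<phi> (hd Ws ! j)) (word_app hs as w))"
  using assms
proof (induction as arbitrary: hs Ws)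
  case Nil
  then have "Ws \<noteq> []" by (auto dest: hist_ok_nonempty)
  then show ?case using Nil by (simp add: hd_conv_nth)
next
  case (Cons a as)
  obtain T hs' where hs: "hs = T # hs'" using Cons.prems(2) by (cases hs) auto
  obtain W' W Ws' where Ws: "Ws = W' # W # Ws'"
    using Cons.prems(1) unfolding hs by (metis hist_ok.simps(3,4) list.exhaust)
  have t: "table_ok k W W' T" and h: "hist_ok k hs' (W # Ws')"
    using Cons.prems(1) by (simp_all add: hs Ws)
  have a: "a < k" using Cons.prems(3) by simp
  let ?v = "word_app hs' as w"
  have "snd ` set ?v \<subseteq> {..<length (hd (W # Ws'))} \<and> (\<forall>\<phi>. ann_left k \<phi> \<longrightarrow>
      \<phi> (as @ (W # Ws') ! length as ! w) = vec_eval (\<lambda>j. \<phi> (hd (W # Ws') ! j)) ?v)"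
    by (rule Cons.IH[OF h]) (use Cons.prems in \<open>auto simp: hs Ws\<close>)
  then have b: "snd ` set ?v \<subseteq> {..<length W}"
    and ev: "\<And>\<phi>. ann_left k \<phi> \<Longrightarrow> \<phi> (as @ (W # Ws') ! length as ! w) = vec_eval (\<lambda>j. \<phi> (W ! j)) ?v"
    by auto
  have e: "entry_ok k W W' a j (T ! a ! j)" if "j \<in> snd ` set ?v" for j
    using t a b that unfolding table_ok_def by blast
  show ?case
  proof (intro conjI allI impI)
    show "snd ` set (word_app hs (a # as) w) \<subseteq> {..<length (hd Ws)}"
      unfolding hs Ws word_app.simps list.sel
      by (rule row_app_bound) (use e in \<open>simp add: entry_ok_def\<close>)
    fix \<phi> assume \<phi>: "ann_left k \<phi>"
    have "\<phi> (a # as @ (W # Ws') ! length as ! w) = vec_eval (\<lambda>j. \<phi> (a # W ! j)) ?v"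
      using ev[OF ann_left_Cons[OF \<phi> a]] .
    also have "\<dots> = vec_eval (\<lambda>j. vec_eval (\<lambda>t. \<phi> (W' ! t)) (T ! a ! j)) ?v"
      by (rule vec_eval_cong) (use e \<phi> in \<open>auto simp: entry_ok_def\<close>)
    finally show "\<phi> ((a # as) @ Ws ! length (a # as) ! w)
        = vec_eval (\<lambda>j. \<phi> (hd Ws ! j)) (word_app hs (a # as) w)"
      by (simp add: hs Ws vec_eval_row_app)
  qed
qed

definition term_sum :: "(nat \<Rightarrow> nat \<Rightarrow> rat) \<Rightarrow> (int \<times> nat \<times> nat) list \<Rightarrow> rat" where
  "term_sum g ts = (\<Sum>t\<leftarrow>ts. of_int (fst t) * g (fst (snd t)) (snd (snd t)))"

lemma term_sum_simps [simp]:
  "term_sum g [] = 0"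
  "term_sum g (t # ts) = of_int (fst t) * g (fst (snd t)) (snd (snd t)) + term_sum g ts"
  "term_sum g (ts @ ts') = term_sum g ts + term_sum g ts'"
  by (simp_all add: term_sum_def)

lemma term_sum_map:
  "term_sum g (map (\<lambda>x. (c * fst x, a, snd x)) v) = of_int c * vec_eval (g a) v"
  by (induction v) (simp_all add: distrib_left mult.assoc)

definition rel_wf :: "nat \<Rightarrow> nat \<Rightarrow> (int \<times> nat list) list \<Rightarrow> bool" where
  "rel_wf k L r \<longleftrightarrow> (\<forall>t\<in>set r. length (snd t) = L \<and> set (snd t) \<subseteq> {..<k})"

lemma expand_sound:
  assumes "hist_ok k hs Ws" "rel_wf k (Suc L) r" "L \<le> length hs" "w < length (Ws ! L)"
  shows "(\<forall>t\<in>set (expand hs r w). fst (snd t) < k \<and> snd (snd t) < length (hd Ws)) \<and>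
    (\<forall>\<phi>. ann_left k \<phi> \<longrightarrow> rel_eval \<phi> r (Ws ! L ! w) = term_sum (\<lambda>a j. \<phi> (a # hd Ws ! j)) (expand hs r w))"
  using assms(2)
proof (induction r)
  case Nil
  then show ?case by (simp add: rel_eval_def)
next
  case (Cons t r)
  obtain c a as where t: "t = (c, a # as)" and as: "length as = L" "set as \<subseteq> {..<k}" "a < k"
    using Cons.prems unfolding rel_wf_def by (cases t; cases "snd t") auto
  have "w < length (Ws ! length as)" "length as \<le> length hs" using assms as by auto
  note s = word_app_sound[OF assms(1) this(2) as(2) this(1)]
  have IH: "\<forall>t\<in>set (expand hs r w). fst (snd t) < k \<and> snd (snd t) < length (hd Ws)"
    "\<And>\<phi>. ann_left k \<phi> \<Longrightarrow> rel_eval \<phi> r (Ws ! L ! w) = term_sum (\<lambda>a j. \<phi> (a # hd Ws ! j)) (expand hs r w)"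
    using Cons by (auto simp: rel_wf_def)
  show ?case
  proof (intro conjI allI impI)
    show "\<forall>t\<in>set (expand hs (t # r) w). fst (snd t) < k \<and> snd (snd t) < length (hd Ws)"
      using IH(1) s as(3) by (fastforce simp: t)
    fix \<phi> assume \<phi>: "ann_left k \<phi>"
    have "\<phi> (a # as @ Ws ! L ! w) = vec_eval (\<lambda>j. \<phi> (a # hd Ws ! j)) (word_app hs as w)"
      using s ann_left_Cons[OF \<phi> as(3)] as(1) by blast
    then show "rel_eval \<phi> (t # r) (Ws ! L ! w) = term_sum (\<lambda>a j. \<phi> (a # hd Ws ! j)) (expand hs (t # r) w)"
      using IH(2)[OF \<phi>] by (simp add: t term_sum_map rel_eval_def)
  qed
qed

lemma solve_sound:
  assumes "solve rows cur e s ts i = Some v"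
    and "\<And>a x. a < e \<Longrightarrow> x < n \<Longrightarrow> g a x = vec_eval G (rows ! a ! x) \<and> snd ` set (rows ! a ! x) \<subseteq> {..<N}"
    and "\<And>x. x < i \<Longrightarrow> g e x = vec_eval G (cur ! x) \<and> snd ` set (cur ! x) \<subseteq> {..<N}"
    and "\<forall>t\<in>set ts. snd (snd t) < n"
  shows "snd ` set v \<subseteq> {..<N} \<and>
    vec_eval G v = - of_int s * (term_sum g ts - of_int (coeff_at ts e i) * g e i)"
  using assms(1,4)
proof (induction ts arbitrary: v)
  case (Cons t ts)
  obtain w where w: "solve rows cur e s ts i = Some w"
    using Cons.prems(1) by (auto split: option.splits)
  have IH: "snd ` set w \<subseteq> {..<N}"
    "vec_eval G w = - of_int s * (term_sum g ts - of_int (coeff_at ts e i) * g e i)"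
    using Cons.IH[OF w] Cons.prems by auto
  obtain c a x where t: "t = (c, a, x)" by (cases t)
  have x: "x < n" using Cons.prems(2) by (simp add: t)
  consider "a = e" "x = i" | "a = e" "x < i" | "a < e"
    using Cons.prems(1) by (auto simp: w t split: if_splits)
  then show ?case
  proof cases
    case 1
    then have v: "v = w" using Cons.prems(1) unfolding t by (simp add: w)
    have "coeff_at (t # ts) e i = c + coeff_at ts e i" "term_sum g (t # ts) = of_int c * g e i + term_sum g ts"
      using 1 by (simp_all add: t)
    then show ?thesis using IH unfolding v by (simp add: distrib_right)
  next
    case 2
    then have v: "v = vec_add (- s * c) (cur ! x) w" using Cons.prems(1) unfolding t by (simp add: w)
    have "coeff_at (t # ts) e i = coeff_at ts e i" "term_sum g (t # ts) = of_int c * g e x + term_sum g ts"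
      using 2 by (simp_all add: t)
    then show ?thesis using IH assms(3)[OF 2(2)] unfolding v
      by (simp add: vec_add_bound right_diff_distrib distrib_left)
  next
    case 3
    then have v: "v = vec_add (- s * c) (rows ! a ! x) w"
      using Cons.prems(1) unfolding t by (simp add: w)
    have "coeff_at (t # ts) e i = coeff_at ts e i" "term_sum g (t # ts) = of_int c * g a x + term_sum g ts"
      using 3 by (simp_all add: t)
    then show ?thesis using IH assms(2)[OF 3 x] unfolding v
      by (simp add: vec_add_bound right_diff_distrib distrib_left)
  qed
qed simp

lemma rel_wf_pair_rel:
  assumes "e < k" "f < k"
  shows "\<exists>L. length (snd (hd (pair_rel e f))) = Suc (Suc L) \<and> rel_wf k (Suc (Suc L)) (pair_rel e f)"
  using assms by (auto simp: pair_rel_def rel_wf_def)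

lemma rel_wf_claw_rel:
  assumes "3 < k"
  shows "\<exists>L. length (snd (hd (claw_rel b))) = Suc (Suc L) \<and> rel_wf k (Suc (Suc L)) (claw_rel b)"
  using assms by (auto simp: claw_rel_def rel_wf_def)

lemma ann_left_rel_eval:
  assumes "ann_left k \<phi>" "v \<in> lists {..<k}"
  shows "e < k \<Longrightarrow> f < k \<Longrightarrow> rel_eval \<phi> (pair_rel e f) v = 0"
    and "3 < k \<Longrightarrow> rel_eval \<phi> (claw_rel b) v = 0"
proof -
  have "[] \<in> lists {..<k}" by simp
  then have "(\<forall>e<k. \<forall>f<k. rel_eval (\<lambda>w. \<phi> ([] @ w)) (pair_rel e f) v = 0) \<and>
     (3 < k \<longrightarrow> (\<forall>b. rel_eval (\<lambda>w. \<phi> ([] @ w)) (claw_rel b) v = 0))"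
    using assms unfolding ann_left_def ann_rel_def by blast
  then show "e < k \<Longrightarrow> f < k \<Longrightarrow> rel_eval \<phi> (pair_rel e f) v = 0"
    and "3 < k \<Longrightarrow> rel_eval \<phi> (claw_rel b) v = 0" by auto
qed

lemma rel_entry_sound:
  assumes re: "rel_entry hs rows cur e i r w = Some v"
    and h: "hist_ok k hs Ws" and k: "0 < k"
    and wf: "length (snd (hd r)) = Suc (Suc L)" "rel_wf k (Suc (Suc L)) r"
    and W: "\<forall>W\<in>set Ws. \<forall>x\<in>set W. x \<in> lists {..<k}"
    and r0: "\<And>\<phi> x. ann_left k \<phi> \<Longrightarrow> x \<in> lists {..<k} \<Longrightarrow> rel_eval \<phi> r x = 0"
    and rows: "\<And>a x. a < e \<Longrightarrow> x < length (hd Ws) \<Longrightarrow> entry_ok k (hd Ws) W' a x (rows ! a ! x)"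
    and cur: "\<And>x. x < i \<Longrightarrow> entry_ok k (hd Ws) W' e x (cur ! x)"
  shows "entry_ok k (hd Ws) W' e i v"
proof -
  define tot where "tot = expand hs r w"
  define s where "s = coeff_at tot e i"
  have L: "L < length hs" "w < length (hd (hs ! L))" and s: "s = 1 \<or> s = -1"
    and sol: "solve rows cur e s tot i = Some v"
    using re wf(1) by (auto simp: rel_entry_def Let_def tot_def s_def split: if_splits)
  have t: "table_ok k (Ws ! Suc L) (Ws ! L) (hs ! L)" by (rule hist_ok_nth[OF h L(1)])
  then have "length (hd (hs ! L)) = length (Ws ! Suc L)"
    using k unfolding table_ok_def by (metis hd_conv_nth length_greater_0_conv)
  then have w: "w < length (Ws ! Suc L)" using L(2) by simp
  have LW: "Suc L < length Ws"
    using h L(1)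
  proof (induction k hs Ws arbitrary: L rule: hist_ok.induct)
    case (2 k T hs W' W Ws)
    then show ?case by (cases L) auto
  qed auto
  have x: "Ws ! Suc L ! w \<in> lists {..<k}" using W LW w by (meson nth_mem)
  have "Suc L \<le> length hs" using L by simp
  note ex = expand_sound[OF h wf(2) this w, folded tot_def]
  have main: "snd ` set v \<subseteq> {..<length W'} \<and> \<phi> (e # hd Ws ! i) = vec_eval (\<lambda>j. \<phi> (W' ! j)) v"
    if \<phi>: "ann_left k \<phi>" for \<phi>
  proof -
    let ?g = "\<lambda>a j. \<phi> (a # hd Ws ! j)" and ?G = "\<lambda>j. \<phi> (W' ! j)"
    have "snd ` set v \<subseteq> {..<length W'} \<and>
      vec_eval ?G v = - of_int s * (term_sum ?g tot - of_int (coeff_at tot e i) * ?g e i)"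
      by (rule solve_sound[OF sol, where n = "length (hd Ws)"])
        (use rows cur \<phi> ex in \<open>auto simp: entry_ok_def\<close>)
    moreover have "term_sum ?g tot = 0" using ex \<phi> r0[OF \<phi> x] by metis
    ultimately show ?thesis using s unfolding s_def[symmetric] by auto
  qed
  have "ann_left k (\<lambda>x. 0)"
  proof -
    have "rel_eval (\<lambda>w. 0) r v = 0" for r v
      unfolding rel_eval_def by (induction r) auto
    then show ?thesis by (simp add: ann_left_def ann_rel_def)
  qed
  then show ?thesis using main unfolding entry_ok_def by blast
qed

definition next_words :: "nat list list \<Rightarrow> step list list \<Rightarrow> nat list list" where
  "next_words W l = map (\<lambda>x. fst x # W ! snd x) (level_news 0 l)"

lemma build_row_sound:
  assumes "build_row k hs rows e cur i nb sts = Some (row, nb')"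
    and h: "hist_ok k hs Ws" and k: "e < k"
    and W: "\<forall>W\<in>set Ws. \<forall>x\<in>set W. x \<in> lists {..<k}"
    and init: "hs = [] \<Longrightarrow> hd Ws = [[]]"
    and rows: "\<And>a x. a < e \<Longrightarrow> x < length (hd Ws) \<Longrightarrow> entry_ok k (hd Ws) W' a x (rows ! a ! x)"
    and "\<And>x. x < i \<Longrightarrow> entry_ok k (hd Ws) W' e x (cur ! x)"
    and "length cur = i" "i + length sts = length (hd Ws)"
    and "W' = map (\<lambda>x. fst x # hd Ws ! snd x) (pre @ row_news e i sts @ rest)" "length pre = nb"
  shows "length row = length (hd Ws) \<and> nb' = nb + length (row_news e i sts) \<and>
    (\<forall>x<length (hd Ws). entry_ok k (hd Ws) W' e x (row ! x))"
  using assms(1,7-)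
proof (induction sts arbitrary: cur i nb pre)
  case (Cons st sts)
  obtain v where v: "step_entry k hs rows cur e i nb st = Some v"
    and b: "build_row k hs rows e (cur @ [v]) (Suc i) (if st = New then Suc nb else nb) sts = Some (row, nb')"
    using Cons.prems(1) by (auto split: option.splits)
  have ok: "entry_ok k (hd Ws) W' e i v"
  proof (cases st)
    case New
    have "W' ! nb = e # hd Ws ! i" "nb < length W'"
      using Cons.prems(5,6) by (auto simp: New nth_append)
    then show ?thesis using v by (auto simp: New entry_ok_def)
  next
    case Kill
    then have "hs = []" "Suc e < k" "v = []" using v by (auto split: if_splits)
    moreover have "\<phi> ([] @ [e]) = 0" if "ann_left k \<phi>" for \<phi>
    proof -
      have "[] \<in> lists {..<k}" by simp
      then show ?thesis using that \<open>Suc e < k\<close> unfolding ann_left_def by blast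
    qed
    moreover have "i = 0" "hd Ws = [[]]" using init[OF \<open>hs = []\<close>] Cons.prems(4) by auto
    ultimately show ?thesis by (auto simp: entry_ok_def)
  next
    case (Rel f w)
    then have f: "f < k" and re: "rel_entry hs rows cur e i (pair_rel e f) w = Some v"
      using v by (auto split: if_splits)
    obtain L where L: "length (snd (hd (pair_rel e f))) = Suc (Suc L)" "rel_wf k (Suc (Suc L)) (pair_rel e f)"
      using rel_wf_pair_rel[OF k f] by blast
    show ?thesis
      by (rule rel_entry_sound[OF re h _ L W _ rows Cons.prems(2)])
        (use k f in \<open>auto intro: ann_left_rel_eval\<close>)
  next
    case (Claw b w)
    then have f: "3 < k" and re: "rel_entry hs rows cur e i (claw_rel b) w = Some v"
      using v by (auto split: if_splits)
    obtain L where L: "length (snd (hd (claw_rel b))) = Suc (Suc L)" "rel_wf k (Suc (Suc L)) (claw_rel b)"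
      using rel_wf_claw_rel[OF f] by blast
    show ?thesis
      by (rule rel_entry_sound[OF re h _ L W _ rows Cons.prems(2)])
        (use k f in \<open>auto intro: ann_left_rel_eval\<close>)
  qed
  have cur: "entry_ok k (hd Ws) W' e x ((cur @ [v]) ! x)" if "x < Suc i" for x
    using that Cons.prems(2)[of x] Cons.prems(3) ok by (cases "x = i") (auto simp: nth_append)
  show ?case
  proof (cases "st = New")
    case True
    have "length row = length (hd Ws) \<and> nb' = Suc nb + length (row_news e (Suc i) sts) \<and>
      (\<forall>x<length (hd Ws). entry_ok k (hd Ws) W' e x (row ! x))"
      by (rule Cons.IH[OF _ cur, where pre = "pre @ [(e, i)]"])
        (use b Cons.prems True in auto)
    then show ?thesis using True by simp
  next
    case False
    have "length row = length (hd Ws) \<and> nb' = nb + length (row_news e (Suc i) sts) \<and>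
      (\<forall>x<length (hd Ws). entry_ok k (hd Ws) W' e x (row ! x))"
      by (rule Cons.IH[OF _ cur, where pre = pre])
        (use b Cons.prems False in auto)
    then show ?thesis using False by simp
  qed
qed auto

lemma build_rows_mono: "build_rows k hs n rows e nb l = Some T \<Longrightarrow> e + length l = k"
  by (induction l arbitrary: rows e nb) (fastforce split: if_splits option.splits)+

lemma build_rows_sound:
  assumes "build_rows k hs n rows e nb l = Some T" and n: "n = length (hd Ws)"
    and h: "hist_ok k hs Ws"
    and W: "\<forall>W\<in>set Ws. \<forall>x\<in>set W. x \<in> lists {..<k}"
    and init: "hs = [] \<Longrightarrow> hd Ws = [[]]"
    and "length rows = e"
    and "\<And>a. a < e \<Longrightarrow> length (rows ! a) = length (hd Ws)"
    and "\<And>a x. a < e \<Longrightarrow> x < length (hd Ws) \<Longrightarrow> entry_ok k (hd Ws) W' a x (rows ! a ! x)"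
    and "W' = map (\<lambda>x. fst x # hd Ws ! snd x) (pre @ level_news e l)" "length pre = nb"
  shows "table_ok k (hd Ws) W' T"
  using assms(1,6-)
proof (induction l arbitrary: rows e nb pre)
  case Nil
  then show ?case by (auto simp: table_ok_def split: if_splits)
next
  case (Cons sts l)
  obtain row nb' where len: "length sts = n" and row: "build_row k hs rows e [] 0 nb sts = Some (row, nb')"
    and b: "build_rows k hs n (rows @ [row]) (Suc e) nb' l = Some T"
    using Cons.prems(1) by (auto split: if_splits option.splits)
  have e: "e < k" using build_rows_mono[OF Cons.prems(1)] by simp
  have r: "length row = length (hd Ws) \<and> nb' = nb + length (row_news e 0 sts) \<and>
    (\<forall>x<length (hd Ws). entry_ok k (hd Ws) W' e x (row ! x))"
    by (rule build_row_sound[OF row h e W init Cons.prems(4), where pre = pre and rest = "level_news (Suc e) l"])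
      (use Cons.prems len n in auto)
  show ?case
  proof (rule Cons.IH[OF b, where pre = "pre @ row_news e 0 sts"])
    fix a assume a: "a < Suc e"
    show "length ((rows @ [row]) ! a) = length (hd Ws)"
      using a r Cons.prems(2,3) by (cases "a = e") (auto simp: nth_append)
    show "entry_ok k (hd Ws) W' a x ((rows @ [row]) ! a ! x)" if "x < length (hd Ws)" for x
      using a r that Cons.prems(2,4) by (cases "a = e") (auto simp: nth_append)
  qed (use Cons.prems r in auto)
qed

subsection \<open>Functionals and the relations of a graph\<close>

lemma fmul_fsc_left: "fmul (fsc c p) q = fsc c (fmul p q)"
  by (rule ext) (simp add: fmul_def fsc_def sum_distrib_left mult.assoc)

lemma fmul_one_right: "fmul p (fword []) = p"
proof
  fix w
  have "fmul p (fword []) w = (\<Sum>k\<in>{length w}. p (take k w) * fword [] (drop k w))"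
    unfolding fmul_def by (rule sum.mono_neutral_right) (auto simp: fword_def)
  then show "fmul p (fword []) w = p w" by (simp add: fword_def)
qed

lemma gen_eq_fword: "gen x = fword [x]"
  by (simp add: gen_def fword_def)

definition edge_sign :: "nat \<Rightarrow> nat \<Rightarrow> rat" where
  "edge_sign j a = (if j < a then 1 else -1)"

definition oriented :: "nat \<Rightarrow> nat \<Rightarrow> nat \<times> nat" where
  "oriented j a = (if j < a then (j, a) else (a, j))"

lemma X_eq: "X j a = fsc (edge_sign j a) (gen (oriented j a))"
  by (simp add: X_def edge_sign_def oriented_def fneg_def fsc_def)

lemma fin_supp_X [simp]: "fin_supp (X j a)"
  by (simp add: X_eq gen_eq_fword)

lemma fin_supp_fmul_X [simp]: "fin_supp p \<Longrightarrow> fin_supp (fmul (X j a) p)"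
  by (simp add: X_eq fmul_fsc_left)

lemma fa_eval_X [simp]: "fa_eval \<phi> (X j a) = edge_sign j a * \<phi> [oriented j a]"
  by (simp add: X_eq gen_eq_fword)

lemma fa_eval_fmul_X [simp]:
  "fin_supp p \<Longrightarrow> fa_eval \<phi> (fmul (X j a) p) = edge_sign j a * fa_eval (\<lambda>w. \<phi> (oriented j a # w)) p"
  by (simp add: X_eq fmul_fsc_left)

lemma fin_supp_fneg [simp]: "fin_supp p \<Longrightarrow> fin_supp (fneg p)"
  unfolding fneg_def by (rule fin_supp_fsc)

lemma fa_eval_fneg [simp]: "fin_supp p \<Longrightarrow> fa_eval \<phi> (fneg p) = - fa_eval \<phi> p"
  unfolding fneg_def by (subst fa_eval_fsc) simp_all

lemma fin_supp_G_rels: "r \<in> G_rels E \<Longrightarrow> fin_supp r"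
  by (auto simp: G_rels_def)

fun Xprod :: "(nat \<times> nat) list \<Rightarrow> (nat \<times> nat) fa" where
  "Xprod [] = fword []"
| "Xprod (x # l) = fmul (X (fst x) (snd x)) (Xprod l)"

lemma fin_supp_Xprod [simp]: "fin_supp (Xprod l)"
  by (induction l) auto

lemma fa_eval_Xprod:
  assumes F: "FK_fun V \<phi>" and "A \<in> lists (offdiag V)" and B: "B \<in> lists (offdiag V)"
    and "l \<in> lists (offdiag V)"
  shows "fa_eval (\<lambda>w. \<phi> (A @ w @ B)) (Xprod l) = \<phi> (A @ l @ B)"
  using assms(2,4)
proof (induction l arbitrary: A)
  case (Cons x l)
  obtain j a where x: "x = (j, a)" by (cases x)
  have ja: "j \<in> V" "a \<in> V" "j \<noteq> a" using Cons.prems by (auto simp: x offdiag_def)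
  have o: "A @ [oriented j a] \<in> lists (offdiag V)"
    using Cons.prems ja by (auto simp: oriented_def offdiag_def)
  have "fa_eval (\<lambda>w. \<phi> ((A @ [oriented j a]) @ w @ B)) (Xprod l) = \<phi> ((A @ [oriented j a]) @ l @ B)"
    by (rule Cons.IH[OF o]) (use Cons.prems in auto)
  then have "fa_eval (\<lambda>w. \<phi> (A @ w @ B)) (Xprod (x # l)) = edge_sign j a * \<phi> (A @ [oriented j a] @ (l @ B))"
    by (simp add: x)
  moreover have "\<phi> (A @ [(a, j)] @ (l @ B)) = - \<phi> (A @ [(j, a)] @ (l @ B))"
    by (rule FK_fun_D(1)[OF F]) (use Cons.prems B ja in auto)
  ultimately show ?case by (auto simp: x edge_sign_def oriented_def)
qed simp

lemma FK_fun_annihilates_G_rels: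
  assumes F: "FK_fun V \<phi>" and E: "E \<subseteq> offdiag V"
  shows "annihilates E (G_rels E) \<phi>"
  unfolding annihilates_def
proof (intro ballI)
  fix r A B assume r: "r \<in> G_rels E" and "A \<in> lists E" "B \<in> lists E"
  then have A: "A \<in> lists (offdiag V)" and B: "B \<in> lists (offdiag V)" using E by auto
  have adj: "(j, a) \<in> offdiag V \<and> j \<in> V \<and> a \<in> V \<and> j \<noteq> a" if "adj E j a" for j a
    using that E by (auto simp: adj_def offdiag_def)
  have ev: "fa_eval (\<lambda>w. \<phi> (A @ w @ B)) (Xprod l) = \<phi> (A @ l @ B)" if "set l \<subseteq> offdiag V" for l
    by (rule fa_eval_Xprod[OF F A B]) (use that in auto)
  have adjE: "adj E a b" if "(a, b) \<in> E" for a b using that by (simp add: adj_def)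
  from r consider
    (sq) a b where "r = Xprod [(a, b), (a, b)]" "(a, b) \<in> E"
  | (com) a b c d where "r = fadd (Xprod [(a, b), (c, d)]) (fneg (Xprod [(c, d), (a, b)]))"
      "(a, b) \<in> E" "(c, d) \<in> E" "{a, b} \<inter> {c, d} = {}"
  | (braid) j a b where "r = fadd (Xprod [(j, a), (j, b), (j, a)]) (Xprod [(j, b), (j, a), (j, b)])"
      "adj E j a" "adj E j b" "a \<noteq> b"
  | (claw) j a b c where "r = fadd (fadd (Xprod [(j, a), (j, b), (j, c), (j, a)])
        (Xprod [(j, b), (j, c), (j, a), (j, b)])) (Xprod [(j, c), (j, a), (j, b), (j, c)])"
      "adj E j a" "adj E j b" "adj E j c" "distinct [a, b, c]"
    unfolding G_rels_def by (auto simp: fmul_one_right)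
  then show "fa_eval (\<lambda>w. \<phi> (A @ w @ B)) r = 0"
  proof cases
    case sq
    then show ?thesis
      using adj[OF adjE] FK_fun_D(2)[OF F A B] ev[of "[(a, b), (a, b)]"] by (simp del: Xprod.simps)
  next
    case com
    then have "(a, b) \<in> offdiag V" "(c, d) \<in> offdiag V" using E by auto
    then show ?thesis
      using com FK_fun_D(3)[OF F A B, of a b c d] ev[of "[(a, b), (c, d)]"] ev[of "[(c, d), (a, b)]"]
      by (auto simp: offdiag_def simp del: Xprod.simps)
  next
    case braid
    then show ?thesis
      using adj[OF braid(2)] adj[OF braid(3)] FK_fun_braid[OF F A B, of j a b]
        ev[of "[(j, a), (j, b), (j, a)]"] ev[of "[(j, b), (j, a), (j, b)]"]
      by (auto simp del: Xprod.simps)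
  next
    case claw
    then show ?thesis
      using adj[OF claw(2)] adj[OF claw(3)] adj[OF claw(4)] FK_fun_claw[OF F A B, of j a b c]
        ev[of "[(j, a), (j, b), (j, c), (j, a)]"] ev[of "[(j, b), (j, c), (j, a), (j, b)]"]
        ev[of "[(j, c), (j, a), (j, b), (j, c)]"]
      by (auto simp del: Xprod.simps)
  qed
qed

definition edge_map :: "(nat \<Rightarrow> nat) \<Rightarrow> nat \<Rightarrow> nat \<times> nat" where
  "edge_map \<tau> e = (\<tau> (fst (edge e)), \<tau> (snd (edge e)))"

lemma snd_edge: "snd (edge e) = Suc e"
  by (simp add: edge_def)

lemma edge_bound: "e < k \<Longrightarrow> fst (edge e) \<le> k \<and> snd (edge e) \<le> k \<and> fst (edge e) < snd (edge e)"
  by (auto simp: edge_def)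

lemma annihilates_ann_rel:
  assumes ann: "annihilates E (G_rels E) \<psi>" and E: "\<And>e. e < k \<Longrightarrow> edge_map \<tau> e \<in> E"
    and inj: "inj_on \<tau> {..k}" and ord: "\<And>e. e < k \<Longrightarrow> \<tau> (fst (edge e)) < \<tau> (snd (edge e))"
  shows "ann_rel k (\<lambda>w. \<psi> (map (edge_map \<tau>) w))"
  unfolding ann_rel_def
proof (intro ballI conjI allI impI)
  fix u v assume "u \<in> lists {..<k}" "v \<in> lists {..<k}"
  then have uv: "map (edge_map \<tau>) u \<in> lists E" "map (edge_map \<tau>) v \<in> lists E" using E by auto
  have ev: "fa_eval (\<lambda>w. \<psi> (map (edge_map \<tau>) u @ w @ map (edge_map \<tau>) v)) r = 0" if "r \<in> G_rels E" for r
    using ann that uv unfolding annihilates_def by blast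
  have tau: "\<tau> x = \<tau> y \<longleftrightarrow> x = y" if "x \<le> k" "y \<le> k" for x y
    using inj that by (auto simp: inj_on_def)
  have E': "(\<tau> (fst (edge e)), \<tau> (snd (edge e))) \<in> E" if "e < k" for e
    using E[OF that] by (simp add: edge_map_def)
  have adj: "adj E (\<tau> (fst (edge e))) (\<tau> (snd (edge e)))" "adj E (\<tau> (snd (edge e))) (\<tau> (fst (edge e)))"
    if "e < k" for e using E'[OF that] by (auto simp: adj_def)
  have sg: "edge_sign (\<tau> (fst (edge e))) (\<tau> (snd (edge e))) = 1"
    "edge_sign (\<tau> (snd (edge e))) (\<tau> (fst (edge e))) = -1"
    "oriented (\<tau> (fst (edge e))) (\<tau> (snd (edge e))) = edge_map \<tau> e"
    "oriented (\<tau> (snd (edge e))) (\<tau> (fst (edge e))) = edge_map \<tau> e" if "e < k" for e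
    using ord[OF that] by (auto simp: edge_sign_def oriented_def edge_map_def)
  {
    fix j a b assume "adj E j a" "adj E j b" "a \<noteq> b"
    then have "fadd (fmul (X j a) (fmul (X j b) (X j a))) (fmul (X j b) (fmul (X j a) (X j b))) \<in> G_rels E"
      unfolding G_rels_def by blast
    note ev[OF this]
  } note braid = this
  {
    fix j a b c assume "adj E j a" "adj E j b" "adj E j c" "distinct [a, b, c]"
    then have "fadd (fadd (fmul (X j a) (fmul (X j b) (fmul (X j c) (X j a))))
                 (fmul (X j b) (fmul (X j c) (fmul (X j a) (X j b)))))
          (fmul (X j c) (fmul (X j a) (fmul (X j b) (X j c)))) \<in> G_rels E"
      unfolding G_rels_def by blast
    note ev[OF this]
  } note claw = this
  {
    fix e f assume e: "e < k" and f: "f < k"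
    note le = edge_bound[OF e] edge_bound[OF f]
    show "rel_eval (\<lambda>w. \<psi> (map (edge_map \<tau>) (u @ w))) (pair_rel e f) v = 0"
    proof (cases "e = f")
      case True
      have "fmul (X (\<tau> (fst (edge e))) (\<tau> (snd (edge e)))) (X (\<tau> (fst (edge e))) (\<tau> (snd (edge e)))) \<in> G_rels E"
        unfolding G_rels_def using E'[OF e] by blast
      from ev[OF this] show ?thesis
        using True sg[OF e] by (simp add: pair_rel_def rel_eval_def)
    next
      case ne: False
      show ?thesis
      proof (cases "disjoint_edges e f")
        case True
        let ?a = "\<tau> (fst (edge e))" and ?b = "\<tau> (snd (edge e))" and ?c = "\<tau> (fst (edge f))" and ?d = "\<tau> (snd (edge f))"
        have "{?a, ?b} \<inter> {?c, ?d} = {}"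
          using True tau le by (auto simp: disjoint_edges_def)
        then have "fadd (fmul (X ?a ?b) (X ?c ?d)) (fneg (fmul (X ?c ?d) (X ?a ?b))) \<in> G_rels E"
          unfolding G_rels_def using E'[OF e] E'[OF f] by blast
        from ev[OF this] show ?thesis
          using True ne sg[OF e] sg[OF f] by (simp add: pair_rel_def rel_eval_def)
      next
        case False
        then consider "fst (edge e) = fst (edge f)" | "fst (edge e) = snd (edge f)" | "snd (edge e) = fst (edge f)"
          using ne by (auto simp: disjoint_edges_def snd_edge)
        then show ?thesis
        proof cases
          case 1
          have "\<tau> (snd (edge e)) \<noteq> \<tau> (snd (edge f))" using tau le ne by (simp add: snd_edge)
          from braid[OF adj(1)[OF e] adj(1)[OF f, folded 1] this] show ?thesis
            using False ne sg[OF e] sg[OF f] 1 by (simp add: pair_rel_def rel_eval_def)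
        next
          case 2
          have "\<tau> (snd (edge e)) \<noteq> \<tau> (fst (edge f))" using tau le 2 by force
          from braid[OF adj(1)[OF e] adj(2)[OF f, folded 2] this] show ?thesis
            using False ne sg[OF e] sg[OF f] 2 le by (simp add: pair_rel_def rel_eval_def)
        next
          case 3
          have "\<tau> (fst (edge e)) \<noteq> \<tau> (snd (edge f))" using tau le 3 by force
          from braid[OF adj(2)[OF e] adj(1)[OF f, folded 3] this] show ?thesis
            using False ne sg[OF e] sg[OF f] 3 le by (simp add: pair_rel_def rel_eval_def)
        qed
      qed
    qed
  }
  fix b assume k: "3 < k"
  have k': "1 < k" "2 < k" "3 < k" using k by auto
  have ed: "edge 1 = (1, 2)" "edge 2 = (2, 3)" "edge 3 = (2, 4)" by (simp_all add: edge_def)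
  note S = sg[OF k'(1)] sg[OF k'(2)] sg[OF k'(3)] and A = adj[OF k'(1)] adj[OF k'(2)] adj[OF k'(3)]
  have A': "adj E (\<tau> 2) (\<tau> 1)" "adj E (\<tau> 2) (\<tau> 3)" "adj E (\<tau> 2) (\<tau> 4)"
    using A unfolding ed by simp_all
  have d: "distinct [\<tau> 1, \<tau> 3, \<tau> 4]" "distinct [\<tau> 1, \<tau> 4, \<tau> 3]" using tau k by auto
  have S': "edge_sign (\<tau> 2) (\<tau> 1) = -1" "edge_sign (\<tau> 2) (\<tau> 3) = 1" "edge_sign (\<tau> 2) (\<tau> 4) = 1"
    "oriented (\<tau> 2) (\<tau> 1) = edge_map \<tau> 1" "oriented (\<tau> 2) (\<tau> 3) = edge_map \<tau> 2"
    "oriented (\<tau> 2) (\<tau> 4) = edge_map \<tau> 3"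
    using S unfolding ed by simp_all
  show "rel_eval (\<lambda>w. \<psi> (map (edge_map \<tau>) (u @ w))) (claw_rel b) v = 0"
    using claw[OF A' d(1)] claw[OF A'(1,3,2) d(2)] unfolding claw_rel_def rel_eval_def
    by (cases b) (simp_all add: S' del: One_nat_def)
qed

subsection \<open>Right derivations and independence\<close>

abbreviation edge_word :: "nat list \<Rightarrow> (nat \<times> nat) list" where
  "edge_word \<equiv> map edge"

definition star_word :: "nat \<Rightarrow> (nat \<times> nat) list \<Rightarrow> bool" where
  "star_word k u \<longleftrightarrow> (\<forall>f\<in>set u. snd f = k)"

lemma star_word_simps [simp]:
  "star_word k []" "star_word k (u @ [f]) \<longleftrightarrow> star_word k u \<and> snd f = k"
  by (auto simp: star_word_def)

lemma ann_rel_pairing: "ann_rel k (\<lambda>w. pairing u (edge_word w))"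
proof -
  have "annihilates (edge ` {..<k}) (G_rels (edge ` {..<k})) (pairing u)"
    by (rule FK_fun_annihilates_G_rels[OF FK_fun_pairing]) (auto simp: offdiag_def edge_def)
  then have "ann_rel k (\<lambda>w. pairing u (map (edge_map id) w))"
    by (rule annihilates_ann_rel) (auto simp: edge_map_def edge_def)
  moreover have "edge_map id = edge" by (rule ext) (simp add: edge_map_def)
  ultimately show ?thesis by simp
qed

lemma ann_left_pairing:
  assumes "star_word k u"
  shows "ann_left k (\<lambda>w. pairing u (edge_word w))"
  unfolding ann_left_def
proof (intro conjI ballI allI impI)
  fix v h assume "Suc h < k"
  then have "fst (edge h) \<noteq> k" "snd (edge h) \<noteq> k" by (auto simp: edge_def split: if_splits)
  then show "pairing u (edge_word (v @ [h])) = 0"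
    using pairing_snoc_avoid[of "edge h" k u "edge_word v"] assms by (simp add: star_word_def)
qed (rule ann_rel_pairing)

definition delta_ok :: "nat \<Rightarrow> nat list list \<Rightarrow> nat list list \<Rightarrow> vec list list \<Rightarrow> bool" where
  "delta_ok k V W D \<longleftrightarrow> length D = k \<and> (\<forall>f<k. length (D ! f) = length W \<and>
     (\<forall>i<length W. snd ` set (D ! f ! i) \<subseteq> {..<length V} \<and>
       (\<forall>u. star_word k u \<longrightarrow> pairing (u @ [(f, k)]) (edge_word (W ! i))
          = vec_eval (\<lambda>j. pairing u (edge_word (V ! j))) (D ! f ! i))))"

definition perms_ok :: "nat \<Rightarrow> nat list list \<Rightarrow> nat list list \<Rightarrow> bool" where
  "perms_ok k W ps \<longleftrightarrow> length ps = length W \<and> (\<forall>i<length W. length (ps ! i) = Suc k \<and>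
     (\<forall>x\<le>k. ps ! i ! x = word_perm (edge_word (W ! i)) x))"

lemma perms_ok_step:
  assumes "perms_ok k W ps" "\<forall>x\<in>set news. fst x < k \<and> snd x < length W"
  shows "perms_ok k (map (\<lambda>x. fst x # W ! snd x) news) (map (\<lambda>x. swap_list (ps ! snd x) (fst x)) news)"
  unfolding perms_ok_def
proof (intro conjI allI impI)
  fix t assume "t < length (map (\<lambda>x. fst x # W ! snd x) news)"
  then have t: "t < length news" by simp
  obtain e i where ei: "news ! t = (e, i)" by (cases "news ! t")
  then have b: "e < k" "i < length W" using assms(2) t by (metis fst_conv nth_mem, metis snd_conv nth_mem)
  have p: "length (ps ! i) = Suc k" "\<And>x. x \<le> k \<Longrightarrow> ps ! i ! x = word_perm (edge_word (W ! i)) x"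
    using assms(1) b by (auto simp: perms_ok_def)
  note eb = edge_bound[OF b(1)]
  show "length (map (\<lambda>x. swap_list (ps ! snd x) (fst x)) news ! t) = Suc k"
    using t ei p by (simp add: swap_list_def)
  fix x assume x: "x \<le> k"
  have "swap_list (ps ! i) e ! x = word_perm (edge_word (W ! i)) (swapv (edge e) x)"
    using eb x p by (auto simp: swap_list_def nth_list_update swapv_def)
  then show "map (\<lambda>x. swap_list (ps ! snd x) (fst x)) news ! t ! x
      = word_perm (edge_word (map (\<lambda>x. fst x # W ! snd x) news ! t)) x"
    using t ei by simp
qed simp

lemma Dop_vec_eval: "Dop e (\<lambda>x. vec_eval (\<lambda>j. g j x) v) u = vec_eval (\<lambda>j. Dop e (g j) u) v"
  by (induction v) (auto simp: Dop_add Dop_scale)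

lemma length_delta_rows [simp]: "length (delta_rows k hs D ps news f) = length D"
  by (induction D arbitrary: f) auto

lemma nth_delta_rows:
  "n < length D \<Longrightarrow> delta_rows k hs D ps news f ! n = delta_row k hs (D ! n) ps news (f + n)"
proof (induction D arbitrary: f n)
  case (Cons Df D)
  then show ?case by (cases n) auto
qed simp

lemma entry_okD:
  "entry_ok k W W' e i v \<Longrightarrow> ann_left k \<phi> \<Longrightarrow> \<phi> (e # W ! i) = vec_eval (\<lambda>j. \<phi> (W' ! j)) v"
  by (simp add: entry_ok_def)

lemma delta_ok_step:
  assumes D: "delta_ok k V W D" and ps: "perms_ok k W ps"
    and news: "\<forall>x\<in>set news. fst x < k \<and> snd x < length W"
    and T: "case hs of [] \<Rightarrow> V = [] | T # hs' \<Rightarrow> table_ok k V W T"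
  shows "delta_ok k W (map (\<lambda>x. fst x # W ! snd x) news) (delta_rows k hs D ps news 0)"
  unfolding delta_ok_def
proof (intro conjI allI impI)
  show "length (delta_rows k hs D ps news 0) = k" using D by (simp add: delta_ok_def)
  fix f assume f: "f < k"
  have row: "delta_rows k hs D ps news 0 ! f = delta_row k hs (D ! f) ps news f"
    using nth_delta_rows[of f D] D f by (simp add: delta_ok_def)
  show "length (delta_rows k hs D ps news 0 ! f) = length (map (\<lambda>x. fst x # W ! snd x) news)"
    by (simp add: row delta_row_def)
  fix t assume "t < length (map (\<lambda>x. fst x # W ! snd x) news)"
  then have t: "t < length news" by simp
  obtain e i where ei: "news ! t = (e, i)" by (cases "news ! t")
  then have b: "e < k" "i < length W" using news t by (metis fst_conv nth_mem, metis snd_conv nth_mem)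
  let ?v = "D ! f ! i"
  define c where "c = br (ps ! i ! fst (edge e), ps ! i ! snd (edge e)) (f, k)"
  have w: "delta_rows k hs D ps news 0 ! f ! t = vec_ins c i (row_app (table_row hs e) ?v)"
    using t ei by (simp add: row delta_row_def c_def)
  have v: "snd ` set ?v \<subseteq> {..<length V}"
    and ev: "\<And>u. star_word k u \<Longrightarrow> pairing (u @ [(f, k)]) (edge_word (W ! i)) = vec_eval (\<lambda>j. pairing u (edge_word (V ! j))) ?v"
    using D f b(2) by (auto simp: delta_ok_def)
  have ent: "entry_ok k V W e j (table_row hs e ! j)" if "j \<in> snd ` set ?v" for j
  proof (cases hs)
    case Nil
    then show ?thesis using T v that by auto
  next
    case (Cons T' hs')
    then show ?thesis using T v that b(1) by (auto simp: table_ok_def table_row_def)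
  qed
  have "snd ` set (row_app (table_row hs e) ?v) \<subseteq> {..<length W}"
    by (rule row_app_bound) (use ent in \<open>simp add: entry_ok_def\<close>)
  then show "snd ` set (delta_rows k hs D ps news 0 ! f ! t) \<subseteq> {..<length W}"
    unfolding w by (rule vec_ins_bound[OF b(2)])
  fix u assume u: "star_word k u"
  have "pairing (u @ [(f, k)]) (edge e # edge_word (W ! i)) = Dop (edge e) (\<lambda>x. pairing (x @ [(f, k)]) (edge_word (W ! i))) u
     + of_int (br (word_perm (edge_word (W ! i)) (fst (edge e)), word_perm (edge_word (W ! i)) (snd (edge e))) (f, k)) * pairing u (edge_word (W ! i))"
    by (rule pairing_snoc_Cons)
  also have "br (word_perm (edge_word (W ! i)) (fst (edge e)), word_perm (edge_word (W ! i)) (snd (edge e))) (f, k) = c"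
    using ps b(2) edge_bound[OF b(1)] by (simp add: c_def perms_ok_def)
  also have "Dop (edge e) (\<lambda>x. pairing (x @ [(f, k)]) (edge_word (W ! i))) u
      = Dop (edge e) (\<lambda>x. vec_eval (\<lambda>j. pairing x (edge_word (V ! j))) ?v) u"
    by (rule Dop_local, rule ev) (use u in \<open>auto simp: star_word_def\<close>)
  also have "\<dots> = vec_eval (\<lambda>j. pairing u (edge_word (e # V ! j))) ?v"
    by (simp add: Dop_vec_eval pairing_Cons)
  also have "\<dots> = vec_eval (\<lambda>j. vec_eval (\<lambda>t. pairing u (edge_word (W ! t))) (table_row hs e ! j)) ?v"
    by (rule vec_eval_cong, rule entry_okD[OF ent ann_left_pairing[OF u]])
  finally show "pairing (u @ [(f, k)]) (edge_word (map (\<lambda>x. fst x # W ! snd x) news ! t))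
      = vec_eval (\<lambda>j. pairing u (edge_word (W ! j))) (delta_rows k hs D ps news 0 ! f ! t)"
    using t ei by (simp add: w vec_eval_row_app)
qed

definition star_indep :: "nat \<Rightarrow> nat list list \<Rightarrow> bool" where
  "star_indep k W \<longleftrightarrow> (\<forall>c. (\<forall>u. star_word k u \<longrightarrow> (\<Sum>i<length W. c i * pairing u (edge_word (W ! i))) = 0)
     \<longrightarrow> (\<forall>i<length W. c i = (0 :: rat)))"

lemma pivots_ok_zero:
  assumes "pivots_ok k D piv" "\<And>i. i < n \<Longrightarrow> c i \<noteq> 0 \<Longrightarrow> i \<in> fst ` set piv"
    and eq: "\<And>f t. f < k \<Longrightarrow> (\<Sum>i<n. c i * of_int (vec_at (D ! f ! i) t)) = (0 :: rat)"
  shows "\<forall>i<n. c i = 0"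
  using assms(1,2)
proof (induction piv)
  case (Cons p piv)
  obtain i f t where p: "p = (i, f, t)" by (cases p)
  have f: "f < k" and nz: "vec_at (D ! f ! i) t \<noteq> 0" and z: "\<And>j. j \<in> fst ` set piv \<Longrightarrow> vec_at (D ! f ! j) t = 0"
    and piv: "pivots_ok k D piv"
    using Cons.prems(1) by (auto simp: p list_all_iff)
  have "c i = 0" if i: "i < n"
  proof -
    have "(\<Sum>j<n. c j * of_int (vec_at (D ! f ! j) t)) = (\<Sum>j<n. if j = i then c i * of_int (vec_at (D ! f ! i) t) else 0)"
    proof (rule sum.cong)
      fix j assume "j \<in> {..<n}"
      then have "c j = 0 \<or> j = i \<or> j \<in> fst ` set piv" using Cons.prems(2)[of j] by (auto simp: p)
      then show "c j * of_int (vec_at (D ! f ! j) t) = (if j = i then c i * of_int (vec_at (D ! f ! i) t) else 0)"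
        using z[of j] by auto
    qed simp
    then have "c i * of_int (vec_at (D ! f ! i) t) = 0"
      using eq[OF f, of t] i by simp
    then show ?thesis using nz by simp
  qed
  then have "j \<in> fst ` set piv" if "j < n" "c j \<noteq> 0" for j
    using Cons.prems(2)[OF that] that by (auto simp: p)
  then show ?case using Cons.IH[OF piv] by blast
qed auto

lemma star_indep_step:
  assumes ind: "star_indep k W" and D: "delta_ok k W W' D" and piv: "pivots_ok k D piv"
    and cov: "\<And>i. i < length W' \<Longrightarrow> i \<in> fst ` set piv"
  shows "star_indep k W'"
  unfolding star_indep_def
proof (rule allI, rule impI)
  fix c :: "nat \<Rightarrow> rat"
  assume c: "\<forall>u. star_word k u \<longrightarrow> (\<Sum>i<length W'. c i * pairing u (edge_word (W' ! i))) = 0"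
  show "\<forall>i<length W'. c i = 0"
  proof (rule pivots_ok_zero[OF piv])
    fix f t assume f: "f < k"
    let ?a = "\<lambda>t. \<Sum>i<length W'. c i * of_int (vec_at (D ! f ! i) t)"
    have bnd: "snd ` set (D ! f ! i) \<subseteq> {..<length W}" if "i < length W'" for i
      using D f that by (auto simp: delta_ok_def)
    have "(\<Sum>t<length W. ?a t * pairing u (edge_word (W ! t))) = 0" if u: "star_word k u" for u
    proof -
      have "(\<Sum>t<length W. ?a t * pairing u (edge_word (W ! t)))
          = (\<Sum>t<length W. \<Sum>i<length W'. c i * (of_int (vec_at (D ! f ! i) t) * pairing u (edge_word (W ! t))))"
        by (simp add: sum_distrib_right mult.assoc)
      also have "\<dots> = (\<Sum>i<length W'. \<Sum>t<length W. c i * (of_int (vec_at (D ! f ! i) t) * pairing u (edge_word (W ! t))))"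
        by (rule sum.swap)
      also have "\<dots> = (\<Sum>i<length W'. c i * pairing (u @ [(f, k)]) (edge_word (W' ! i)))"
      proof (rule sum.cong)
        fix i assume i: "i \<in> {..<length W'}"
        then have "pairing (u @ [(f, k)]) (edge_word (W' ! i)) = vec_eval (\<lambda>j. pairing u (edge_word (W ! j))) (D ! f ! i)"
          using D f u by (auto simp: delta_ok_def)
        also have "\<dots> = (\<Sum>t<length W. of_int (vec_at (D ! f ! i) t) * pairing u (edge_word (W ! t)))"
          by (rule vec_eval_vec_at) (use bnd i in auto)
        finally show "(\<Sum>t<length W. c i * (of_int (vec_at (D ! f ! i) t) * pairing u (edge_word (W ! t))))
            = c i * pairing (u @ [(f, k)]) (edge_word (W' ! i))"
          by (simp add: sum_distrib_left)
      qed simp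
      also have "\<dots> = 0" using c u by simp
      finally show ?thesis .
    qed
    then have "\<forall>u. star_word k u \<longrightarrow> (\<Sum>t<length W. ?a t * pairing u (edge_word (W ! t))) = 0" by simp
    then have *: "\<forall>t<length W. ?a t = 0"
      by (rule ind[unfolded star_indep_def, THEN spec[where x = ?a], THEN mp])
    show "?a t = 0"
    proof (cases "t < length W")
      case False
      then have "vec_at (D ! f ! i) t = 0" if "i < length W'" for i
        using vec_at_outside[OF bnd[OF that]] by blast
      then show ?thesis by simp
    qed (use * in simp)
  qed (use cov in blast)
qed

subsection \<open>Soundness of a complete certificate\<close>

definition spans_next :: "nat \<Rightarrow> nat list list \<Rightarrow> nat list list \<Rightarrow> bool" where
  "spans_next k W W' \<longleftrightarrow> (\<exists>T. table_ok k W W' T) \<and> (\<forall>w\<in>set W'. \<exists>e<k. \<exists>x\<in>set W. w = e # x)"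

fun good_levels :: "nat \<Rightarrow> nat list list list \<Rightarrow> bool" where
  "good_levels k [] \<longleftrightarrow> False"
| "good_levels k [W] \<longleftrightarrow> W = []"
| "good_levels k (W # W' # Ws) \<longleftrightarrow> spans_next k W W' \<and> star_indep k W' \<and> good_levels k (W' # Ws)"

fun levels :: "nat list list \<Rightarrow> certificate \<Rightarrow> nat list list list" where
  "levels W [] = [W]"
| "levels W (l # ls) = W # levels (next_words W (fst l)) ls"

lemma levels_Cons: "\<exists>Ws. levels W ls = W # Ws"
  by (cases ls) auto

lemma row_news_bound: "x \<in> set (row_news e i sts) \<Longrightarrow> fst x = e \<and> snd x < i + length sts"
proof (induction sts arbitrary: i)
  case (Cons st sts)
  then show ?case by (fastforce split: if_splits)
qed simp

lemma level_news_bound: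
  assumes "build_rows k hs n rows e nb l = Some T" "x \<in> set (level_news e l)"
  shows "fst x < k \<and> snd x < n"
  using assms
proof (induction l arbitrary: rows e nb)
  case (Cons sts l)
  have "e < k" "length sts = n" using build_rows_mono[OF Cons.prems(1)] Cons.prems(1) by (auto split: if_splits)
  moreover obtain rows' nb' where "build_rows k hs n rows' (Suc e) nb' l = Some T"
    using Cons.prems(1) by (auto split: if_splits option.splits)
  ultimately show ?case
    using Cons.prems(2) Cons.IH[of rows' "Suc e" nb'] row_news_bound[of x e 0 sts] by auto
qed simp

lemma run_sound:
  assumes "run k hs n D ps ls" and "n = length W" and "0 < k"
    and "hist_ok k hs (W # Ws)"
    and "\<forall>W\<in>set (W # Ws). \<forall>x\<in>set W. x \<in> lists {..<k}"
    and "hs = [] \<Longrightarrow> W = [[]] \<and> V = []"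
    and "hs \<noteq> [] \<Longrightarrow> table_ok k V W (hd hs)"
    and "delta_ok k V W D" "perms_ok k W ps" "star_indep k W"
  shows "good_levels k (levels W ls)"
  using assms
proof (induction ls arbitrary: hs n D ps W Ws V)
  case (Cons l ls)
  obtain T where T: "build_rows k hs n [] 0 0 (fst l) = Some T"
    using Cons.prems(1) by (auto split: option.splits)
  define news where "news = level_news 0 (fst l)"
  define D' where "D' = delta_rows k hs D ps news 0"
  let ?W = "next_words W (fst l)" and ?ps = "map (\<lambda>x. swap_list (ps ! snd x) (fst x)) news"
  have W': "?W = map (\<lambda>x. fst x # W ! snd x) news" by (simp add: next_words_def news_def)
  have piv: "pivots_ok k D' (snd l)" and cov: "list_all (\<lambda>i. i \<in> set (map fst (snd l))) [0..<length news]"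
    and run: "run k (T # take 2 hs) (length news) D' ?ps ls"
    using Cons.prems(1) by (simp_all add: T Let_def news_def D'_def)
  have nb: "\<forall>x\<in>set news. fst x < k \<and> snd x < length W"
    using level_news_bound[OF T] Cons.prems(2) unfolding news_def by blast
  have "table_ok k (hd (W # Ws)) ?W T"
    by (rule build_rows_sound[OF T _ Cons.prems(4,5), where pre = "[]"])
      (use Cons.prems in \<open>auto simp: next_words_def\<close>)
  then have tab: "table_ok k W ?W T" by simp
  have "case hs of [] \<Rightarrow> V = [] | T # hs' \<Rightarrow> table_ok k V W T"
    using Cons.prems(6,7) by (auto split: list.splits)
  then have D': "delta_ok k W ?W D'"
    unfolding W' D'_def by (rule delta_ok_step[OF Cons.prems(8,9) nb])
  have ps': "perms_ok k ?W ?ps"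
    unfolding W' by (rule perms_ok_step[OF Cons.prems(9) nb])
  have ind: "star_indep k ?W"
    by (rule star_indep_step[OF Cons.prems(10) D' piv]) (use cov in \<open>auto simp: list_all_iff W'\<close>)
  have wf: "\<forall>w\<in>set ?W. \<exists>e<k. \<exists>x\<in>set W. w = e # x"
    using nb by (force simp: W')
  have "good_levels k (levels ?W ls)"
  proof (rule Cons.IH[OF run _ Cons.prems(3), where V = W and Ws = "W # Ws"])
    show "hist_ok k (T # take 2 hs) (?W # W # Ws)"
      using tab hist_ok_take[OF Cons.prems(4)] by simp
    show "\<forall>W\<in>set (?W # W # Ws). \<forall>x\<in>set W. x \<in> lists {..<k}"
      using Cons.prems(5) wf by fastforce
  qed (use tab D' ps' ind in \<open>auto simp: W'\<close>)
  moreover obtain Ws' where "levels ?W ls = ?W # Ws'" using levels_Cons by blast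
  ultimately show ?case
    using tab ind wf by (auto simp: spans_next_def)
qed simp

lemma check_sound:
  assumes "check k ls" "0 < k"
  shows "good_levels k (levels [[]] ls)" "star_indep k [[]]"
proof -
  show ind: "star_indep k [[]]"
    unfolding star_indep_def
  proof (intro allI impI)
    fix c :: "nat \<Rightarrow> rat" and i
    assume c: "\<forall>u. star_word k u \<longrightarrow> (\<Sum>i<length [[]]. c i * pairing u (edge_word ([[]] ! i))) = 0"
      and i: "i < length [[] :: nat list]"
    show "c i = 0" using c[rule_format, of "[]"] i by simp
  qed
  have "run k [] 1 (replicate k [[]]) [[0..<Suc k]] ls"
    using assms(1) by (simp add: check_def)
  then show "good_levels k (levels [[]] ls)"
    by (rule run_sound[where V = "[]" and Ws = "[]"])
      (use assms(2) ind in \<open>auto simp: delta_ok_def perms_ok_def nth_append simp del: upt_Suc\<close>)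
qed

section \<open>Normal forms\<close>

lemma good_levels_nth:
  "good_levels k L \<Longrightarrow> Suc d < length L \<Longrightarrow> spans_next k (L ! d) (L ! Suc d) \<and> star_indep k (L ! Suc d)"
proof (induction k L arbitrary: d rule: good_levels.induct)
  case (3 k W W' Ws)
  then show ?case by (cases d) auto
qed auto

lemma good_levels_last: "good_levels k L \<Longrightarrow> L \<noteq> [] \<and> last L = []"
  by (induction k L rule: good_levels.induct) auto

definition level :: "nat list list list \<Rightarrow> nat \<Rightarrow> nat list list" where
  "level L d = (if d < length L then L ! d else [])"

definition stage :: "nat \<Rightarrow> nat list list list \<Rightarrow> bool" where
  "stage k L \<longleftrightarrow> good_levels k L \<and> star_indep k [[]] \<and> level L 0 = [[]]"

lemma stage_step:
  assumes "stage k L" "level L d \<noteq> []"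
  shows "spans_next k (level L d) (level L (Suc d))"
proof -
  have d: "d < length L" using assms(2) by (auto simp: level_def split: if_splits)
  have "Suc d < length L"
  proof (rule ccontr)
    assume "\<not> Suc d < length L"
    then have "d = length L - 1" using d by simp
    moreover have "L \<noteq> []" using d by auto
    ultimately have "L ! d = last L" by (simp add: last_conv_nth)
    then show False using good_levels_last[of k L] assms d by (simp add: stage_def level_def)
  qed
  then show ?thesis using good_levels_nth[of k L d] assms(1) d by (simp add: stage_def level_def)
qed

lemma stage_indep: "stage k L \<Longrightarrow> star_indep k (level L d)"
proof (cases d)
  case (Suc d')
  assume "stage k L"
  then show ?thesis using good_levels_nth[of k L d'] Suc
    by (auto simp: stage_def level_def star_indep_def)
qed (simp add: stage_def)

lemma stage_words:
  assumes "stage k L" "w \<in> set (level L d)"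
  shows "length w = d \<and> w \<in> lists {..<k}"
  using assms(2)
proof (induction d arbitrary: w)
  case 0
  then show ?case using assms(1) by (simp add: stage_def)
next
  case (Suc d)
  have "level L d \<noteq> []"
  proof
    assume "level L d = []"
    then have "d \<ge> length L \<or> L ! d = []" by (auto simp: level_def split: if_splits)
    then have "Suc d < length L \<and> L ! d = []" using Suc.prems by (auto simp: level_def split: if_splits)
    then show False
      using Suc.prems good_levels_nth[of k L d] assms(1) by (auto simp: stage_def level_def spans_next_def)
  qed
  then have "spans_next k (level L d) (level L (Suc d))" by (rule stage_step[OF assms(1)])
  then obtain e x where "e < k" "x \<in> set (level L d)" "w = e # x"
    using Suc.prems by (auto simp: spans_next_def)
  then show ?case using Suc.IH by simp
qed

lemma stage_reduce:
  assumes "stage k L" "w \<in> lists {..<k}"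
  shows "\<exists>v. snd ` set v \<subseteq> {..<length (level L (length w))} \<and>
    (\<forall>\<phi>. ann_left k \<phi> \<longrightarrow> \<phi> w = vec_eval (\<lambda>j. \<phi> (level L (length w) ! j)) v)"
  using assms(2)
proof (induction w rule: list.induct)
  case Nil
  then show ?case using assms(1) by (intro exI[of _ "[(1, 0)]"]) (simp add: stage_def)
next
  case (Cons e w)
  let ?d = "length w"
  obtain v where v: "snd ` set v \<subseteq> {..<length (level L ?d)}"
    "\<And>\<phi>. ann_left k \<phi> \<Longrightarrow> \<phi> w = vec_eval (\<lambda>j. \<phi> (level L ?d ! j)) v"
    using Cons.IH Cons.prems by auto
  have e: "e < k" using Cons.prems by simp
  have ew: "\<phi> (e # w) = vec_eval (\<lambda>j. \<phi> (e # level L ?d ! j)) v" if "ann_left k \<phi>" for \<phi>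
    using v(2)[OF ann_left_Cons[OF that e]] .
  show ?case
  proof (cases "level L ?d = []")
    case True
    then have "v = []" using v(1) by auto
    then show ?thesis using ew by (intro exI[of _ "[]"]) simp
  next
    case False
    obtain T where T: "table_ok k (level L ?d) (level L (Suc ?d)) T"
      using stage_step[OF assms(1) False] by (auto simp: spans_next_def)
    have ent: "entry_ok k (level L ?d) (level L (Suc ?d)) e j (T ! e ! j)" if "j \<in> snd ` set v" for j
      using T e v(1) that unfolding table_ok_def by blast
    show ?thesis
    proof (intro exI[of _ "row_app (T ! e) v"] conjI allI impI)
      show "snd ` set (row_app (T ! e) v) \<subseteq> {..<length (level L (length (e # w)))}"
        unfolding length_Cons by (rule row_app_bound) (use ent in \<open>simp add: entry_ok_def\<close>)
      fix \<phi> assume \<phi>: "ann_left k \<phi>"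
      have "vec_eval (\<lambda>j. \<phi> (e # level L ?d ! j)) v
          = vec_eval (\<lambda>j. vec_eval (\<lambda>t. \<phi> (level L (Suc ?d) ! t)) (T ! e ! j)) v"
        by (rule vec_eval_cong, rule entry_okD[OF ent \<phi>])
      then show "\<phi> (e # w) = vec_eval (\<lambda>j. \<phi> (level L (length (e # w)) ! j)) (row_app (T ! e) v)"
        using ew[OF \<phi>] by (simp add: vec_eval_row_app)
    qed
  qed
qed

definition stage_set :: "nat list list list \<Rightarrow> nat list set" where
  "stage_set L = set (concat L)"

lemma stage_set_iff: "w \<in> stage_set L \<longleftrightarrow> (\<exists>d. w \<in> set (level L d))"
  by (auto simp: stage_set_def level_def in_set_conv_nth split: if_splits) (metis nth_mem)+

lemma level_eq:
  assumes "stage k L"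
  shows "set (level L d) = {w \<in> stage_set L. length w = d}"
  using stage_words[OF assms] by (auto simp: stage_set_iff)

lemma stage_set_words: "stage k L \<Longrightarrow> w \<in> stage_set L \<Longrightarrow> w \<in> lists {..<k}"
  using stage_words unfolding stage_set_iff by blast

lemma finite_stage_set [simp]: "finite (stage_set L)"
  by (simp add: stage_set_def)

lemma stage_spans:
  assumes "stage k L" "ann_left k \<phi>" "\<And>w. w \<in> stage_set L \<Longrightarrow> \<phi> w = 0" "w \<in> lists {..<k}"
  shows "\<phi> w = 0"
proof -
  obtain v where v: "snd ` set v \<subseteq> {..<length (level L (length w))}"
    "\<phi> w = vec_eval (\<lambda>j. \<phi> (level L (length w) ! j)) v"
    using stage_reduce[OF assms(1,4)] assms(2) by blast
  have "vec_eval (\<lambda>j. \<phi> (level L (length w) ! j)) v = vec_eval (\<lambda>j. 0) v"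
  proof (rule vec_eval_cong)
    fix j assume "j \<in> snd ` set v"
    then have "level L (length w) ! j \<in> stage_set L"
      using v(1) unfolding stage_set_iff by (meson lessThan_iff nth_mem subsetD)
    then show "\<phi> (level L (length w) ! j) = 0" by (rule assms(3))
  qed
  moreover have "vec_eval (\<lambda>j. 0) v = 0" by (induction v) auto
  ultimately show ?thesis using v(2) by simp
qed

subsection \<open>Spanning\<close>

lemma ann_rel_snoc:
  assumes "ann_rel k \<phi>" "h < k"
  shows "ann_rel k (\<lambda>w. \<phi> (w @ [h]))"
  unfolding ann_rel_def
proof (intro ballI)
  fix u v assume u: "u \<in> lists {..<k}" and "v \<in> lists {..<k}"
  then have v: "v @ [h] \<in> lists {..<k}" using assms by simp
  have *: "rel_eval (\<lambda>w. \<phi> ((u @ w) @ [h])) r v = rel_eval (\<lambda>w. \<phi> (u @ w)) r (v @ [h])" for r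
    by (simp add: rel_eval_def)
  show "(\<forall>e<k. \<forall>f<k. rel_eval (\<lambda>w. \<phi> ((u @ w) @ [h])) (pair_rel e f) v = 0) \<and>
     (3 < k \<longrightarrow> (\<forall>b. rel_eval (\<lambda>w. \<phi> ((u @ w) @ [h])) (claw_rel b) v = 0))"
    unfolding * using assms(1) u v unfolding ann_rel_def by blast
qed

lemma ann_rel_prefix:
  assumes "ann_rel (Suc k) \<phi>" "m \<in> lists {..<Suc k}"
  shows "ann_rel k (\<lambda>w. \<phi> (m @ w))"
  unfolding ann_rel_def
proof (intro ballI)
  fix u v assume "u \<in> lists {..<k}" "v \<in> lists {..<k}"
  then have uv: "m @ u \<in> lists {..<Suc k}" "v \<in> lists {..<Suc k}" using assms(2) by auto
  then have "(\<forall>e<Suc k. \<forall>f<Suc k. rel_eval (\<lambda>w. \<phi> ((m @ u) @ w)) (pair_rel e f) v = 0) \<and>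
     (3 < Suc k \<longrightarrow> (\<forall>b. rel_eval (\<lambda>w. \<phi> ((m @ u) @ w)) (claw_rel b) v = 0))"
    using assms(1) unfolding ann_rel_def by blast
  then show "(\<forall>e<k. \<forall>f<k. rel_eval (\<lambda>w. \<phi> (m @ u @ w)) (pair_rel e f) v = 0) \<and>
     (3 < k \<longrightarrow> (\<forall>b. rel_eval (\<lambda>w. \<phi> (m @ u @ w)) (claw_rel b) v = 0))"
    by simp
qed

lemma rel_eval_truncate:
  assumes "\<forall>t\<in>set r. length (snd t) = l"
  shows "rel_eval (\<lambda>w. if length (u @ w) = n then \<phi> (u @ w) else 0) r v
    = (if length u + l + length v = n then rel_eval (\<lambda>w. \<phi> (u @ w)) r v else 0)"
  using assms by (induction r) (auto simp: rel_eval_def)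

lemma ann_rel_truncate:
  assumes "ann_rel k \<phi>"
  shows "ann_rel k (\<lambda>w. if length w = n then \<phi> w else 0)"
  unfolding ann_rel_def
proof (intro ballI conjI allI impI)
  fix u v assume u: "u \<in> lists {..<k}" "v \<in> lists {..<k}"
  {
    fix e f assume ef: "e < k" "f < k"
    obtain l where "\<forall>t\<in>set (pair_rel e f). length (snd t) = l"
      using rel_wf_pair_rel[OF ef] unfolding rel_wf_def by blast
    note tr = rel_eval_truncate[OF this, of u n \<phi> v]
    have "rel_eval (\<lambda>w. \<phi> (u @ w)) (pair_rel e f) v = 0"
      using assms u ef unfolding ann_rel_def by blast
    then show "rel_eval (\<lambda>w. if length (u @ w) = n then \<phi> (u @ w) else 0) (pair_rel e f) v = 0"
      unfolding tr by simp
  }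
  fix b assume k: "3 < k"
  obtain l where "\<forall>t\<in>set (claw_rel b). length (snd t) = l"
    using rel_wf_claw_rel[OF k] unfolding rel_wf_def by blast
  note tr = rel_eval_truncate[OF this, of u n \<phi> v]
  have "rel_eval (\<lambda>w. \<phi> (u @ w)) (claw_rel b) v = 0"
    using assms u k unfolding ann_rel_def by blast
  then show "rel_eval (\<lambda>w. if length (u @ w) = n then \<phi> (u @ w) else 0) (claw_rel b) v = 0"
    unfolding tr by simp
qed

lemma stage_module_spans:
  assumes st: "stage (Suc k) L" and "ann_rel (Suc k) \<phi>"
    and "\<And>m b. m \<in> stage_set L \<Longrightarrow> b \<in> lists {..<k} \<Longrightarrow> \<phi> (m @ b) = 0"
    and "w \<in> lists {..<Suc k}"
  shows "\<phi> w = 0"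
  using assms(2-)
proof (induction "length w" arbitrary: w \<phi> rule: less_induct)
  case less
  let ?\<psi> = "\<lambda>x. if length x = length w then \<phi> x else 0"
  have "ann_left (Suc k) ?\<psi>"
    unfolding ann_left_def
  proof (intro conjI ballI allI impI)
    fix u h assume u: "u \<in> lists {..<Suc k}" and h: "Suc h < Suc k"
    have "\<phi> (u @ [h]) = 0" if "length (u @ [h]) = length w"
    proof (rule less.hyps[where w = u and \<phi> = "\<lambda>x. \<phi> (x @ [h])"])
      show "ann_rel (Suc k) (\<lambda>x. \<phi> (x @ [h]))" by (rule ann_rel_snoc) (use less.prems h in auto)
      show "\<phi> ((m @ b) @ [h]) = 0" if "m \<in> stage_set L" "b \<in> lists {..<k}" for m b
        using less.prems(2)[of m "b @ [h]"] that h by simp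
    qed (use that u in auto)
    then show "?\<psi> (u @ [h]) = 0" by simp
  qed (rule ann_rel_truncate[OF less.prems(1)])
  then have "?\<psi> w = 0"
    by (rule stage_spans[OF st]) (use less.prems(2)[of _ "[]"] less.prems(3) in auto)
  then show ?case by simp
qed

fun normal_forms :: "(nat \<Rightarrow> nat list list list) \<Rightarrow> nat \<Rightarrow> nat list set" where
  "normal_forms L 0 = {[]}"
| "normal_forms L (Suc k) = (\<lambda>(m, b). m @ b) ` (stage_set (L (Suc k)) \<times> normal_forms L k)"

lemma finite_normal_forms [simp]: "finite (normal_forms L k)"
  by (induction k) auto

lemma normal_forms_words:
  assumes "\<And>j. 0 < j \<Longrightarrow> j \<le> k \<Longrightarrow> stage j (L j)"
  shows "normal_forms L k \<subseteq> lists {..<k}"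
  using assms
proof (induction k)
  case (Suc k)
  have "stage (Suc k) (L (Suc k))" using Suc.prems by simp
  moreover have "normal_forms L k \<subseteq> lists {..<k}" by (rule Suc.IH) (use Suc.prems in auto)
  ultimately show ?case using stage_set_words[of "Suc k" "L (Suc k)"] by fastforce
qed simp

lemma normal_forms_span:
  assumes "\<And>j. 0 < j \<Longrightarrow> j \<le> k \<Longrightarrow> stage j (L j)"
    and "ann_rel k \<phi>" "\<And>w. w \<in> normal_forms L k \<Longrightarrow> \<phi> w = 0" "w \<in> lists {..<k}"
  shows "\<phi> w = 0"
  using assms
proof (induction k arbitrary: \<phi> w)
  case (Suc k)
  have st: "stage (Suc k) (L (Suc k))" using Suc.prems(1) by simp
  show ?case
  proof (rule stage_module_spans[OF st Suc.prems(2) _ Suc.prems(4)])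
    fix m b assume m: "m \<in> stage_set (L (Suc k))" and b: "b \<in> lists {..<k}"
    show "\<phi> (m @ b) = 0"
    proof (rule Suc.IH[OF _ _ _ b])
      show "ann_rel k (\<lambda>w. \<phi> (m @ w))"
        by (rule ann_rel_prefix[OF Suc.prems(2) stage_set_words[OF st m]])
      show "\<phi> (m @ w) = 0" if "w \<in> normal_forms L k" for w
        using Suc.prems(3) m that by force
    qed (use Suc.prems(1) in auto)
  qed
qed simp

lemma normal_forms_span_degree:
  assumes "\<And>j. 0 < j \<Longrightarrow> j \<le> k \<Longrightarrow> stage j (L j)" "ann_rel k \<phi>"
    and "\<And>w. w \<in> normal_forms L k \<Longrightarrow> length w = d \<Longrightarrow> \<phi> w = 0" "w \<in> lists {..<k}" "length w = d"
  shows "\<phi> w = 0"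
proof -
  have "(if length w = d then \<phi> w else 0) = 0"
    by (rule normal_forms_span[OF assms(1) ann_rel_truncate[OF assms(2)]]) (use assms(3,4) in auto)
  then show ?thesis using assms(5) by simp
qed

subsection \<open>Independence\<close>

lemma star_indep_distinct:
  assumes "star_indep k W"
  shows "distinct W"
  unfolding distinct_conv_nth
proof (intro allI impI)
  fix i j assume i: "i < length W" and j: "j < length W" and ij: "i \<noteq> j"
  show "W ! i \<noteq> W ! j"
  proof
    assume eq: "W ! i = W ! j"
    let ?c = "\<lambda>x. if x = i then 1 else if x = j then -1 else (0 :: rat)"
    have "(\<Sum>x<length W. ?c x * pairing u (edge_word (W ! x))) = 0" for u
    proof -
      have "(\<Sum>x<length W. ?c x * pairing u (edge_word (W ! x)))
         = (\<Sum>x<length W. (if x = i then pairing u (edge_word (W ! i)) else 0)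
             + (if x = j then - pairing u (edge_word (W ! j)) else 0))"
        by (rule sum.cong) (use ij in auto)
      then show ?thesis using i j eq by (simp add: sum.distrib)
    qed
    then have "\<forall>u. star_word k u \<longrightarrow> (\<Sum>x<length W. ?c x * pairing u (edge_word (W ! x))) = 0" by simp
    then have "\<forall>x<length W. ?c x = 0"
      by (rule assms[unfolded star_indep_def, THEN spec[where x = ?c], THEN mp])
    then show False using i by auto
  qed
qed

lemma star_indep_set:
  assumes "star_indep k W" "\<And>u. star_word k u \<Longrightarrow> (\<Sum>m\<in>set W. c m * pairing u (edge_word m)) = 0" "m \<in> set W"
  shows "c m = (0 :: rat)"
proof -
  have "(\<Sum>i<length W. c (W ! i) * pairing u (edge_word (W ! i))) = (\<Sum>m\<in>set W. c m * pairing u (edge_word m))" for u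
    by (rule sum.reindex_bij_betw) (rule bij_betw_nth[OF star_indep_distinct[OF assms(1)]], auto)
  then have "\<forall>u. star_word k u \<longrightarrow> (\<Sum>i<length W. c (W ! i) * pairing u (edge_word (W ! i))) = 0"
    using assms(2) by simp
  then have "\<forall>i<length W. c (W ! i) = 0"
    by (rule assms(1)[unfolded star_indep_def, THEN spec[where x = "\<lambda>i. c (W ! i)"], THEN mp])
  then show ?thesis using assms(3) by (metis in_set_conv_nth)
qed

definition word_indep :: "nat list set \<Rightarrow> bool" where
  "word_indep N \<longleftrightarrow> (\<forall>c. (\<forall>u. (\<Sum>w\<in>N. c w * pairing u (edge_word w)) = 0) \<longrightarrow> (\<forall>w\<in>N. c w = (0 :: rat)))"

lemma word_indepD:
  assumes "word_indep N" "\<And>u. (\<Sum>w\<in>N. c w * pairing u (edge_word w)) = 0" "w \<in> N"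
  shows "c w = 0"
proof -
  have "\<forall>u. (\<Sum>w\<in>N. c w * pairing u (edge_word w)) = 0" using assms(2) by simp
  then have "\<forall>w\<in>N. c w = 0"
    by (rule assms(1)[unfolded word_indep_def, THEN spec[where x = c], THEN mp])
  then show ?thesis using assms(3) by simp
qed

text \<open>The pairing with \<open>u @ v\<close>, \<open>u\<close> a word in the letters \<open>(i, k + 1)\<close>, isolates the summands with
  the longest left factor, and splits there as a product.\<close>

lemma product_indep:
  assumes st: "stage (Suc k) L" and N: "word_indep N" "finite N" "N \<subseteq> lists {..<k}"
    and c: "\<And>u. (\<Sum>m\<in>stage_set L. \<Sum>b\<in>N. c m b * pairing u (edge_word (m @ b))) = 0"
    and "m \<in> stage_set L" "b \<in> N"
  shows "c m b = (0 :: rat)"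
proof (rule ccontr)
  assume "c m b \<noteq> 0"
  define S where "S = {m \<in> stage_set L. \<exists>b\<in>N. c m b \<noteq> 0}"
  have S: "finite S" "S \<noteq> {}" using assms(6,7) \<open>c m b \<noteq> 0\<close> by (auto simp: S_def)
  define d where "d = Max (length ` S)"
  have "d \<in> length ` S" unfolding d_def using S by (intro Max_in) auto
  then obtain m0 b0 where m0: "m0 \<in> stage_set L" "length m0 = d" "b0 \<in> N" "c m0 b0 \<noteq> 0"
    by (auto simp: S_def)
  have long: "c m b = 0" if "m \<in> stage_set L" "b \<in> N" "d < length m" for m b
  proof (rule ccontr)
    assume "c m b \<noteq> 0"
    then have "length m \<in> length ` S" using that by (auto simp: S_def)
    then have "length m \<le> d" unfolding d_def using S(1) by (intro Max_ge) auto
    then show False using that(3) by simp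
  qed
  have avoid: "fst e \<noteq> Suc k \<and> snd e \<noteq> Suc k" if b: "b \<in> N" and e: "e \<in> set (edge_word b)" for b e
  proof -
    obtain x where "x \<in> set b" "e = edge x" using e by auto
    moreover from this have "x < k" using b N(3) by auto
    ultimately have "x < k" "e = edge x" by auto
    then show ?thesis using edge_bound[of x k] by auto
  qed
  have "(\<Sum>m\<in>set (level L d). c m b0 * pairing u (edge_word m)) = 0" if u: "star_word (Suc k) u" for u
  proof (cases "length u = d")
    case True
    have "(\<Sum>m\<in>stage_set L. c m b * pairing u (edge_word m)) = 0" if "b \<in> N" for b
    proof (rule word_indepD[OF N(1) _ that])
      fix v
      have "(\<Sum>b\<in>N. (\<Sum>m\<in>stage_set L. c m b * pairing u (edge_word m)) * pairing v (edge_word b))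
          = (\<Sum>b\<in>N. \<Sum>m\<in>stage_set L. c m b * (pairing u (edge_word m) * pairing v (edge_word b)))"
        by (simp add: sum_distrib_right mult.assoc)
      also have "\<dots> = (\<Sum>b\<in>N. \<Sum>m\<in>stage_set L. c m b * pairing (u @ v) (edge_word (m @ b)))"
      proof (intro sum.cong refl)
        fix b m assume b: "b \<in> N" and m: "m \<in> stage_set L"
        show "c m b * (pairing u (edge_word m) * pairing v (edge_word b)) = c m b * pairing (u @ v) (edge_word (m @ b))"
        proof (cases "d < length m")
          case False
          then have "pairing (u @ v) (edge_word m @ edge_word b) = pairing u (edge_word m) * pairing v (edge_word b)"
            using avoid[OF b] u True
            by (intro pairing_product[where l = "Suc k"]) (auto simp: star_word_def)
          then show ?thesis by simp
        qed (use long[OF m b] in simp)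
      qed
      also have "\<dots> = 0" using c[of "u @ v"] by (subst sum.swap)
      finally show "(\<Sum>b\<in>N. (\<Sum>m\<in>stage_set L. c m b * pairing u (edge_word m)) * pairing v (edge_word b)) = 0" .
    qed
    from this[OF m0(3)] have "(\<Sum>m\<in>stage_set L. c m b0 * pairing u (edge_word m)) = 0" .
    moreover have "(\<Sum>m\<in>set (level L d). c m b0 * pairing u (edge_word m)) = (\<Sum>m\<in>stage_set L. c m b0 * pairing u (edge_word m))"
    proof (rule sum.mono_neutral_left)
      show "\<forall>m\<in>stage_set L - set (level L d). c m b0 * pairing u (edge_word m) = 0"
      proof
        fix m assume "m \<in> stage_set L - set (level L d)"
        then have "length u \<noteq> length (edge_word m)" using True by (auto simp: level_eq[OF st])
        then show "c m b0 * pairing u (edge_word m) = 0" by (simp add: pairing_length)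
      qed
    qed (auto simp: level_eq[OF st])
    ultimately show ?thesis by simp
  next
    case False
    have "pairing u (edge_word m) = 0" if "m \<in> set (level L d)" for m
      by (rule pairing_length) (use False that in \<open>auto simp: level_eq[OF st]\<close>)
    then show ?thesis by simp
  qed
  then have "c m0 b0 = 0"
    by (rule star_indep_set[OF stage_indep[OF st]]) (use m0 in \<open>auto simp: level_eq[OF st]\<close>)
  then show False using m0 by simp
qed

lemma product_inj:
  assumes st: "stage (Suc k) L" and N: "word_indep N" "finite N" "N \<subseteq> lists {..<k}"
  shows "inj_on (\<lambda>(m, b). m @ b) (stage_set L \<times> N)"
proof (rule inj_onI, clarify)
  fix m b m' b'
  assume m: "m \<in> stage_set L" "b \<in> N" "m' \<in> stage_set L" "b' \<in> N" and eq: "m @ b = m' @ b'"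
  show "m = m' \<and> b = b'"
  proof (rule ccontr)
    assume ne: "\<not> (m = m' \<and> b = b')"
    let ?c = "\<lambda>x y. (if x = m \<and> y = b then 1 else 0) - (if x = m' \<and> y = b' then 1 else (0 :: rat))"
    have one: "(\<Sum>x\<in>stage_set L. \<Sum>y\<in>N. (if x = p \<and> y = q then 1 else 0) * g x y) = g p q"
      if "p \<in> stage_set L" "q \<in> N" for p q and g :: "_ \<Rightarrow> _ \<Rightarrow> rat"
    proof -
      have "(\<Sum>x\<in>stage_set L. \<Sum>y\<in>N. (if x = p \<and> y = q then 1 else 0) * g x y)
          = (\<Sum>x\<in>stage_set L. if x = p then (\<Sum>y\<in>N. if y = q then g p q else 0) else 0)"
        by (intro sum.cong refl) (auto intro!: sum.cong sum.neutral)
      then show ?thesis using that N(2) by simp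
    qed
    have "?c m b = 0"
    proof (rule product_indep[OF st N _ m(1,2), where c = ?c])
      fix u
      show "(\<Sum>x\<in>stage_set L. \<Sum>y\<in>N. ?c x y * pairing u (edge_word (x @ y))) = 0"
        using one[OF m(1,2), of "\<lambda>x y. pairing u (edge_word (x @ y))"]
          one[OF m(3,4), of "\<lambda>x y. pairing u (edge_word (x @ y))"] eq
        by (simp add: left_diff_distrib sum_subtractf flip: map_append)
    qed
    then show False using ne by auto
  qed
qed

lemma normal_forms_indep:
  assumes "\<And>j. 0 < j \<Longrightarrow> j \<le> k \<Longrightarrow> stage j (L j)"
  shows "word_indep (normal_forms L k)"
  using assms
proof (induction k)
  case 0
  show ?case
    unfolding word_indep_def normal_forms.simps
  proof (intro allI impI ballI)
    fix c :: "nat list \<Rightarrow> rat" and w :: "nat list"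
    assume c: "\<forall>u. (\<Sum>w\<in>{[]}. c w * pairing u (edge_word w)) = 0" and "w \<in> {[]}"
    then show "c w = 0" using c[THEN spec, of "[]"] by simp
  qed
next
  case (Suc k)
  have st: "stage (Suc k) (L (Suc k))" using Suc.prems by simp
  have N: "word_indep (normal_forms L k)" "finite (normal_forms L k)" "normal_forms L k \<subseteq> lists {..<k}"
    using Suc by (auto intro!: normal_forms_words)
  note inj = product_inj[OF st N]
  show ?case
    unfolding word_indep_def
  proof (intro allI impI ballI)
    fix c :: "nat list \<Rightarrow> rat" and w
    assume c: "\<forall>u. (\<Sum>w\<in>normal_forms L (Suc k). c w * pairing u (edge_word w)) = 0"
      and w: "w \<in> normal_forms L (Suc k)"
    have "(\<Sum>m\<in>stage_set (L (Suc k)). \<Sum>b\<in>normal_forms L k. c (m @ b) * pairing u (edge_word (m @ b))) = 0" for u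
    proof -
      have "(\<Sum>w\<in>normal_forms L (Suc k). c w * pairing u (edge_word w))
          = (\<Sum>(m, b)\<in>stage_set (L (Suc k)) \<times> normal_forms L k. c (m @ b) * pairing u (edge_word (m @ b)))"
        unfolding normal_forms.simps by (subst sum.reindex[OF inj]) (simp add: case_prod_beta)
      then show ?thesis using c by (simp add: sum.cartesian_product)
    qed
    note z = product_indep[OF st N, where c = "\<lambda>m b. c (m @ b)", OF this]
    show "c w = 0" using w z by auto
  qed
qed

subsection \<open>Counting\<close>

definition nf_series :: "(nat \<Rightarrow> nat list list list) \<Rightarrow> nat \<Rightarrow> rat fps" where
  "nf_series L k = Abs_fps (\<lambda>d. of_nat (card {w \<in> normal_forms L k. length w = d}))"

definition level_series :: "nat list list list \<Rightarrow> rat fps" where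
  "level_series L = Abs_fps (\<lambda>d. of_nat (length (level L d)))"

lemma nf_series_0: "nf_series L 0 = 1"
  by (rule fps_ext) (auto simp: nf_series_def card_eq_0_iff)

lemma nf_series_Suc:
  assumes "\<And>j. 0 < j \<Longrightarrow> j \<le> Suc k \<Longrightarrow> stage j (L j)"
  shows "nf_series L (Suc k) = level_series (L (Suc k)) * nf_series L k"
proof (rule fps_ext)
  fix d
  let ?M = "stage_set (L (Suc k))" and ?N = "normal_forms L k"
  have st: "stage (Suc k) (L (Suc k))" using assms by simp
  have N: "word_indep ?N" "finite ?N" "?N \<subseteq> lists {..<k}"
    using assms by (auto intro!: normal_forms_indep normal_forms_words)
  note inj = product_inj[OF st N]
  have card_level: "card {w \<in> ?M. length w = i} = length (level (L (Suc k)) i)" for i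
    using distinct_card[OF star_indep_distinct[OF stage_indep[OF st]]] level_eq[OF st] by metis
  let ?P = "\<lambda>i. {w \<in> ?M. length w = i} \<times> {w \<in> ?N. length w = d - i}"
  have "{w \<in> normal_forms L (Suc k). length w = d} = (\<lambda>(m, b). m @ b) ` (\<Union>i\<in>{0..d}. ?P i)"
    by (auto simp: image_iff)
  moreover have "inj_on (\<lambda>(m, b). m @ b) (\<Union>i\<in>{0..d}. ?P i)"
    by (rule inj_on_subset[OF inj]) auto
  ultimately have "card {w \<in> normal_forms L (Suc k). length w = d} = card (\<Union>i\<in>{0..d}. ?P i)"
    by (simp add: card_image)
  also have "\<dots> = (\<Sum>i\<in>{0..d}. card (?P i))"
    by (rule card_UN_disjoint) auto
  also have "\<dots> = (\<Sum>i=0..d. length (level (L (Suc k)) i) * card {w \<in> ?N. length w = d - i})"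
    by (simp add: card_cartesian_product card_level)
  finally show "fps_nth (nf_series L (Suc k)) d = fps_nth (level_series (L (Suc k)) * nf_series L k) d"
    by (simp add: nf_series_def level_series_def fps_mult_nth)
qed

fun list_series :: "int list \<Rightarrow> rat fps" where
  "list_series [] = 0"
| "list_series (x # xs) = of_int x + fps_X * list_series xs"

fun list_add :: "int list \<Rightarrow> int list \<Rightarrow> int list" where
  "list_add [] ys = ys"
| "list_add (x # xs) [] = x # xs"
| "list_add (x # xs) (y # ys) = (x + y) # list_add xs ys"

fun list_mul :: "int list \<Rightarrow> int list \<Rightarrow> int list" where
  "list_mul [] ys = []"
| "list_mul (x # xs) ys = list_add (map ((*) x) ys) (0 # list_mul xs ys)"

lemma list_series_add: "list_series (list_add xs ys) = list_series xs + list_series ys"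
  by (induction xs ys rule: list_add.induct) (auto simp: algebra_simps)

lemma list_series_scale: "list_series (map ((*) c) ys) = of_int c * list_series ys"
  by (induction ys) (auto simp: algebra_simps)

lemma list_series_mul: "list_series (list_mul xs ys) = list_series xs * list_series ys"
  by (induction xs) (auto simp: list_series_add list_series_scale algebra_simps)

lemma list_series_nth: "fps_nth (list_series xs) d = (if d < length xs then of_int (xs ! d) else 0)"
proof (induction xs arbitrary: d)
  case (Cons x xs)
  then show ?case by (cases d) (auto simp: fps_of_int[symmetric])
qed simp

lemma qint_eq_list_series: "qint n = list_series (replicate n 1)"
proof (rule fps_ext)
  fix d
  have "fps_nth (qint n) d = (\<Sum>i<n. if d = i then 1 else 0)"
    unfolding qint_def by (simp add: fps_sum_nth fps_X_power_nth)
  then show "fps_nth (qint n) d = fps_nth (list_series (replicate n 1)) d"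
    by (simp add: list_series_nth)
qed

lemma list_series_zeros: "list_series (xs @ replicate n 0) = list_series xs"
  by (rule fps_ext) (auto simp: list_series_nth nth_append)

definition cert_sizes :: "certificate \<Rightarrow> int list" where
  "cert_sizes ls = 1 # map (\<lambda>l. int (length (level_news 0 (fst l)))) ls"

lemma map_length_levels: "map (\<lambda>W. int (length W)) (levels W ls) = int (length W) # map (\<lambda>l. int (length (level_news 0 (fst l)))) ls"
  by (induction ls arbitrary: W) (auto simp: next_words_def)

lemma level_series_levels: "level_series (levels [[]] ls) = list_series (cert_sizes ls)"
proof (rule fps_ext)
  fix d
  have eq: "cert_sizes ls = map (\<lambda>W. int (length W)) (levels [[]] ls)"
    by (simp add: cert_sizes_def map_length_levels)
  show "fps_nth (level_series (levels [[]] ls)) d = fps_nth (list_series (cert_sizes ls)) d"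
    unfolding eq by (simp add: level_series_def list_series_nth level_def)
qed

lemma stage_check: "check k ls \<Longrightarrow> 0 < k \<Longrightarrow> stage k (levels [[]] ls)"
  using check_sound[of k ls] by (cases ls) (auto simp: stage_def level_def)

section \<open>Subalgebras of the Fomin--Kirillov algebra\<close>

lemma FKL_eq: "FKL n = offdiag {1..n}"
  by (simp add: FKL_def offdiag_def)

lemma fin_supp_gen [simp]: "fin_supp (gen x)"
  by (simp add: gen_eq_fword)

lemma fin_supp_FK_rels: "r \<in> FK_rels n \<Longrightarrow> fin_supp r"
  by (auto simp: FK_rels_def)

lemma fa_eval_gen [simp]: "fa_eval \<phi> (gen x) = \<phi> [x]"
  by (simp add: gen_eq_fword)

lemma annihilates_FK_rels_iff: "annihilates (FKL n) (FK_rels n) \<phi> \<longleftrightarrow> FK_fun {1..n} \<phi>"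
proof
  assume F: "FK_fun {1..n} \<phi>"
  show "annihilates (FKL n) (FK_rels n) \<phi>"
    unfolding annihilates_def
  proof (intro ballI)
    fix r A B assume "r \<in> FK_rels n" and "A \<in> lists (FKL n)" "B \<in> lists (FKL n)"
    note D = FK_fun_D[OF F this(2,3)[unfolded FKL_eq]]
    from \<open>r \<in> FK_rels n\<close> consider
      (anti) i j where "r = fadd (gen (i,j)) (gen (j,i))" "i \<in> {1..n}" "j \<in> {1..n}" "i \<noteq> j"
    | (sq) i j where "r = fmul (gen (i,j)) (gen (i,j))" "i \<in> {1..n}" "j \<in> {1..n}" "i \<noteq> j"
    | (com) i j k l where "r = fadd (fmul (gen (i,j)) (gen (k,l))) (fneg (fmul (gen (k,l)) (gen (i,j))))"
        "{i, j, k, l} \<subseteq> {1..n}" "distinct [i, j, k, l]"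
    | (tri) i j k where "r = fadd (fadd (fmul (gen (i,j)) (gen (j,k))) (fmul (gen (j,k)) (gen (k,i))))
          (fmul (gen (k,i)) (gen (i,j)))" "{i, j, k} \<subseteq> {1..n}" "distinct [i, j, k]"
      unfolding FK_rels_def FKL_def by fast
    then show "fa_eval (\<lambda>w. \<phi> (A @ w @ B)) r = 0"
    proof cases
      case anti
      then show ?thesis using D(1)[OF anti(2-4)] by simp
    next
      case sq
      then show ?thesis using D(2)[OF sq(2-4)] by simp
    next
      case com
      then show ?thesis using D(3)[OF com(2,3)] by simp
    next
      case tri
      then show ?thesis using D(4)[OF tri(2,3)] by simp
    qed
  qed
next
  assume ann: "annihilates (FKL n) (FK_rels n) \<phi>"
  have ev: "fa_eval (\<lambda>w. \<phi> (A @ w @ B)) r = 0"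
    if "A \<in> lists (offdiag {1..n})" "B \<in> lists (offdiag {1..n})" "r \<in> FK_rels n" for A B r
    using ann that unfolding annihilates_def FKL_eq by blast
  show "FK_fun {1..n} \<phi>"
    unfolding FK_fun_def
  proof (intro conjI allI impI)
    fix A B and i j :: nat
    assume AB: "A \<in> lists (offdiag {1..n})" "B \<in> lists (offdiag {1..n})"
      and ij: "i \<in> {1..n}" "j \<in> {1..n}" "i \<noteq> j"
    then have "(i, j) \<in> FKL n" by (simp add: FKL_def)
    then have "fadd (gen (i,j)) (gen (j,i)) \<in> FK_rels n" "fmul (gen (i,j)) (gen (i,j)) \<in> FK_rels n"
      unfolding FK_rels_def by blast+
    from this[THEN ev[OF AB]]
    show "\<phi> (A @ [(j, i)] @ B) = - \<phi> (A @ [(i, j)] @ B)" "\<phi> (A @ [(i, j), (i, j)] @ B) = 0"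
      by simp_all
  next
    fix A B and i j k l :: nat
    assume AB: "A \<in> lists (offdiag {1..n})" "B \<in> lists (offdiag {1..n})"
      and V: "{i, j, k, l} \<subseteq> {1..n}" "distinct [i, j, k, l]"
    have "i \<in> {1..n}" "j \<in> {1..n}" "k \<in> {1..n}" "l \<in> {1..n}" using V by auto
    then have "fadd (fmul (gen (i,j)) (gen (k,l))) (fneg (fmul (gen (k,l)) (gen (i,j)))) \<in> FK_rels n"
      unfolding FK_rels_def using V(2) by blast
    from ev[OF AB this] show "\<phi> (A @ [(i, j), (k, l)] @ B) = \<phi> (A @ [(k, l), (i, j)] @ B)"
      by simp
  next
    fix A B and i j k :: nat
    assume AB: "A \<in> lists (offdiag {1..n})" "B \<in> lists (offdiag {1..n})"
      and V: "{i, j, k} \<subseteq> {1..n}" "distinct [i, j, k]"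
    have "i \<in> {1..n}" "j \<in> {1..n}" "k \<in> {1..n}" using V by auto
    then have "fadd (fadd (fmul (gen (i,j)) (gen (j,k))) (fmul (gen (j,k)) (gen (k,i))))
          (fmul (gen (k,i)) (gen (i,j))) \<in> FK_rels n"
      unfolding FK_rels_def using V(2) by blast
    from ev[OF AB this] show "\<phi> (A @ [(i, j), (j, k)] @ B) + \<phi> (A @ [(j, k), (k, i)] @ B)
        + \<phi> (A @ [(k, i), (i, j)] @ B) = 0"
      by simp
  qed
qed

lemma FK_fun_map:
  assumes F: "FK_fun UNIV \<psi>" and inj: "inj_on g V"
  shows "FK_fun V (\<lambda>w. \<psi> (map (map_prod g g) w))"
proof -
  have mem: "map (map_prod g g) A \<in> lists (offdiag UNIV)" if "A \<in> lists (offdiag V)" for A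
  proof -
    have "map_prod g g x \<in> offdiag UNIV" if "x \<in> set A" for x
      using that \<open>A \<in> lists (offdiag V)\<close> inj by (auto simp: offdiag_def inj_on_def)
    then show ?thesis by auto
  qed
  have g: "g x = g y \<longleftrightarrow> x = y" if "x \<in> V" "y \<in> V" for x y
    using inj that by (auto simp: inj_on_def)
  show ?thesis
    unfolding FK_fun_def
  proof (intro conjI allI impI)
    fix A B i j assume "A \<in> lists (offdiag V)" "B \<in> lists (offdiag V)" and V: "i \<in> V" "j \<in> V" "i \<noteq> j"
    note D = FK_fun_D[OF F mem mem, OF this(1,2)]
    show "\<psi> (map (map_prod g g) (A @ [(j, i)] @ B)) = - \<psi> (map (map_prod g g) (A @ [(i, j)] @ B))"
      using D(1)[of "g i" "g j"] V g by simp
    show "\<psi> (map (map_prod g g) (A @ [(i, j), (i, j)] @ B)) = 0"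
      using D(2)[of "g i" "g j"] V g by simp
  next
    fix A B i j k l assume "A \<in> lists (offdiag V)" "B \<in> lists (offdiag V)" and V: "{i, j, k, l} \<subseteq> V" "distinct [i, j, k, l]"
    note D = FK_fun_D[OF F mem mem, OF this(1,2)]
    show "\<psi> (map (map_prod g g) (A @ [(i, j), (k, l)] @ B)) = \<psi> (map (map_prod g g) (A @ [(k, l), (i, j)] @ B))"
      using D(3)[of "g i" "g j" "g k" "g l"] V g by simp
  next
    fix A B i j k assume "A \<in> lists (offdiag V)" "B \<in> lists (offdiag V)" and V: "{i, j, k} \<subseteq> V" "distinct [i, j, k]"
    note D = FK_fun_D[OF F mem mem, OF this(1,2)]
    show "\<psi> (map (map_prod g g) (A @ [(i, j), (j, k)] @ B)) + \<psi> (map (map_prod g g) (A @ [(j, k), (k, i)] @ B))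
        + \<psi> (map (map_prod g g) (A @ [(k, i), (i, j)] @ B)) = 0"
      using D(4)[of "g i" "g j" "g k"] V g by simp
  qed
qed

lemma G_rels_gen_ideal_subset:
  assumes E: "E \<subseteq> FKL n"
  shows "gen_ideal E (G_rels E) \<subseteq> gen_ideal (FKL n) (FK_rels n)"
proof
  fix p assume "p \<in> gen_ideal E (G_rels E)"
  then show "p \<in> gen_ideal (FKL n) (FK_rels n)"
  proof induction
    case (gi_gen r)
    show ?case
    proof (rule gen_ideal_separation)
      fix \<phi> assume "annihilates (FKL n) (FK_rels n) \<phi>"
      then have "annihilates E (G_rels E) \<phi>"
        unfolding annihilates_FK_rels_iff
        by (rule FK_fun_annihilates_G_rels) (use E in \<open>simp only: FKL_eq\<close>)
      then show "fa_eval \<phi> r = 0"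
        using fa_eval_gen_ideal[of "G_rels E" r E \<phi>] fin_supp_G_rels gen_ideal.gi_gen[OF gi_gen] by blast
    qed (use fin_supp_FK_rels fin_supp_G_rels gi_gen in blast)+
  qed (use E in \<open>auto intro: gen_ideal.intros\<close>)
qed

lemma adj_oriented: "adj E j a \<Longrightarrow> E \<subseteq> {(i, j). i < j} \<Longrightarrow> oriented j a \<in> E"
  by (auto simp: adj_def oriented_def)

lemma supp_fadd: "\<forall>w. p w \<noteq> 0 \<longrightarrow> Q w \<Longrightarrow> \<forall>w. q w \<noteq> 0 \<longrightarrow> Q w \<Longrightarrow> fadd p q w \<noteq> 0 \<Longrightarrow> Q w"
  by (auto simp: fadd_def) (metis add.right_neutral)

lemma supp_fmul_X:
  assumes "\<forall>w. p w \<noteq> 0 \<longrightarrow> set w \<subseteq> E" "oriented j a \<in> E"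
  shows "\<forall>w. fmul (X j a) p w \<noteq> 0 \<longrightarrow> set w \<subseteq> E"
proof (intro allI impI)
  fix w assume "fmul (X j a) p w \<noteq> 0"
  then have "fsc (edge_sign j a) (fmul (gen (oriented j a)) p) w \<noteq> 0"
    unfolding X_eq fmul_fsc_left .
  then have "fmul (gen (oriented j a)) p w \<noteq> 0" by (auto simp: fsc_def)
  then have "w \<in> {w. fmul (gen (oriented j a)) p w \<noteq> 0}" by simp
  then have "w \<in> (#) (oriented j a) ` {w. p w \<noteq> 0}" unfolding supp_fmul_gen_left .
  then obtain v where "w = oriented j a # v" "p v \<noteq> 0" by auto
  then show "set w \<subseteq> E" using assms by simp
qed

lemma supp_gen_ideal_G_rels:
  assumes E: "E \<subseteq> {(i, j). i < j}" and "p \<in> gen_ideal E (G_rels E)"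
  shows "\<forall>w. p w \<noteq> 0 \<longrightarrow> set w \<subseteq> E"
  using assms(2)
proof induction
  case (gi_gen r)
  have X: "\<forall>w. X j a w \<noteq> 0 \<longrightarrow> set w \<subseteq> E" if "oriented j a \<in> E" for j a
    using that by (auto simp: X_eq gen_def fsc_def)
  have neg: "\<forall>w. fneg p w \<noteq> 0 \<longrightarrow> set w \<subseteq> E" if "\<forall>w. p w \<noteq> 0 \<longrightarrow> set w \<subseteq> E" for p
    using that unfolding fneg_def fsc_def by auto
  have add: "\<forall>w. fadd p q w \<noteq> 0 \<longrightarrow> set w \<subseteq> E"
    if "\<forall>w. p w \<noteq> 0 \<longrightarrow> set w \<subseteq> E" "\<forall>w. q w \<noteq> 0 \<longrightarrow> set w \<subseteq> E" for p q
    using supp_fadd[OF that] by blast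
  have adjE: "adj E a b" if "(a, b) \<in> E" for a b using that by (simp add: adj_def)
  note o = adj_oriented[OF _ E]
  from gi_gen show ?case
    unfolding G_rels_def
    by (elim UnE CollectE exE conjE)
      (simp only:, intro add neg supp_fmul_X X o, (assumption | (rule adjE, assumption))+)+
next
  case (gi_add p q)
  then show ?case using supp_fadd[of p "\<lambda>w. set w \<subseteq> E" q] by blast
next
  case (gi_left p x)
  have "set w \<subseteq> E" if "fmul (gen x) p w \<noteq> 0" for w
  proof -
    have "w \<in> {w. fmul (gen x) p w \<noteq> 0}" using that by simp
    then have "w \<in> (#) x ` {w. p w \<noteq> 0}" unfolding supp_fmul_gen_left .
    then obtain v where "w = x # v" "p v \<noteq> 0" by auto
    then show ?thesis using gi_left by simp
  qed
  then show ?case by simp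
next
  case (gi_right p x)
  have "set w \<subseteq> E" if "fmul p (gen x) w \<noteq> 0" for w
  proof -
    have "w \<in> {w. fmul p (gen x) w \<noteq> 0}" using that by simp
    then have "w \<in> (\<lambda>w. w @ [x]) ` {w. p w \<noteq> 0}" unfolding supp_fmul_gen_right .
    then obtain v where "w = v @ [x]" "p v \<noteq> 0" by auto
    then show ?thesis using gi_right by simp
  qed
  then show ?case by simp
qed (auto simp: fzero_def fsc_def)

subsection \<open>Dimensions of quotients\<close>

lemma sum_fa_apply: "(\<Sum>x\<in>A. g x) w = (\<Sum>x\<in>A. g x w)" for g :: "'b \<Rightarrow> 'g fa"
  by (induction A rule: infinite_finite_induct) auto

lemma lin_comb_eq: "lin_comb S c = (\<Sum>v\<in>S. fsc (c v) v)"
  by (rule ext) (simp add: lin_comb_def sum_fa_apply fsc_def)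

lemma inj_fword: "inj fword"
proof (rule injI)
  fix x y :: "'g list" assume "fword x = fword y"
  then have "fword x x = fword y x" by simp
  then show "x = y" by (simp add: fword_def split: if_splits)
qed

lemma independent_fword:
  assumes "finite N"
  shows "fa.independent (fword ` N)"
proof (rule fa.independent_if_scalars_zero)
  fix f and x :: "'a fa" assume s: "(\<Sum>x\<in>fword ` N. fsc (f x) x) = 0" and x: "x \<in> fword ` N"
  obtain w where w: "w \<in> N" "x = fword w" using x by auto
  have "(\<Sum>x\<in>fword ` N. fsc (f x) x) w = (\<Sum>u\<in>N. f (fword u) * fword u w)"
    by (subst sum.reindex) (auto simp: sum_fa_apply fsc_def inj_on_subset[OF inj_fword])
  also have "\<dots> = (\<Sum>u\<in>N. if u = w then f (fword w) else 0)"
    by (rule sum.cong) (auto simp: fword_def)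
  also have "\<dots> = f x" using w assms by simp
  finally show "f x = 0" using s by simp
qed (use assms in simp)

lemma dim_quot_eq_card:
  assumes I: "fa.subspace I" and B: "finite B" "B \<subseteq> V" "fa.independent B"
    and BI: "\<And>s. s \<in> fa.span B \<Longrightarrow> s \<in> I \<Longrightarrow> s = 0"
    and V: "\<And>v. v \<in> V \<Longrightarrow> \<exists>s\<in>fa.span B. v - s \<in> I"
  shows "dim_quot V I = card B"
proof -
  have low: "indep_mod I B"
    unfolding indep_mod_def
  proof (intro conjI allI impI ballI)
    fix c v assume c: "lin_comb B c \<in> I" and v: "v \<in> B"
    have "lin_comb B c \<in> fa.span B"
      unfolding lin_comb_eq by (intro fa.span_sum fa.span_scale fa.span_base)
    then have "(\<Sum>v\<in>B. fsc (c v) v) = 0" using BI c by (simp add: lin_comb_eq)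
    then show "c v = 0" using fa.independentD[OF B(3,1) subset_refl _ v] by blast
  qed (rule B(1))
  have up: "card S \<le> card B" if S: "S \<subseteq> V" "indep_mod I S" for S
  proof -
    have finS: "finite S" using S(2) by (simp add: indep_mod_def)
    have zero: "c v = 0" if "lin_comb S c \<in> I" "v \<in> S" for c v
      using S(2) that by (auto simp: indep_mod_def)
    have "\<forall>v\<in>S. \<exists>s\<in>fa.span B. v - s \<in> I" using V S(1) by blast
    then obtain s where s: "\<And>v. v \<in> S \<Longrightarrow> s v \<in> fa.span B" "\<And>v. v \<in> S \<Longrightarrow> v - s v \<in> I" by metis
    have red: "lin_comb S c \<in> I" if "(\<Sum>v\<in>S. fsc (c v) (s v)) = 0" for c
    proof -
      have "lin_comb S c = (\<Sum>v\<in>S. fsc (c v) (v - s v))"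
        using that by (simp add: lin_comb_eq fa.scale_right_diff_distrib sum_subtractf)
      also have "\<dots> \<in> I" using s(2) by (intro fa.subspace_sum[OF I] fa.subspace_scale[OF I])
      finally show ?thesis .
    qed
    have inj: "inj_on s S"
    proof (rule inj_onI, rule ccontr)
      fix v v' assume v: "v \<in> S" "v' \<in> S" "s v = s v'" "v \<noteq> v'"
      let ?c = "\<lambda>x. if x = v then 1 else if x = v' then -1 else (0 :: rat)"
      have "(\<Sum>x\<in>S. fsc (?c x) (s x)) = (\<Sum>x\<in>S. (if x = v then s v else 0) - (if x = v' then s v' else 0))"
        by (rule sum.cong) (use v in auto)
      also have "\<dots> = 0" using v finS by (simp add: sum_subtractf)
      finally have "lin_comb S ?c \<in> I" by (rule red)
      from zero[OF this v(1)] show False by simp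
    qed
    have ind: "fa.independent (s ` S)"
    proof (rule fa.independent_if_scalars_zero)
      fix f x assume "(\<Sum>x\<in>s ` S. fsc (f x) x) = 0" and "x \<in> s ` S"
      then obtain v where v: "v \<in> S" "x = s v" by auto
      have "(\<Sum>v\<in>S. fsc (f (s v)) (s v)) = 0"
        using \<open>(\<Sum>x\<in>s ` S. fsc (f x) x) = 0\<close> by (simp add: sum.reindex[OF inj])
      then have "lin_comb S (\<lambda>v. f (s v)) \<in> I" by (rule red)
      from zero[OF this v(1)] show "f x = 0" using v by simp
    qed (use finS in simp)
    have "s ` S \<subseteq> fa.span B" using s(1) by blast
    then have "card (s ` S) \<le> card B"
      using fa.independent_span_bound[OF B(1) ind] by blast
    then show ?thesis by (simp add: card_image[OF inj])
  qed
  show ?thesis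
    unfolding dim_quot_def
  proof (rule Max_eqI)
    show "finite {card S | S. S \<subseteq> V \<and> indep_mod I S}"
      by (rule finite_subset[of _ "{..card B}"]) (use up in auto)
  qed (use up low B(2) in auto)
qed

definition cert1 :: "certificate" where
"cert1 =
[([[New]],[(0,0,0)]),
([[Rel 0 0]],[])]"

definition cert2 :: "certificate" where
"cert2 =
[([[Kill],[New]],[(0,1,0)]),
([[New],[Rel 1 0]],[(0,0,0)]),
([[Rel 0 0],[Rel 0 0]],[])]"

definition cert3 :: "certificate" where
"cert3 =
[([[Kill],[Kill],[New]],[(0,2,0)]),
([[Rel 2 0],[New],[Rel 2 0]],[(0,1,0)]),
([[New],[Rel 1 0],[Rel 1 0]],[(0,0,0)]),
([[Rel 0 0],[Rel 0 0],[Rel 0 0]],[])]"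

definition cert4 :: "certificate" where
"cert4 =
[([[Kill],[Kill],[Kill],[New]],[(0,2,0)]),
([[Rel 3 0],[New],[New],[Rel 3 0]],[(0,1,0),(1,3,0)]),
([[New,Rel 2 0],[Rel 1 0,New],[New,Rel 2 0],[Rel 1 0,Rel 2 0]],[(0,0,0),(1,3,0),(2,1,1)]),
([[Rel 0 0,New,New],[Rel 0 0,Rel 1 1,New],[Rel 0 0,Rel 1 0,Rel 2 0],[Rel 0 0,Claw True 0,Claw False 0]],[(0,3,
0),(1,0,2),(2,1,1)]),
([[Rel 0 1,Rel 0 2,New],[Rel 0 1,New,Rel 1 2],[Rel 0 1,Rel 2 0,Rel 2 1],[Rel 0 1,Rel 0 2,New]],[(0,1,0),(1,0,
2),(2,2,2)]),
([[Rel 0 2,New,New],[Rel 0 2,Rel 1 1,Rel 3 2],[Rel 2 0,Rel 1 0,Rel 3 1],[Rel 0 2,New,Rel 3 2]],[(0,0,0),(1,2,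
0),(2,0,2)]),
([[Rel 0 1,Rel 0 2,New],[Rel 1 0,New,Rel 3 1],[Rel 0 1,Rel 0 2,Claw True 0],[Rel 0 1,Rel 3 0,Rel 3 1]],[(0,0,
1),(1,2,0)]),
([[Rel 0 2,Rel 1 2],[New,Rel 1 1],[Rel 0 2,Claw False 0],[Rel 3 0,Rel 1 0]],[(0,0,1)]),
([[Rel 1 2],[Rel 1 0],[New],[Rel 3 1]],[(0,1,0)]),
([[Rel 2 0],[Rel 2 0],[Rel 2 0],[Rel 2 1]],[])]"

definition cert5 :: "certificate" where
"cert5 =
[([[Kill],[Kill],[Kill],[Kill],[New]],[(0,4,0)]),
([[Rel 4 0],[Rel 4 0],[Rel 4 0],[New],[Rel 4 0]],[(0,2,0)]),
([[Rel 3 0],[New],[New],[Rel 3 0],[Rel 3 0]],[(0,1,0),(1,3,0)]),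
([[New,Rel 2 0],[Rel 1 0,New],[New,Rel 2 0],[Rel 1 0,Rel 2 0],[Rel 1 0,Rel 2 0]],[(0,0,0),(1,3,0),(2,1,1)]),
([[Rel 0 0,New,New],[Rel 0 0,Rel 1 1,New],[Rel 0 0,Rel 1 0,Rel 2 0],[Rel 0 0,Claw True 0,Claw False 0],
[Rel 0 0,Rel 1 1,Rel 2 0]],[(0,3,0),(1,0,2),(2,1,1)]),
([[Rel 0 1,Rel 0 2,New],[Rel 0 1,New,Rel 1 2],[Rel 0 1,Rel 2 0,Rel 2 1],[Rel 0 1,Rel 0 2,New],[Rel 0 1,
Rel 0 2,Rel 1 2]],[(0,1,0),(1,0,2),(2,2,2)]),
([[Rel 0 2,New,New],[Rel 0 2,Rel 1 1,Rel 3 2],[Rel 2 0,Rel 1 0,Rel 3 1],[Rel 0 2,New,Rel 3 2],[Rel 0 2,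
Rel 1 1,New]],[(0,0,0),(1,2,0),(2,0,2),(3,4,2)]),
([[Rel 0 1,Rel 0 2,New,New],[Rel 1 0,New,Rel 3 1,Rel 4 2],[Rel 0 1,Rel 0 2,Claw True 0,Rel 4 2],[Rel 0 1,
Rel 3 0,Rel 3 1,Rel 4 2],[Rel 0 1,Rel 0 2,New,Rel 4 2]],[(0,0,1),(1,4,1),(2,2,0),(3,0,3)]),
([[Rel 0 2,Rel 0 3,Rel 1 2,New],[New,New,Rel 1 1,Rel 4 2],[Rel 0 2,Rel 0 3,Claw False 0,Rel 4 2],[Rel 3 0,
Rel 0 3,Rel 1 0,Rel 4 1],[Rel 0 2,Rel 4 1,Rel 1 1,Rel 4 2]],[(0,0,1),(1,0,2),(2,4,2)]),
([[Rel 0 3,Rel 1 2,Rel 1 3],[New,Rel 1 0,Rel 1 1],[Rel 0 3,New,Rel 4 2],[Rel 0 3,Rel 3 2,New],[Rel 4 0,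
Rel 1 0,Rel 4 2]],[(0,0,2),(1,1,1),(2,4,1)]),
([[Rel 1 3,Rel 2 1,Rel 3 2],[Rel 1 0,Rel 2 0,Rel 3 1],[New,Rel 2 1,New],[New,Rel 2 2,Rel 3 2],[Rel 4 1,
Rel 2 1,Rel 3 2]],[(0,1,0),(1,4,1),(2,0,2)]),
([[Rel 2 0,Rel 2 2,Rel 3 0],[Rel 2 0,Claw True 1,Rel 3 0],[Rel 2 0,Rel 2 2,New],[New,Rel 2 2,Rel 3 0],
[Rel 4 1,Rel 2 2,Rel 4 2]],[(0,0,1),(1,1,2)]),
([[Rel 2 2,Rel 3 0],[Rel 4 1,Claw False 0],[Rel 2 2,New],[Rel 2 0,Rel 3 0],[Rel 4 1,Rel 3 1]],[(0,1,0)]),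
([[Rel 2 1],[New],[Rel 2 1],[Rel 3 0],[Rel 2 1]],[(0,2,0)]),
([[New],[Rel 1 0],[Rel 1 1],[Rel 1 0],[Rel 1 0]],[(0,3,0)]),
([[Rel 0 0],[Rel 0 0],[Rel 0 0],[Rel 0 0],[Rel 0 0]],[])]"

definition cert6 :: "certificate" where
"cert6 =
[([[Kill],[Kill],[Kill],[Kill],[Kill],[New]],[(0,5,0)]),
([[Rel 5 0],[Rel 5 0],[Rel 5 0],[Rel 5 0],[New],[Rel 5 0]],[(0,4,0)]),
([[Rel 4 0],[Rel 4 0],[Rel 4 0],[New],[Rel 4 0],[Rel 4 0]],[(0,2,0)]),
([[Rel 3 0],[New],[New],[Rel 3 0],[Rel 3 0],[Rel 3 0]],[(0,1,0),(1,3,0)]),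
([[New,Rel 2 0],[Rel 1 0,New],[New,Rel 2 0],[Rel 1 0,Rel 2 0],[Rel 1 0,Rel 2 0],[Rel 1 0,Rel 2 0]],[(0,0,0),
(1,3,0),(2,1,1)]),
([[Rel 0 0,New,New],[Rel 0 0,Rel 1 1,New],[Rel 0 0,Rel 1 0,Rel 2 0],[Rel 0 0,Claw True 0,Claw False 0],
[Rel 0 0,Rel 1 1,Rel 2 0],[Rel 0 0,Rel 1 1,Rel 2 0]],[(0,3,0),(1,0,2),(2,1,1)]),
([[Rel 0 1,Rel 0 2,New],[Rel 0 1,New,Rel 1 2],[Rel 0 1,Rel 2 0,Rel 2 1],[Rel 0 1,Rel 0 2,New],[Rel 0 1,
Rel 0 2,Rel 1 2],[Rel 0 1,Rel 0 2,Rel 1 2]],[(0,1,0),(1,0,2),(2,2,2)]),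
([[Rel 0 2,New,New],[Rel 0 2,Rel 1 1,Rel 3 2],[Rel 2 0,Rel 1 0,Rel 3 1],[Rel 0 2,New,Rel 3 2],[Rel 0 2,
Rel 1 1,New],[Rel 0 2,Rel 1 1,Rel 3 2]],[(0,0,0),(1,2,0),(2,0,2),(3,4,2)]),
([[Rel 0 1,Rel 0 2,New,New],[Rel 1 0,New,Rel 3 1,Rel 4 2],[Rel 0 1,Rel 0 2,Claw True 0,Rel 4 2],[Rel 0 1,
Rel 3 0,Rel 3 1,Rel 4 2],[Rel 0 1,Rel 0 2,New,Rel 4 2],[Rel 0 1,Rel 0 2,Rel 3 1,New]],[(0,0,1),(1,4,1),(2,2,
0),(3,0,3),(4,5,3)]),
([[Rel 0 2,Rel 0 3,Rel 1 2,New,New],[New,New,Rel 1 1,Rel 4 2,Rel 5 3],[Rel 0 2,Rel 0 3,Claw False 0,Rel 4 2,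
Rel 5 3],[Rel 3 0,Rel 0 3,Rel 1 0,Rel 4 1,Rel 5 3],[Rel 0 2,Rel 4 1,Rel 1 1,Rel 4 2,Rel 5 2],[Rel 0 2,Rel 0 3,
Rel 1 1,New,Rel 5 3]],[(0,0,1),(1,5,1),(2,0,2),(3,4,2),(4,0,4)]),
([[Rel 0 3,Rel 0 4,Rel 1 2,Rel 1 3,New],[New,New,Rel 1 0,Rel 1 1,Rel 5 3],[Rel 0 3,Rel 0 4,New,Rel 4 2,
Rel 5 3],[Rel 0 3,Rel 0 4,Rel 3 2,New,Rel 5 3],[Rel 4 0,Rel 0 4,Rel 1 0,Rel 4 2,Rel 5 2],[Rel 0 3,Rel 5 1,
Rel 1 0,Rel 1 1,Rel 5 3]],[(0,0,1),(1,0,3),(2,5,3),(3,1,2),(4,4,2)]),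
([[Rel 0 4,Rel 1 3,Rel 1 4,Rel 2 2,Rel 3 3],[New,Rel 1 0,Rel 1 1,Rel 2 0,Rel 3 1],[Rel 0 4,New,Rel 5 3,
Rel 2 2,New],[Rel 0 4,New,New,Rel 2 2,Rel 3 3],[Rel 0 4,Rel 4 2,Rel 1 1,Rel 2 2,Rel 3 2],[Rel 5 0,Rel 1 0,
Rel 5 3,Rel 2 2,Rel 3 3]],[(0,0,2),(1,1,1),(2,4,3),(3,0,4),(4,5,4)]),
([[Rel 1 4,Rel 2 1,Rel 2 4,Rel 3 1,Rel 3 2],[Rel 1 0,Rel 2 0,Claw True 1,Rel 3 0,Rel 3 1],[New,Rel 2 1,
Rel 2 4,New,New],[New,New,Rel 2 3,Rel 3 1,Rel 3 2],[Rel 1 0,Rel 4 3,Rel 2 4,Rel 4 4,New],[Rel 5 1,Rel 2 1,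
Rel 2 4,Rel 3 1,Rel 5 4]],[(0,1,0),(1,0,2),(2,5,2),(3,0,4),(4,1,3),(5,5,3)]),
([[Rel 2 0,Rel 2 3,Rel 2 4,Rel 3 0,Rel 3 1,Rel 4 4],[Rel 2 0,Rel 4 2,Rel 5 2,Rel 3 0,Claw False 0,Rel 4 4],
[Rel 2 0,Rel 2 3,Rel 2 4,New,New,New],[New,Rel 2 1,Rel 2 2,Rel 3 0,Rel 3 1,Rel 4 2],[Rel 2 0,Rel 4 2,Rel 2 4,
New,Rel 3 3,Rel 4 4],[Rel 5 1,Rel 2 3,Rel 5 2,Rel 5 3,Rel 3 1,Rel 4 4]],[(0,0,2),(1,1,1),(2,5,1),(3,1,3),(4,0,
5)]),
([[Rel 2 3,Rel 2 4,Rel 2 5,Rel 3 0,Rel 4 3],[Rel 5 1,New,Rel 4 2,Rel 5 4,Rel 4 3],[Rel 2 3,Rel 2 4,Rel 2 5,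
New,New],[Rel 2 0,Rel 3 1,New,Rel 3 0,Rel 4 0],[Rel 2 3,Rel 2 4,Rel 4 2,New,Rel 4 3],[Rel 5 1,Rel 2 4,Rel 2 5,
Rel 5 4,Rel 5 5]],[(0,2,1),(1,1,0),(2,0,2),(3,5,1),(4,1,4)]),
([[New,Rel 2 3,Rel 2 4,Rel 3 2,Rel 4 3],[Rel 1 1,New,Rel 4 0,New,Rel 4 3],[Rel 1 4,Rel 2 3,Rel 2 4,Rel 3 5,
New],[Rel 1 1,Rel 3 0,New,Rel 3 2,Rel 4 0],[Rel 1 1,Rel 2 3,Rel 4 0,Rel 3 2,Rel 4 3],[Rel 1 1,Rel 5 1,Rel 5 2,
Rel 3 2,Rel 4 4]],[(0,3,0),(1,2,1),(2,5,0),(3,1,2),(4,0,3)]),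
([[Rel 0 0,New,New,Rel 2 4,Rel 3 2],[Rel 0 1,Rel 1 1,Rel 1 3,New,New],[Rel 0 0,Rel 1 3,Claw False 5,Rel 2 4,
Rel 3 4],[Rel 0 0,Rel 1 0,Rel 1 2,New,Rel 3 2],[Rel 0 0,Rel 1 1,Rel 1 3,Rel 4 1,Rel 3 0],[Rel 0 0,Rel 5 0,
Rel 1 3,Rel 2 4,Rel 5 3]],[(0,3,1),(1,5,0),(2,2,3),(3,0,2),(4,1,4)]),
([[Rel 0 1,Rel 0 2,New,New,Rel 3 3],[Rel 0 1,Rel 0 3,Rel 1 3,Rel 1 4,New],[Rel 0 1,Rel 0 2,Rel 1 4,Rel 5 2,
Rel 3 4],[Rel 0 1,Rel 0 2,New,Rel 1 2,Rel 3 3],[Rel 0 1,Rel 0 2,Rel 4 1,Rel 1 4,Rel 4 4],[Rel 5 0,Rel 0 2,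
Rel 1 3,Rel 5 2,Rel 3 3]],[(0,3,2),(1,0,1),(2,1,3),(3,2,4)]),
([[Rel 0 2,Rel 0 3,New,New],[Rel 0 3,Rel 0 4,Rel 1 4,New],[Rel 0 2,Rel 0 3,Rel 4 3,Claw True 4],[Rel 0 2,
Rel 0 3,Rel 1 3,Rel 3 2],[Rel 4 0,Rel 0 3,Rel 4 3,Rel 3 1],[Rel 0 2,Rel 5 1,Rel 1 4,Rel 3 2]],[(0,1,1),(1,3,
3),(2,2,2)]),
([[Rel 0 2,Rel 0 3,New],[Rel 0 4,New,Rel 1 3],[Rel 0 2,Rel 0 3,New],[Rel 0 2,Rel 3 0,Rel 3 2],[Rel 4 1,
Rel 0 3,Rel 1 3],[Rel 0 2,Rel 0 3,Rel 1 3]],[(0,2,0),(1,3,2),(2,4,2)]),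
([[Rel 0 2,New,New],[Rel 0 3,Rel 1 1,Rel 2 3],[Rel 0 2,New,Rel 2 2],[Rel 3 0,Rel 1 0,Rel 2 2],[Rel 0 2,
Rel 1 1,Rel 2 2],[Rel 0 2,Rel 1 1,Rel 2 2]],[(0,3,0),(1,4,0),(2,3,2)]),
([[Rel 0 1,Rel 0 2,New],[Rel 1 0,New,Rel 2 1],[Rel 0 1,Rel 2 0,Rel 2 1],[Rel 0 1,Rel 0 2,Claw False 0],
[Rel 0 1,Rel 0 2,Rel 2 1],[Rel 0 1,Rel 0 2,Rel 2 1]],[(0,3,1),(1,4,0)]),
([[Rel 0 2,Rel 1 2],[New,Rel 1 1],[Rel 2 0,Rel 1 0],[Rel 0 2,Claw True 0],[Rel 0 2,Rel 1 1],[Rel 0 2,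
Rel 1 1]],[(0,3,1)]),
([[Rel 1 2],[Rel 1 0],[Rel 2 1],[New],[Rel 1 0],[Rel 1 0]],[(0,2,0)]),
([[Rel 3 0],[Rel 3 0],[Rel 3 1],[Rel 3 0],[New],[Rel 3 0]],[(0,1,0)]),
([[Rel 4 0],[Rel 4 0],[Rel 4 0],[Rel 4 0],[Rel 4 0],[New]],[(0,0,0)]),
([[Rel 5 0],[Rel 5 0],[Rel 5 0],[Rel 5 0],[Rel 5 0],[Rel 5 0]],[])]"

definition cert7 :: "certificate" where
"cert7 =
[([[Kill],[Kill],[Kill],[Kill],[Kill],[Kill],[New]],[(0,6,0)]),
([[Rel 6 0],[Rel 6 0],[Rel 6 0],[Rel 6 0],[Rel 6 0],[New],[Rel 6 0]],[(0,5,0)]),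
([[Rel 5 0],[Rel 5 0],[Rel 5 0],[Rel 5 0],[New],[Rel 5 0],[Rel 5 0]],[(0,4,0)]),
([[Rel 4 0],[Rel 4 0],[Rel 4 0],[New],[Rel 4 0],[Rel 4 0],[Rel 4 0]],[(0,2,0)]),
([[Rel 3 0],[New],[New],[Rel 3 0],[Rel 3 0],[Rel 3 0],[Rel 3 0]],[(0,1,0),(1,3,0)]),
([[New,Rel 2 0],[Rel 1 0,New],[New,Rel 2 0],[Rel 1 0,Rel 2 0],[Rel 1 0,Rel 2 0],[Rel 1 0,Rel 2 0],[Rel 1 0,
Rel 2 0]],[(0,0,0),(1,3,0),(2,1,1)]),
([[Rel 0 0,New,New],[Rel 0 0,Rel 1 1,New],[Rel 0 0,Rel 1 0,Rel 2 0],[Rel 0 0,Claw True 0,Claw False 0],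
[Rel 0 0,Rel 1 1,Rel 2 0],[Rel 0 0,Rel 1 1,Rel 2 0],[Rel 0 0,Rel 1 1,Rel 2 0]],[(0,3,0),(1,0,2),(2,1,1)]),
([[Rel 0 1,Rel 0 2,New],[Rel 0 1,New,Rel 1 2],[Rel 0 1,Rel 2 0,Rel 2 1],[Rel 0 1,Rel 0 2,New],[Rel 0 1,
Rel 0 2,Rel 1 2],[Rel 0 1,Rel 0 2,Rel 1 2],[Rel 0 1,Rel 0 2,Rel 1 2]],[(0,1,0),(1,0,2),(2,2,2)]),
([[Rel 0 2,New,New],[Rel 0 2,Rel 1 1,Rel 3 2],[Rel 2 0,Rel 1 0,Rel 3 1],[Rel 0 2,New,Rel 3 2],[Rel 0 2,
Rel 1 1,New],[Rel 0 2,Rel 1 1,Rel 3 2],[Rel 0 2,Rel 1 1,Rel 3 2]],[(0,0,0),(1,2,0),(2,0,2),(3,4,2)]),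
([[Rel 0 1,Rel 0 2,New,New],[Rel 1 0,New,Rel 3 1,Rel 4 2],[Rel 0 1,Rel 0 2,Claw True 0,Rel 4 2],[Rel 0 1,
Rel 3 0,Rel 3 1,Rel 4 2],[Rel 0 1,Rel 0 2,New,Rel 4 2],[Rel 0 1,Rel 0 2,Rel 3 1,New],[Rel 0 1,Rel 0 2,Rel 3 1,
Rel 4 2]],[(0,0,1),(1,4,1),(2,2,0),(3,0,3),(4,5,3)]),
([[Rel 0 2,Rel 0 3,Rel 1 2,New,New],[New,New,Rel 1 1,Rel 4 2,Rel 5 3],[Rel 0 2,Rel 0 3,Claw False 0,Rel 4 2,
Rel 5 3],[Rel 3 0,Rel 0 3,Rel 1 0,Rel 4 1,Rel 5 3],[Rel 0 2,Rel 4 1,Rel 1 1,Rel 4 2,Rel 5 2],[Rel 0 2,Rel 0 3,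
Rel 1 1,New,Rel 5 3],[Rel 0 2,Rel 0 3,Rel 1 1,Rel 4 2,New]],[(0,0,1),(1,5,1),(2,0,2),(3,4,2),(4,0,4),(5,6,
4)]),
([[Rel 0 3,Rel 0 4,Rel 1 2,Rel 1 3,New,New],[New,New,Rel 1 0,Rel 1 1,Rel 5 3,Rel 6 4],[Rel 0 3,Rel 0 4,New,
Rel 4 2,Rel 5 3,Rel 6 4],[Rel 0 3,Rel 0 4,Rel 3 2,New,Rel 5 3,Rel 6 4],[Rel 4 0,Rel 0 4,Rel 1 0,Rel 4 2,
Rel 5 2,Rel 6 4],[Rel 0 3,Rel 5 1,Rel 1 0,Rel 1 1,Rel 5 3,Rel 6 3],[Rel 0 3,Rel 0 4,Rel 1 0,Rel 1 1,New,
Rel 6 4]],[(0,0,1),(1,6,1),(2,0,3),(3,5,3),(4,1,2),(5,4,2),(6,0,5)]),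
([[Rel 0 4,Rel 0 5,Rel 1 3,Rel 1 4,Rel 2 2,Rel 3 3,New],[New,New,Rel 1 0,Rel 1 1,Rel 2 0,Rel 3 1,Rel 6 4],
[Rel 0 4,Rel 0 5,New,Rel 5 3,Rel 2 2,New,Rel 6 4],[Rel 0 4,Rel 0 5,New,New,Rel 2 2,Rel 3 3,Rel 6 4],[Rel 0 4,
Rel 0 5,Rel 4 2,Rel 1 1,Rel 2 2,Rel 3 2,Rel 6 4],[Rel 5 0,Rel 0 5,Rel 1 0,Rel 5 3,Rel 2 2,Rel 3 3,Rel 6 3],
[Rel 0 4,Rel 6 1,Rel 1 0,Rel 1 1,Rel 2 2,Rel 3 3,Rel 6 4]],[(0,0,1),(1,0,3),(2,6,3),(3,1,2),(4,4,4),(5,0,5),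
(6,5,5)]),
([[Rel 0 6,Rel 1 4,Rel 1 5,Rel 2 2,Rel 2 5,Rel 3 2,Rel 3 3],[New,Rel 1 0,Rel 1 1,Rel 2 0,Claw True 1,Rel 3 0,
Rel 3 1],[Rel 0 6,New,Rel 6 3,Rel 2 2,Rel 2 5,New,New],[Rel 0 6,New,New,New,Rel 2 3,Rel 3 2,Rel 3 3],[Rel 0 6,
Rel 1 0,Rel 1 1,Rel 4 4,Rel 2 5,Rel 4 5,New],[Rel 0 6,Rel 5 2,Rel 1 1,Rel 2 2,Rel 2 5,Rel 3 2,Rel 5 5],
[Rel 6 0,Rel 1 0,Rel 6 3,Rel 2 2,Rel 2 5,Rel 3 2,Rel 3 3]],[(0,0,2),(1,1,1),(2,0,4),(3,5,4),(4,0,6),(5,6,6),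
(6,1,5),(7,5,5)]),
([[Rel 1 6,Rel 2 1,Rel 2 5,Rel 2 6,Rel 3 1,Rel 3 2,Rel 3 3,Rel 4 6],[Rel 1 0,Rel 2 0,Rel 4 4,Rel 5 4,Rel 3 0,
Rel 3 1,Claw False 0,Rel 4 6],[New,Rel 2 1,Rel 2 5,Rel 2 6,New,New,New,New],[New,New,Rel 2 2,Rel 2 3,Rel 3 1,
Rel 3 2,Rel 3 3,Rel 4 3],[Rel 1 0,Rel 2 1,Rel 4 4,Rel 2 6,New,New,Rel 3 4,Rel 4 6],[Rel 1 0,Rel 5 3,Rel 2 5,
Rel 5 4,Rel 5 5,Rel 3 2,Rel 3 3,Rel 4 5],[Rel 6 1,Rel 2 1,Rel 2 5,Rel 2 6,Rel 3 1,Rel 6 6,Rel 3 3,Rel 4 6]],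
[(0,1,0),(1,0,3),(2,6,3),(3,1,2),(4,5,2),(5,0,5),(6,1,4),(7,0,7),(8,6,7)]),
([[Rel 2 0,Rel 2 4,Rel 2 5,Rel 2 6,Rel 2 7,Rel 3 0,Rel 3 1,Rel 4 4,Rel 4 5],[Rel 2 0,Rel 5 2,Rel 6 3,New,
Rel 4 3,Rel 3 0,Rel 5 6,Rel 4 4,Rel 4 5],[Rel 2 0,Rel 2 4,Rel 2 5,Rel 2 6,Rel 2 7,New,New,New,New],[New,
Rel 2 1,Rel 2 2,Rel 3 2,New,Rel 3 0,Rel 3 1,Rel 4 1,Rel 4 2],[Rel 2 0,Rel 2 4,Rel 2 5,Rel 2 6,Rel 4 3,New,New,
Rel 4 4,Rel 4 5],[Rel 2 0,Rel 5 2,Rel 2 5,Rel 2 6,Rel 2 7,Rel 3 0,Rel 5 6,Rel 5 7,New],[Rel 6 1,Rel 2 4,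
Rel 6 3,Rel 2 6,Rel 2 7,Rel 6 4,Rel 3 1,Rel 4 4,Rel 6 7]],[(0,2,3),(1,0,2),(2,1,1),(3,0,4),(4,6,4),(5,1,5),(6,
5,3),(7,0,8),(8,1,7),(9,6,7)]),
([[New,Rel 2 5,Rel 2 6,Rel 2 7,Rel 2 8,Rel 3 0,Rel 3 4,Rel 4 5,Rel 4 6,Rel 5 8],[Rel 1 3,Rel 6 1,New,Rel 4 1,
Rel 4 2,Rel 6 6,New,Rel 4 5,Rel 4 6,Rel 5 8],[Rel 1 6,Rel 2 5,Rel 2 6,Rel 2 7,Rel 2 8,New,Rel 3 7,New,New,
New],[Rel 1 2,Rel 2 0,Rel 3 1,New,New,Rel 3 0,Rel 3 4,Rel 4 0,Rel 4 1,Rel 5 8],[Rel 1 3,Rel 2 5,Rel 2 6,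
Rel 4 1,Rel 4 2,New,Rel 3 3,Rel 4 5,Rel 4 6,Rel 5 5],[Rel 1 3,Rel 2 5,Rel 5 3,Rel 5 4,Rel 2 8,Rel 3 0,Rel 3 4,
New,Rel 4 6,Rel 5 8],[Rel 1 3,Rel 6 1,Rel 2 6,Rel 2 7,Rel 6 4,Rel 6 6,Rel 3 4,Rel 6 7,Rel 4 6,Rel 5 7]],[(0,3,
0),(1,2,2),(2,5,0),(3,1,1),(4,0,4),(5,1,3),(6,6,3),(7,0,6),(8,6,6),(9,1,7),(10,0,9)]),
([[Rel 0 0,New,New,Rel 2 5,Rel 2 7,Rel 2 8,Rel 2 9,Rel 3 3,Rel 3 4,Rel 4 5,Rel 5 7],[Rel 0 3,Rel 1 2,Rel 1 6,
New,Rel 4 1,New,Rel 5 4,New,New,Rel 4 5,Rel 5 7],[Rel 0 0,Rel 1 6,Claw False 7,Rel 2 5,Rel 2 7,Rel 2 8,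
Rel 2 9,Rel 3 7,Rel 3 8,New,New],[Rel 0 0,Rel 1 1,Rel 1 4,Rel 3 1,New,New,New,Rel 3 3,Rel 3 4,Rel 4 0,
Rel 5 7],[Rel 0 0,Rel 1 2,Rel 1 6,Rel 2 5,Rel 4 1,Rel 4 2,Rel 2 9,Rel 3 1,Rel 3 2,Rel 4 5,Rel 5 5],[Rel 0 0,
Rel 5 0,Rel 1 6,Rel 2 5,Rel 2 7,Rel 2 8,Rel 5 4,Rel 5 6,Rel 3 4,New,Rel 5 7],[Rel 0 0,Rel 1 2,Rel 1 6,Rel 6 2,
Rel 6 3,Rel 2 8,Rel 2 9,Rel 3 3,Rel 6 6,Rel 6 8,Rel 6 9]],[(0,3,1),(1,5,0),(2,2,3),(3,2,5),(4,0,2),(5,6,2),(6,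
1,4),(7,0,6),(8,0,8),(9,1,7),(10,6,7),(11,1,10)]),
([[Rel 0 1,Rel 0 2,New,New,New,New,Rel 2 9,Rel 2 10,Rel 3 4,Rel 3 5,Rel 3 6,Rel 5 9],[Rel 0 2,Rel 0 6,Rel 1 3,
Rel 1 5,Rel 1 7,Rel 1 8,New,Rel 5 4,New,New,New,Rel 5 9],[Rel 0 1,Rel 0 2,Rel 1 5,Rel 1 8,Rel 5 2,Rel 6 2,
Rel 2 9,Rel 2 10,Rel 3 7,Rel 3 8,Rel 3 9,New],[Rel 0 1,Rel 0 2,Rel 1 1,New,Rel 1 3,Rel 1 4,New,New,Rel 3 4,
Rel 3 5,Rel 3 6,Rel 5 9],[Rel 0 1,Rel 0 2,Rel 1 3,Rel 4 1,Rel 1 7,Rel 1 8,Rel 4 3,Rel 2 10,Rel 3 1,Rel 4 7,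
New,Rel 5 5],[Rel 5 0,Rel 0 2,Rel 1 3,Rel 1 5,Rel 5 2,Rel 1 8,Rel 2 9,Rel 5 4,Rel 3 4,Rel 3 5,Rel 5 8,
Rel 5 9],[Rel 0 1,Rel 0 2,Rel 6 1,Rel 1 5,Rel 1 7,Rel 6 2,Rel 6 5,Rel 6 6,Rel 6 7,Rel 3 5,Rel 3 6,Rel 5 8]],
[(0,3,2),(1,3,3),(2,0,1),(3,6,1),(4,2,6),(5,0,5),(6,1,4),(7,6,4),(8,1,7),(9,2,9),(10,1,8),(11,0,10),(12,6,
9)]),
([[Rel 0 2,Rel 0 3,Rel 0 4,Rel 0 5,New,New,New,New,Rel 2 11,New,Rel 3 6,Rel 3 7,Rel 4 10],[Rel 0 3,Rel 0 5,
Rel 0 7,Rel 0 8,Rel 1 6,Rel 1 8,Rel 1 9,Rel 1 10,New,New,New,New,New],[Rel 0 2,Rel 0 3,Rel 0 4,Rel 0 5,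
Rel 1 9,Rel 6 4,Rel 4 4,Rel 5 5,Rel 2 11,Claw True 8,Rel 3 9,Rel 3 10,Rel 4 10],[Rel 0 2,Rel 0 3,Rel 0 4,
Rel 0 5,New,Rel 1 4,Rel 1 5,Rel 1 6,New,Rel 3 3,Rel 3 6,Rel 3 7,Rel 4 6],[Rel 0 2,Rel 4 0,Rel 0 4,Rel 0 5,
Rel 4 2,Rel 1 8,Rel 4 4,Rel 1 10,Rel 2 11,Rel 3 1,Rel 4 8,New,Rel 4 10],[Rel 0 2,Rel 0 3,Rel 5 1,Rel 0 5,
Rel 1 6,Rel 1 8,Rel 1 9,Rel 5 5,Rel 5 6,Rel 3 3,Rel 3 6,Rel 5 8,Rel 4 8],[Rel 6 0,Rel 0 3,Rel 0 4,Rel 6 1,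
Rel 6 3,Rel 6 4,Rel 1 9,Rel 1 10,Rel 2 11,Rel 3 3,Rel 6 9,Rel 6 10,Rel 4 10]],[(0,3,4),(1,0,3),(2,1,2),(3,6,
2),(4,3,9),(5,2,8),(6,2,6),(7,1,5),(8,0,7),(9,6,6),(10,2,10),(11,1,11),(12,0,12)]),
([[Rel 0 4,Rel 0 5,Rel 0 6,Rel 0 7,Rel 0 9,New,New,New,New,New,New,Rel 3 8,Rel 4 11],[Rel 0 6,Rel 0 8,Rel 0 9,
Rel 0 10,New,Rel 1 8,Rel 1 9,Rel 1 10,Rel 1 11,Rel 1 12,New,New,New],[Rel 0 4,Rel 0 5,Rel 0 6,Rel 0 7,Rel 0 9,
Rel 1 11,New,Rel 4 5,Rel 5 5,Rel 4 7,Rel 6 9,Rel 3 11,Rel 4 11],[Rel 0 4,Rel 0 5,Rel 0 6,Rel 0 7,Rel 3 1,New,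
Rel 3 6,Rel 1 6,Rel 1 7,New,Rel 3 4,Rel 3 8,Rel 4 7],[Rel 4 0,Rel 0 5,Rel 4 2,Rel 0 7,Rel 0 9,Rel 1 8,Rel 1 9,
Rel 4 5,Rel 1 11,Rel 4 7,Rel 3 2,New,Rel 4 11],[Rel 0 4,Rel 0 5,Rel 0 6,Rel 5 3,Rel 0 9,Rel 5 4,Rel 1 9,
Rel 1 10,Rel 5 5,Rel 1 12,Rel 3 4,Rel 5 10,Rel 4 8],[Rel 6 1,Rel 6 2,Rel 0 6,Rel 0 7,Rel 0 9,Rel 1 8,Rel 1 9,
Rel 6 6,Rel 6 7,Rel 1 12,Rel 6 9,Rel 3 8,Rel 6 12]],[(0,3,5),(1,2,2),(2,1,1),(3,0,3),(4,6,2),(5,3,10),(6,3,6),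
(7,2,7),(8,1,8),(9,0,9),(10,4,6),(11,2,11),(12,6,6),(13,1,12)]),
([[Rel 0 5,Rel 0 6,Rel 0 7,Rel 0 8,Rel 0 9,Rel 0 10,New,New,New,New,New,New,New,Rel 4 11],[Rel 0 8,Rel 0 9,
Rel 0 10,Rel 0 11,Rel 0 12,New,Rel 1 4,Rel 1 10,Rel 1 11,Rel 1 12,Rel 2 9,New,Rel 3 12,New],[Rel 0 5,Rel 0 6,
Rel 0 7,Rel 0 8,Rel 0 9,Rel 0 10,New,New,Rel 5 7,Rel 4 8,Rel 2 6,Rel 5 10,New,Rel 4 11],[Rel 0 5,Rel 3 2,
Rel 0 7,Rel 0 8,Rel 0 9,Rel 3 0,Rel 1 1,Rel 3 7,Rel 1 8,New,Rel 2 6,Rel 3 5,Rel 3 9,Rel 4 8],[Rel 0 5,Rel 0 6,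
Rel 4 1,Rel 0 8,Rel 4 3,Rel 0 10,Rel 1 4,Rel 1 10,Rel 1 11,Rel 4 8,Rel 2 6,New,Rel 3 7,Rel 4 11],[Rel 5 0,
Rel 0 6,Rel 0 7,Rel 5 1,Rel 0 9,Rel 0 10,Rel 1 4,Rel 1 10,Rel 5 7,Rel 1 12,Rel 2 6,Rel 5 10,Rel 3 9,Rel 5 12],
[Rel 0 5,Rel 0 6,Rel 6 2,Rel 6 3,Rel 0 9,Rel 6 4,Rel 1 4,Rel 6 6,Rel 1 11,Rel 6 9,Rel 2 6,Rel 3 5,Rel 3 9,
Rel 4 11]],[(0,3,1),(1,2,2),(2,1,3),(3,0,4),(4,4,1),(5,3,11),(6,6,1),(7,3,7),(8,2,8),(9,1,9),(10,3,10),(11,4,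
7),(12,6,10),(13,0,12),(14,2,13)]),
([[Rel 0 6,Rel 0 7,Rel 0 8,Rel 0 9,Rel 0 10,Rel 0 11,Rel 0 12,New,New,New,New,New,New,New,New],[Rel 1 1,
Rel 0 10,Rel 0 11,Rel 0 12,New,New,New,Rel 1 5,Rel 1 11,Rel 1 13,Rel 2 4,Rel 2 10,Claw True 12,Rel 3 12,New],
[Rel 0 6,Rel 0 7,Rel 0 8,Rel 0 9,Rel 2 1,Rel 0 11,Rel 0 12,New,New,Rel 4 8,Rel 2 6,Rel 2 7,Rel 2 12,New,
Rel 4 11],[Rel 0 6,Rel 3 2,Rel 0 8,Rel 0 9,Rel 0 10,Rel 3 0,Rel 3 4,Rel 1 0,Rel 3 8,New,Claw False 1,Rel 2 7,
Rel 2 9,Rel 3 9,Rel 4 5],[Rel 0 6,Rel 0 7,Rel 0 8,Rel 4 3,Rel 0 10,Rel 0 11,Rel 0 12,Rel 1 5,Rel 1 11,Rel 4 8,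
Rel 2 6,Rel 2 7,Rel 2 12,Rel 3 8,Rel 4 11],[Rel 0 6,Rel 0 7,Rel 5 2,Rel 0 9,Rel 0 10,Rel 5 5,Rel 0 12,Rel 1 5,
Rel 5 7,Rel 5 9,Rel 2 6,Rel 2 7,Rel 2 12,Rel 3 9,Rel 4 10],[Rel 0 6,Rel 6 1,Rel 0 8,Rel 6 4,Rel 0 10,Rel 0 11,
Rel 0 12,Rel 6 6,Rel 1 11,Rel 1 13,Rel 2 6,Rel 6 10,Rel 2 12,Rel 6 12,Rel 4 11]],[(0,3,1),(1,2,2),(2,1,3),(3,
3,4),(4,4,1),(5,6,4),(6,0,6),(7,3,14),(8,4,0),(9,3,8),(10,6,0),(11,2,9),(12,3,11),(13,4,8),(14,0,12),(15,1,
13)]),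
([[Rel 0 7,Rel 0 8,Rel 0 9,Rel 0 10,Rel 0 11,Rel 0 12,Rel 0 13,Rel 0 14,Rel 1 10,New,Rel 1 12,New,New,New,New,
New],[Rel 1 1,Rel 0 11,Rel 0 13,New,New,New,New,New,Rel 1 4,Rel 1 5,Rel 1 6,Rel 1 14,Rel 2 5,Rel 2 11,
Rel 6 12,Rel 3 13],[Rel 0 7,Rel 0 8,Rel 0 9,Rel 2 0,Rel 2 1,Rel 2 6,Rel 0 13,Rel 0 14,Rel 1 1,New,New,New,
Rel 2 7,Rel 2 8,Rel 2 13,New],[Rel 0 7,Rel 3 2,Rel 0 9,Rel 0 10,Rel 0 11,Rel 0 12,Rel 3 3,Rel 0 14,
Claw True 2,Rel 1 0,Rel 1 4,New,Rel 6 10,Rel 2 8,Rel 2 9,Rel 3 9],[Rel 0 7,Rel 0 8,Rel 4 2,Rel 0 10,Rel 0 11,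
Rel 0 12,Rel 0 13,Rel 4 5,Rel 1 4,Rel 1 5,Rel 1 6,Rel 4 8,Rel 2 7,Rel 2 8,Rel 2 13,Rel 3 8],[Rel 0 7,Rel 5 1,
Rel 5 3,Rel 0 10,Rel 0 11,Rel 0 12,Rel 0 13,Rel 0 14,Rel 1 4,Rel 5 7,Rel 1 6,Rel 1 14,Rel 2 7,Rel 5 11,
Rel 2 13,Rel 5 13],[Rel 6 0,Rel 0 8,Rel 0 9,Rel 0 10,Rel 6 4,Rel 0 12,Rel 6 6,Rel 0 14,Rel 1 4,Rel 1 5,
Rel 1 6,Rel 1 14,Rel 6 10,Rel 2 8,Rel 6 12,Rel 3 9]],[(0,3,1),(1,2,2),(2,3,4),(3,4,1),(4,0,5),(5,1,6),(6,3,8),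
(7,4,0),(8,6,8),(9,0,10),(10,3,11),(11,3,13),(12,6,3),(13,4,11),(14,1,14),(15,2,15)]),
([[Rel 0 9,Rel 0 11,Rel 0 12,Rel 0 13,Rel 0 14,Rel 0 15,Rel 1 10,Rel 1 11,Rel 1 12,Rel 1 13,New,New,Rel 2 10,
New,New,New],[Rel 1 1,Rel 0 14,New,New,New,New,Rel 1 3,Rel 1 4,Rel 1 5,Rel 1 6,Rel 1 7,Rel 2 5,New,Rel 2 14,
Rel 5 14,Rel 3 14],[Rel 0 9,Rel 0 11,Rel 2 0,Rel 2 1,Rel 2 6,Rel 0 15,Rel 2 8,Rel 1 1,Rel 1 6,New,New,Rel 2 9,
Rel 2 10,Rel 2 11,Rel 2 15,New],[Rel 0 9,Rel 0 11,Rel 0 12,Rel 0 13,Rel 0 14,Rel 3 2,New,Rel 6 8,Claw True 4,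
Rel 1 3,New,Rel 5 12,Claw False 4,New,Rel 2 9,Rel 3 11],[Rel 0 9,Rel 4 1,Rel 0 12,Rel 0 13,Rel 0 14,Rel 0 15,
Rel 1 3,Rel 1 4,Rel 1 5,Rel 1 6,Rel 4 9,Rel 2 9,Rel 2 10,Rel 4 13,Rel 2 15,Rel 4 15],[Rel 5 0,Rel 0 11,
Rel 0 12,Rel 5 4,Rel 0 14,Rel 5 6,Rel 1 3,Rel 1 4,Rel 1 5,Rel 1 6,Rel 1 7,Rel 5 12,Rel 2 10,Rel 2 11,Rel 5 14,
Rel 3 11],[Rel 0 9,Rel 0 11,Rel 6 3,Rel 0 13,Rel 6 5,Rel 0 15,Rel 1 3,Rel 6 8,Rel 1 5,Rel 6 10,Rel 1 7,
Rel 2 9,Rel 2 10,Rel 2 11,Rel 2 15,Rel 3 11]],[(0,3,1),(1,3,3),(2,4,1),(3,1,4),(4,2,5),(5,3,7),(6,4,0),(7,0,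
8),(8,1,9),(9,6,6),(10,0,12),(11,3,13),(12,2,14),(13,2,6),(14,3,15),(15,4,15)]),
([[Rel 0 10,Rel 0 11,Rel 0 13,Rel 0 14,Rel 0 15,Rel 1 12,Rel 1 13,Rel 1 14,Rel 1 15,Rel 2 8,Rel 2 9,New,New,
Rel 3 6,New,New],[Rel 1 1,New,New,New,New,Rel 1 2,Rel 1 3,Rel 1 4,Rel 1 5,Rel 1 12,New,Rel 2 7,Rel 4 14,
Rel 3 3,Rel 3 7,Claw False 14],[Rel 0 10,Rel 2 0,Rel 2 1,Rel 2 5,Rel 0 15,Rel 2 7,Rel 1 1,Rel 1 6,New,Rel 2 8,
Rel 2 9,Rel 2 10,Rel 2 15,Rel 3 8,New,New],[Rel 0 10,Rel 0 11,Rel 0 13,Rel 0 14,Rel 3 1,New,Rel 5 7,Rel 6 8,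
Rel 1 2,New,Rel 6 12,New,Rel 2 11,Rel 3 6,Rel 3 10,Rel 3 13],[Rel 4 0,Rel 0 11,Rel 4 3,Rel 0 14,Rel 4 5,
Rel 1 2,Rel 1 3,Rel 1 4,Rel 1 5,Rel 1 12,Rel 2 9,Rel 4 11,Rel 4 14,New,Rel 3 9,Rel 3 13],[Rel 0 10,Rel 5 2,
Rel 0 13,Rel 5 4,Rel 0 15,Rel 1 2,Rel 5 7,Rel 1 4,Rel 5 9,Rel 1 12,Rel 2 9,Rel 2 10,Rel 2 15,Rel 3 6,Rel 3 10,
Rel 3 13],[Rel 0 10,Rel 0 11,Rel 0 13,Rel 0 14,Rel 0 15,Rel 6 6,Rel 1 3,Rel 6 8,Rel 1 5,Rel 1 12,Rel 6 12,
Rel 2 10,Rel 2 15,Rel 3 6,Rel 3 10,Rel 3 13]],[(0,3,2),(1,2,3),(2,3,4),(3,4,4),(4,3,6),(5,4,0),(6,1,7),(7,2,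
8),(8,0,9),(9,1,10),(10,3,12),(11,4,12),(12,2,5),(13,6,13),(14,3,15),(15,1,13)]),
([[Rel 0 11,Rel 0 12,Rel 0 14,Rel 0 15,Rel 1 11,Rel 1 13,Rel 1 14,Rel 1 15,Rel 2 7,Rel 2 8,New,New,Rel 3 5,
Rel 3 9,New,Rel 4 13],[New,New,New,New,Rel 1 1,Rel 1 2,Rel 1 3,Rel 1 4,Rel 1 10,New,Claw True 7,New,Rel 3 2,
Rel 3 12,Claw False 7,Rel 4 13],[Rel 2 0,Rel 2 4,Rel 0 14,Rel 0 15,Rel 2 6,Rel 1 1,Rel 1 5,New,Rel 2 7,
Rel 2 8,Rel 2 14,Rel 2 15,Rel 3 7,Rel 3 8,New,Rel 4 13],[Rel 0 11,Rel 0 12,Rel 3 0,Rel 3 2,New,New,Rel 5 7,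
Rel 1 1,New,Rel 5 10,Rel 2 10,Rel 3 12,Rel 3 5,Rel 3 9,Rel 3 11,Rel 4 6],[Rel 4 1,Rel 4 3,Rel 0 14,Rel 0 15,
Rel 1 1,Rel 4 6,Rel 1 3,Rel 4 8,Rel 1 10,Rel 2 8,Rel 2 14,Rel 2 15,New,New,Rel 3 11,Rel 4 13],[Rel 0 11,
Rel 0 12,Rel 0 14,Rel 0 15,Rel 5 5,Rel 1 2,Rel 5 7,Rel 1 4,Rel 1 10,Rel 5 10,Rel 2 14,Rel 2 15,Rel 3 5,
Rel 3 9,Rel 3 11,New],[Rel 0 11,Rel 0 12,Rel 0 14,Rel 0 15,Rel 1 1,Rel 1 2,Rel 1 3,Rel 1 4,Rel 6 9,Rel 2 8,
Rel 2 14,Rel 2 15,Rel 6 13,Rel 3 9,Rel 3 11,Rel 4 13]],[(0,3,1),(1,4,1),(2,3,3),(3,3,5),(4,2,6),(5,3,7),(6,4,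
7),(7,1,8),(8,5,11),(9,2,9),(10,3,11),(11,2,4),(12,4,2),(13,0,13),(14,1,12),(15,6,15),(16,0,15)]),
([[Rel 0 10,Rel 0 11,Rel 0 14,Rel 1 11,Rel 1 12,Rel 1 14,Rel 1 15,Rel 2 6,New,Rel 2 7,New,Rel 3 4,Rel 3 5,
Rel 3 8,Rel 4 12,Rel 4 13,Rel 5 15],[New,New,New,Rel 1 0,Rel 1 1,Rel 1 2,Rel 1 3,Rel 1 9,Rel 1 11,New,New,
Rel 3 1,New,Rel 3 10,Rel 4 12,Rel 4 13,Rel 5 15],[Rel 2 2,Rel 2 3,Rel 0 14,Rel 2 5,Rel 1 4,New,New,Rel 2 6,
Rel 1 15,Rel 2 7,Rel 2 14,Rel 3 6,New,Rel 3 7,Rel 4 12,Rel 4 13,Rel 5 15],[Rel 0 10,Rel 3 1,Rel 3 0,New,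
Claw True 1,Rel 3 7,Rel 1 2,New,Rel 1 12,Claw False 1,Rel 3 10,Rel 3 4,Rel 3 5,Rel 3 8,Rel 4 5,Rel 4 9,
Rel 5 15],[Rel 0 10,Rel 0 11,Rel 0 14,Rel 4 4,Rel 4 6,Rel 1 2,Rel 1 3,Rel 1 9,Rel 1 11,Rel 4 9,Rel 2 14,New,
Rel 3 6,New,Rel 4 12,Rel 4 13,Rel 5 13],[Rel 0 10,Rel 0 11,Rel 0 14,Rel 1 0,Rel 1 1,Rel 1 2,Rel 1 3,Rel 5 8,
Rel 1 11,Rel 2 7,Rel 2 14,Rel 5 12,Rel 3 5,Rel 3 8,New,New,Rel 5 15],[Rel 0 10,Rel 0 11,Rel 0 14,Rel 1 0,
Rel 1 1,Rel 1 2,Rel 1 3,Rel 1 9,Rel 1 11,Rel 2 7,Rel 2 14,Rel 3 4,Rel 3 5,Rel 6 13,Rel 6 15,Rel 4 13,New]],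
[(0,5,1),(1,5,10),(2,3,4),(3,3,1),(4,6,2),(5,2,7),(6,3,8),(8,3,9),(7,4,5),(9,3,6),(10,4,0),(11,3,12),(12,1,
13),(13,2,3),(14,0,15),(15,1,11),(17,0,14),(16,6,16)]),
([[Rel 0 8,Rel 0 10,Rel 1 10,New,Rel 1 14,Rel 2 4,New,Rel 3 6,Rel 2 5,Rel 2 6,Rel 2 12,Rel 3 3,Rel 3 7,
Rel 4 11,Rel 4 13,Rel 5 14,Rel 5 15,Rel 6 16],[Rel 0 11,New,Rel 1 0,Rel 1 1,Rel 1 2,Rel 1 9,Rel 1 10,Rel 1 12,
New,New,New,New,Rel 3 9,Rel 4 11,Rel 4 13,Rel 5 14,Rel 5 15,Rel 6 16],[Rel 0 8,Rel 2 2,Rel 1 2,Rel 1 3,New,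
Rel 2 4,Rel 1 14,New,Rel 2 5,Rel 2 6,Rel 2 12,New,Rel 3 6,Rel 4 11,Rel 4 13,Rel 5 14,Rel 5 15,Rel 6 16],
[Rel 0 8,Rel 3 0,Claw True 0,Rel 1 1,Rel 1 0,New,Rel 1 10,Rel 3 6,Rel 2 7,Rel 3 9,Rel 3 4,Rel 3 3,Rel 3 7,New,
Rel 4 8,Rel 5 14,Rel 5 15,Rel 6 16],[Rel 0 8,Rel 0 10,Rel 1 0,Rel 1 1,Rel 1 2,Rel 4 7,Rel 1 10,Rel 1 12,
Rel 2 5,Rel 2 6,Rel 2 12,Rel 3 4,New,Rel 4 11,Rel 4 13,New,Rel 5 13,Rel 6 16],[Rel 0 8,Rel 0 10,Rel 1 0,
Rel 1 1,Rel 1 2,Rel 1 9,Rel 1 10,Rel 1 12,Rel 2 5,Rel 2 6,Rel 2 12,Rel 3 3,Rel 5 13,Rel 4 12,New,Rel 5 14,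
Rel 5 15,New],[Rel 0 8,Rel 0 10,Rel 1 0,Rel 1 1,Rel 1 2,Rel 1 9,Rel 1 10,Rel 1 12,Rel 2 5,Rel 2 6,Rel 2 12,
Rel 3 3,Rel 3 7,Rel 4 11,Rel 6 15,Rel 5 15,New,Rel 6 16]],[(0,5,3),(1,3,0),(2,3,3),(3,3,5),(4,4,5),(5,4,2),(6,
3,7),(7,3,9),(8,4,8),(9,3,10),(10,2,12),(11,2,11),(12,1,14),(13,1,13),(14,0,16),(15,0,15),(16,6,17)]),
([[Rel 0 3,Rel 0 6,New,Rel 2 2,New,New,Rel 3 4,Rel 2 4,Rel 2 7,Rel 2 11,Rel 3 5,Rel 3 13,Rel 4 12,Rel 4 15,
Rel 5 14,Rel 5 17,Rel 6 16],[Rel 1 0,Rel 0 10,Rel 1 1,Rel 1 8,Rel 1 9,Rel 1 10,Rel 1 11,New,New,New,New,New,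
Rel 4 12,Rel 4 15,Rel 5 14,Rel 5 17,Rel 6 16],[Rel 0 3,Rel 0 6,Rel 1 2,Rel 2 2,Rel 2 3,Rel 1 12,New,Rel 2 4,
Rel 2 7,Rel 2 11,New,New,Rel 4 12,Rel 4 15,Rel 5 14,Rel 5 17,Rel 6 16],[Rel 0 3,Rel 0 6,Rel 1 0,Rel 2 4,
Rel 1 9,Rel 3 3,Rel 3 4,Rel 3 8,Rel 2 6,Rel 3 2,Rel 3 5,Rel 3 13,New,New,Rel 5 14,Rel 5 17,Rel 6 16],[Rel 0 3,
Rel 0 6,Rel 1 1,Rel 1 8,Rel 1 9,Rel 1 10,Rel 1 11,Rel 2 4,Rel 2 7,Rel 2 11,Rel 3 7,Rel 4 11,Rel 4 12,Rel 4 15,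
New,New,Rel 6 16],[Rel 0 3,Rel 0 6,Rel 1 1,Rel 1 8,Rel 1 9,Rel 1 10,Rel 1 11,Rel 2 4,Rel 2 7,Rel 2 11,Rel 3 5,
Rel 3 13,Rel 4 13,Rel 5 13,Rel 5 14,Rel 5 17,New],[Rel 0 3,Rel 0 6,Rel 1 1,Rel 1 8,Rel 1 9,Rel 1 10,Rel 1 11,
Rel 2 4,Rel 2 7,Rel 2 11,Rel 3 5,Rel 3 13,Rel 4 12,Rel 4 15,Rel 5 15,Rel 6 15,Rel 6 16]],[(0,3,0),(1,5,4),(2,
5,5),(3,3,4),(4,4,3),(5,3,5),(6,4,10),(7,2,6),(8,3,8),(9,3,10),(10,2,9),(11,2,12),(12,1,11),(13,1,14),(14,0,
13),(15,0,16)]),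
([[Rel 0 2,Rel 0 4,Rel 0 5,New,New,New,New,Rel 4 6,Rel 2 6,Rel 2 10,Rel 2 11,Rel 3 12,Rel 3 13,Rel 4 14,
Rel 4 15,Rel 5 16],[Rel 1 1,Rel 0 9,Rel 0 10,Rel 1 7,Rel 1 8,Rel 1 9,Rel 1 10,Rel 1 11,New,New,New,New,New,
Rel 4 14,Rel 4 15,Rel 5 16],[Rel 0 2,Rel 2 0,Rel 0 5,Rel 2 2,Rel 2 5,Rel 1 11,New,New,Rel 2 6,Rel 2 10,
Rel 2 11,New,New,Rel 4 14,Rel 4 15,Rel 5 16],[Rel 0 2,Rel 0 4,Rel 3 0,Rel 1 8,Rel 2 3,Rel 3 2,Rel 3 4,
Rel 1 13,Rel 3 8,Rel 3 3,Rel 2 13,Rel 3 12,Rel 3 13,New,New,Rel 5 16],[Rel 0 2,Rel 0 4,Rel 0 5,Rel 1 7,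
Rel 1 8,Rel 1 9,Rel 1 10,Rel 4 6,Rel 2 6,Rel 2 10,Rel 4 9,Rel 4 10,Rel 3 15,Rel 4 14,Rel 4 15,New],[Rel 0 2,
Rel 0 4,Rel 0 5,Rel 1 7,Rel 1 8,Rel 1 9,Rel 1 10,Rel 1 11,Rel 2 6,Rel 2 10,Rel 2 11,Rel 3 12,Rel 5 11,
Rel 5 12,Rel 4 17,Rel 5 16],[Rel 0 2,Rel 0 4,Rel 0 5,Rel 1 7,Rel 1 8,Rel 1 9,Rel 1 10,Rel 1 11,Rel 2 6,
Rel 2 10,Rel 2 11,Rel 3 12,Rel 3 13,Rel 4 14,Rel 6 13,Rel 6 14]],[(0,3,1),(1,5,4),(2,3,2),(3,5,6),(4,3,4),(5,
3,6),(6,2,5),(7,4,11),(8,1,7),(9,4,9),(10,2,8),(11,3,11),(12,1,10),(13,2,13),(14,0,12),(15,1,15)]),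
([[Rel 0 3,Rel 0 4,Rel 0 5,Rel 0 6,New,New,New,New,Rel 5 7,New,Rel 2 7,Rel 2 11,Rel 2 12,Rel 3 13,Rel 3 14,
Rel 4 15],[Rel 0 7,Rel 0 8,Rel 0 9,Rel 0 10,Rel 1 8,Rel 1 9,Rel 1 10,Rel 1 11,Rel 1 12,New,New,New,New,New,
New,Rel 4 15],[Rel 2 0,Rel 2 2,Rel 0 5,Rel 0 6,Rel 2 5,Rel 1 10,Rel 1 11,New,New,Rel 2 6,Rel 2 7,Rel 2 11,
Rel 2 12,New,New,Rel 4 15],[Rel 0 3,Rel 0 4,Rel 3 0,Rel 3 1,Rel 1 8,Rel 3 3,Rel 4 2,Rel 1 12,Rel 1 13,Rel 3 4,
Rel 4 8,Rel 2 12,Rel 2 13,Rel 3 13,Rel 3 14,New],[Rel 0 3,Rel 0 4,Rel 0 5,Rel 0 6,Rel 1 8,Rel 1 9,Rel 4 5,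
Rel 4 6,Rel 1 12,Rel 2 6,Rel 4 8,Rel 4 9,Rel 2 12,Rel 3 14,Rel 3 15,Rel 4 15],[Rel 0 3,Rel 0 4,Rel 0 5,
Rel 0 6,Rel 1 8,Rel 1 9,Rel 1 10,Rel 1 11,Rel 5 7,Rel 2 6,Rel 2 7,Rel 2 11,Rel 5 10,Rel 5 11,Rel 3 14,
Rel 4 16],[Rel 0 3,Rel 0 4,Rel 0 5,Rel 0 6,Rel 1 8,Rel 1 9,Rel 1 10,Rel 1 11,Rel 1 12,Rel 2 6,Rel 2 7,
Rel 2 11,Rel 2 12,Rel 3 13,Rel 6 12,Rel 6 13]],[(0,3,1),(1,3,3),(2,2,2),(3,5,7),(4,5,9),(5,3,9),(6,2,4),(7,3,
7),(8,1,6),(9,4,13),(10,0,8),(11,4,11),(12,1,10),(13,3,13),(14,0,12),(15,2,15)]),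
([[Rel 0 4,Rel 0 5,Rel 0 6,Rel 0 7,Rel 0 9,New,New,New,New,New,Rel 6 8,New,Rel 2 8,Rel 2 13,Rel 2 14,
Rel 3 15],[Rel 0 8,Rel 0 9,Rel 0 10,Rel 0 11,New,Rel 1 9,Rel 1 10,Rel 1 11,Rel 1 12,Rel 1 13,Rel 1 14,New,New,
New,New,New],[Rel 2 2,Rel 0 5,Rel 0 6,Rel 0 7,Rel 2 3,Rel 2 5,Rel 2 6,Rel 1 11,Rel 1 12,New,New,Rel 2 7,
Rel 2 8,Rel 2 13,Rel 2 14,New],[Rel 0 4,Rel 3 0,Rel 0 6,Rel 0 7,Rel 3 1,Rel 3 4,New,Rel 4 3,Rel 5 6,Rel 1 13,
Rel 1 14,Rel 4 4,Rel 5 10,Rel 2 13,Rel 2 14,Rel 3 15],[Rel 0 4,Rel 0 5,Rel 4 2,Rel 4 3,Rel 0 9,Rel 1 9,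
Rel 4 4,Rel 4 5,Rel 1 12,Rel 1 13,Rel 1 14,Rel 4 9,Rel 2 8,Rel 2 13,Rel 2 14,Rel 3 15],[Rel 0 4,Rel 0 5,
Rel 0 6,Rel 0 7,Rel 0 9,Rel 1 9,Rel 1 10,Rel 1 11,Rel 5 6,Rel 5 7,Rel 1 14,Rel 2 7,Rel 5 10,Rel 5 11,Rel 2 14,
Rel 3 15],[Rel 0 4,Rel 0 5,Rel 0 6,Rel 0 7,Rel 0 9,Rel 1 9,Rel 1 10,Rel 1 11,Rel 1 12,Rel 1 13,Rel 6 8,
Rel 2 7,Rel 2 8,Rel 2 13,Rel 6 12,Rel 6 13]],[(0,3,4),(1,2,0),(2,3,3),(3,1,2),(4,5,9),(5,5,11),(6,5,5),(7,3,
11),(8,1,6),(9,3,9),(10,0,8),(11,4,15),(12,4,13),(13,0,12),(14,3,15),(15,2,5)]),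
([[Rel 0 5,Rel 0 6,Rel 0 7,Rel 0 8,Rel 0 9,Rel 0 11,New,New,New,New,New,New,New,Rel 2 10,Rel 2 15,New],
[Rel 0 9,Rel 0 10,Rel 0 11,Rel 0 12,Rel 0 13,New,Rel 1 4,Rel 1 11,Rel 1 12,Rel 1 13,Rel 1 14,Rel 1 15,New,New,
New,Rel 3 10],[Rel 2 1,Rel 2 2,Rel 0 7,Rel 0 8,Rel 0 9,Rel 2 3,Rel 1 3,Rel 2 7,Rel 2 8,Rel 1 13,Rel 1 14,New,
Rel 2 9,Rel 2 10,Rel 2 15,Rel 3 6],[Rel 3 0,Rel 0 6,Rel 0 7,Rel 0 8,Rel 0 9,Rel 0 11,Rel 1 1,New,New,Rel 5 7,
Rel 6 8,Rel 1 15,Rel 5 11,Rel 6 12,Rel 2 15,Rel 3 6],[Rel 0 5,Rel 4 0,Rel 4 1,Rel 0 8,Rel 0 9,Rel 4 4,Rel 1 4,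
Rel 4 5,Rel 1 12,Rel 1 13,Rel 1 14,Rel 1 15,Rel 2 9,Rel 2 10,Rel 2 15,Rel 3 4],[Rel 0 5,Rel 0 6,Rel 0 7,
Rel 5 2,Rel 5 3,Rel 0 11,Rel 1 4,Rel 1 11,Rel 5 6,Rel 5 7,Rel 1 14,Rel 1 15,Rel 5 11,Rel 2 10,Rel 2 15,
Rel 3 6],[Rel 0 5,Rel 0 6,Rel 0 7,Rel 0 8,Rel 0 9,Rel 0 11,Rel 1 4,Rel 1 11,Rel 1 12,Rel 1 13,Rel 6 8,Rel 6 9,
Rel 2 9,Rel 6 12,Rel 6 13,Rel 3 6]],[(0,3,6),(1,3,5),(2,1,1),(3,3,4),(4,0,3),(5,5,11),(6,5,12),(7,2,0),(8,5,
7),(9,3,12),(10,0,8),(11,3,11),(12,4,14),(13,2,7),(14,1,15)]),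
([[Rel 0 6,Rel 0 7,Rel 0 8,Rel 0 9,Rel 0 10,Rel 0 11,Rel 0 12,Rel 0 15,New,New,New,New,New,New,New],[Rel 1 0,
Rel 0 11,Rel 0 12,Rel 0 13,Rel 0 14,Rel 0 15,New,New,Rel 1 5,Rel 1 12,Rel 1 13,Rel 1 14,New,Rel 3 11,
Rel 3 12],[Rel 0 6,Rel 2 2,Rel 2 3,Rel 0 9,Rel 0 10,Rel 0 11,Rel 2 4,Rel 0 15,Rel 1 3,Rel 2 9,Rel 2 10,
Rel 1 15,Rel 2 11,Rel 3 7,Rel 3 8],[Rel 0 6,Rel 0 7,Rel 0 8,Rel 0 9,Rel 0 10,Rel 0 11,Rel 0 12,Rel 3 1,New,
New,New,Rel 6 9,Rel 6 12,Rel 3 7,Rel 3 8],[Rel 0 6,Rel 4 0,Rel 0 8,Rel 0 9,Rel 0 10,Rel 0 11,Rel 0 12,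
Rel 0 15,Rel 4 6,Rel 1 12,Rel 1 13,Rel 1 14,Rel 2 11,Rel 4 15,New],[Rel 0 6,Rel 0 7,Rel 5 1,Rel 5 2,Rel 0 10,
Rel 0 11,Rel 5 5,Rel 0 15,Rel 1 5,Rel 5 7,Rel 1 13,Rel 1 14,Rel 2 11,Rel 3 7,Rel 5 15],[Rel 0 6,Rel 0 7,
Rel 0 8,Rel 0 9,Rel 6 3,Rel 6 4,Rel 0 12,Rel 0 15,Rel 1 5,Rel 1 12,Rel 6 8,Rel 6 9,Rel 6 12,Rel 3 7,Rel 3 8]],
[(0,3,8),(1,3,6),(2,0,2),(3,3,5),(4,5,12),(5,2,1),(6,1,7),(7,5,9),(8,2,0),(9,3,12),(10,5,13),(11,2,9),(12,0,
14),(13,1,13)]),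
([[Rel 0 8,Rel 0 9,Rel 0 10,Rel 0 11,Rel 0 12,Rel 0 13,Rel 0 14,New,Rel 1 15,New,New,New,New,New],[Rel 1 1,
Rel 0 12,Rel 0 13,Rel 0 14,New,New,New,Rel 1 6,Rel 1 7,Rel 1 12,Rel 3 5,Rel 3 12,Rel 3 13,Rel 4 14],[Rel 0 8,
Rel 2 3,Rel 2 4,Rel 0 11,Rel 2 5,Rel 0 13,Rel 0 14,Rel 1 4,Claw False 2,Rel 2 11,Claw True 3,Rel 3 9,Rel 3 10,
Rel 4 14],[Rel 0 8,Rel 0 9,Rel 0 10,Rel 0 11,Rel 0 12,Rel 3 1,Rel 3 2,New,Rel 1 1,New,Rel 3 8,Rel 3 9,
Rel 3 10,Rel 4 8],[Rel 4 0,Rel 0 9,Rel 0 10,Rel 0 11,Rel 0 12,Rel 4 7,Rel 0 14,Rel 1 6,Rel 1 7,Rel 1 12,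
Rel 3 6,New,New,Rel 4 14],[Rel 0 8,Rel 5 1,Rel 0 10,Rel 0 11,Rel 0 12,Rel 0 13,Rel 5 7,Rel 5 8,Rel 1 7,
Rel 1 12,Rel 3 8,Rel 5 13,Rel 3 10,Rel 4 15],[Rel 0 8,Rel 0 9,Rel 6 2,Rel 6 3,Rel 6 6,Rel 0 13,Rel 0 14,
Rel 1 6,Rel 1 7,Rel 6 9,Rel 3 8,Rel 3 9,Rel 6 14,Rel 4 14]],[(0,3,7),(1,3,4),(2,3,10),(3,2,1),(4,0,6),(5,1,5),
(6,5,9),(7,2,0),(8,1,8),(9,5,11),(10,2,9),(11,1,11),(12,0,13)]),
([[Rel 0 7,Rel 0 9,Rel 0 10,Rel 0 11,Rel 0 12,Rel 0 13,New,Rel 1 13,Rel 1 14,New,New,New,New],[Rel 1 1,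
Rel 0 12,New,New,New,New,Rel 1 4,Rel 1 5,Rel 1 6,Rel 3 6,Rel 3 12,Rel 4 11,Rel 4 12],[Rel 0 7,Rel 2 3,
Rel 0 10,Rel 0 11,Rel 0 12,Rel 0 13,Rel 1 5,Rel 4 8,Rel 5 8,Rel 5 10,Rel 3 11,Rel 4 11,Rel 4 12],[Rel 0 7,
Rel 0 9,Rel 3 0,Rel 3 1,Rel 3 2,Rel 0 13,New,Rel 1 1,Rel 1 2,Rel 3 7,Rel 3 9,Rel 4 9,Rel 4 10],[Rel 0 7,
Rel 0 9,Rel 0 10,Rel 0 11,Rel 0 12,Rel 4 6,Rel 1 4,Rel 4 8,Rel 1 6,New,New,Rel 4 11,Rel 4 12],[Rel 5 0,
Rel 0 9,Rel 0 10,Rel 5 5,Rel 0 12,Rel 0 13,Rel 1 4,Rel 1 5,Rel 5 8,Rel 5 10,Rel 3 9,Rel 5 13,New],[Rel 0 7,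
Rel 6 1,Rel 0 10,Rel 0 11,Rel 6 6,Rel 0 13,Rel 6 7,Rel 1 5,Rel 1 6,Rel 3 7,Rel 6 11,Rel 4 11,Rel 6 13]],[(0,3,
6),(1,3,9),(2,2,1),(3,1,3),(4,0,5),(5,2,2),(6,2,0),(7,0,8),(8,1,7),(9,5,10),(10,5,11),(11,1,10),(12,0,11)]),
([[Rel 0 6,Rel 0 9,Rel 0 10,Rel 0 11,Rel 0 12,Rel 1 10,Rel 1 11,Rel 1 12,Rel 1 13,New,New,New,New],[Rel 1 1,
New,New,New,New,Rel 1 2,Rel 1 3,Rel 1 4,Rel 1 5,Rel 3 4,Rel 4 9,Rel 4 10,Rel 5 12],[Rel 0 6,Rel 0 9,Rel 0 10,
Rel 0 11,Rel 0 12,New,Rel 5 7,Rel 6 8,Rel 4 8,Rel 6 9,Rel 4 9,Rel 4 10,Rel 5 12],[Rel 0 6,Rel 3 0,Rel 3 1,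
Rel 0 11,Rel 0 12,Rel 3 7,Rel 1 1,Rel 1 2,New,Rel 3 6,Rel 4 7,Rel 4 9,Rel 5 12],[Rel 0 6,Rel 0 9,Rel 0 10,
Rel 4 3,Rel 4 4,Rel 1 2,Rel 1 3,Rel 1 4,Rel 4 8,New,Rel 4 9,Rel 4 10,Rel 5 12],[Rel 0 6,Rel 5 2,Rel 0 10,
Rel 5 5,Rel 0 12,Rel 1 2,Rel 5 7,Rel 1 4,Rel 1 5,Rel 3 6,Rel 4 10,New,Rel 5 12],[Rel 6 0,Rel 0 9,Rel 6 3,
Rel 0 11,Rel 6 5,Rel 1 2,Rel 1 3,Rel 6 8,Rel 1 5,Rel 6 9,Rel 4 9,Rel 6 11,Rel 5 13]],[(0,3,9),(1,3,10),(2,1,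
2),(3,0,3),(4,2,1),(5,2,0),(6,1,6),(7,0,8),(8,4,5),(9,1,5),(10,5,11),(11,0,11)]),
([[Rel 0 9,Rel 0 10,Rel 0 11,Rel 0 12,Rel 1 9,Rel 1 10,Rel 1 11,Rel 1 12,Rel 2 5,Rel 3 8,New,New],[New,New,
New,New,Rel 1 1,Rel 1 2,Rel 1 3,Rel 1 4,Rel 2 2,Rel 3 5,Rel 4 9,Rel 5 11],[Rel 0 9,Rel 0 10,Rel 0 11,Rel 0 12,
New,Rel 6 6,Rel 4 6,Rel 4 7,Rel 2 5,New,Rel 4 9,Rel 5 11],[Rel 3 0,Rel 0 10,Rel 0 11,Rel 0 12,Rel 3 6,Rel 1 1,
New,New,Rel 2 7,Rel 3 8,Rel 4 6,Rel 5 11],[Rel 0 9,Rel 4 1,Rel 4 2,Rel 0 12,Rel 1 1,Rel 1 2,Rel 4 6,Rel 4 7,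
Rel 2 5,Rel 3 8,Rel 4 9,Rel 5 10],[Rel 0 9,Rel 0 10,Rel 0 11,Rel 5 4,Rel 5 5,Rel 1 2,Rel 5 8,Rel 1 4,Rel 2 5,
Rel 3 8,New,Rel 5 11],[Rel 6 1,Rel 0 10,Rel 6 3,Rel 0 12,Rel 1 1,Rel 6 6,Rel 1 3,Rel 6 8,Rel 2 5,Rel 3 8,
Rel 6 10,Rel 6 12]],[(0,3,10),(1,0,2),(2,2,0),(3,2,1),(4,1,5),(5,0,6),(6,4,4),(7,1,8),(8,1,4),(9,0,9),(10,5,
11)]),
([[Rel 0 10,Rel 0 11,Rel 1 9,Rel 1 10,Rel 1 11,Rel 1 12,Rel 2 4,Rel 2 9,Rel 3 6,Rel 3 7,New],[New,New,Rel 1 0,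
Rel 1 1,Rel 1 2,Rel 1 3,Rel 2 1,Claw True 5,Rel 3 3,Rel 3 4,Rel 5 10],[Rel 0 10,Rel 0 11,New,New,Rel 4 5,
Rel 5 7,Rel 2 4,Rel 2 9,New,New,Rel 5 10],[Rel 0 10,Rel 0 11,Rel 3 5,New,New,New,Rel 2 6,Rel 2 8,Rel 3 6,
Rel 3 7,Rel 5 10],[Rel 4 0,Rel 0 11,Rel 1 0,Rel 4 4,Rel 4 5,Rel 1 3,Rel 2 4,Rel 2 9,Rel 3 6,Rel 3 7,Rel 5 9],
[Rel 0 10,Rel 5 2,Rel 1 0,Rel 1 1,Rel 1 2,Rel 5 7,Rel 5 8,Rel 2 9,Rel 5 9,Rel 3 7,Rel 5 10],[Rel 6 1,Rel 6 3,
Rel 6 4,Rel 1 1,Rel 6 6,Rel 1 3,Rel 2 4,Rel 2 9,Rel 3 6,Rel 6 9,Rel 5 10]],[(0,3,10),(1,2,0),(2,0,4),(3,4,2),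
(4,4,3),(5,1,6),(6,0,7),(7,1,3),(8,1,2),(9,0,8)]),
([[Rel 0 10,Rel 1 10,Rel 1 11,Rel 2 2,Rel 2 3,Rel 2 8,Rel 2 9,Rel 3 3,Rel 3 4,Rel 3 5],[New,Rel 1 0,Rel 1 1,
Rel 2 0,Rel 2 1,Rel 5 7,Rel 6 7,Rel 3 1,Rel 3 2,Rel 3 3],[Rel 0 10,New,Rel 5 4,Rel 2 2,Rel 2 3,Rel 2 8,
Rel 2 9,New,New,New],[Rel 0 10,New,New,Rel 2 5,New,Rel 2 6,Rel 2 7,Rel 3 3,Rel 3 4,Rel 3 5],[Rel 0 10,Rel 4 2,
Rel 1 1,Rel 2 2,Rel 4 6,Rel 2 8,Rel 2 9,Rel 4 8,Rel 3 5,New],[Rel 5 0,Rel 1 0,Rel 5 4,Rel 2 2,Rel 2 3,Rel 5 7,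
Rel 2 9,Rel 3 3,Rel 3 4,Rel 5 9],[Rel 0 10,Rel 6 3,Rel 6 5,Rel 6 6,Rel 2 3,Rel 2 8,Rel 6 7,Rel 3 3,Rel 6 8,
Rel 3 5]],[(0,2,0),(1,4,1),(2,1,4),(3,1,3),(4,0,5),(5,1,1),(6,0,8),(7,4,7),(8,0,7)]),
([[Rel 1 10,Rel 2 1,Rel 2 7,Rel 2 8,Rel 2 9,Rel 3 1,Rel 3 2,Rel 3 4,Rel 4 9],[Rel 1 0,Rel 2 0,Rel 4 5,Rel 6 5,
Rel 5 6,Rel 3 0,Rel 3 1,Claw False 1,Rel 4 9],[New,Rel 2 1,Rel 2 7,Rel 2 8,Rel 2 9,New,New,New,New],[New,New,
Rel 2 3,Rel 2 4,Rel 2 5,Rel 3 1,Rel 3 2,Rel 3 4,Rel 4 5],[Rel 1 0,Rel 4 3,Rel 4 5,Rel 2 8,Rel 2 9,Rel 4 8,New,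
Rel 3 6,Rel 4 9],[Rel 5 1,Rel 2 1,Rel 2 7,Rel 2 8,Rel 5 6,Rel 3 1,Rel 5 8,Rel 3 4,Rel 4 9],[Rel 1 0,Rel 6 4,
Rel 2 7,Rel 6 5,Rel 2 9,Rel 6 7,Rel 6 9,Rel 3 4,Rel 4 9]],[(0,4,0),(1,1,1),(2,0,3),(3,1,7),(4,0,2),(5,1,0),(6,
4,5),(7,0,5)]),
([[Rel 2 0,Rel 2 5,Rel 2 6,Rel 2 7,Rel 2 8,Rel 3 0,Rel 3 1,Rel 4 6],[Rel 2 0,Rel 4 3,Rel 5 3,New,Rel 4 4,
Rel 3 0,Rel 6 7,Rel 4 6],[Rel 2 0,Rel 2 5,Rel 2 6,Rel 2 7,Rel 2 8,New,New,New],[New,Rel 2 1,Rel 2 2,Rel 3 2,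
New,Rel 3 0,Rel 3 1,Rel 4 2],[Rel 2 0,Rel 4 3,Rel 2 6,Rel 2 7,Rel 4 4,New,Rel 3 3,Rel 4 6],[Rel 5 1,Rel 2 5,
Rel 5 3,Rel 2 7,Rel 2 8,Rel 5 5,Rel 3 1,Rel 4 8],[Rel 2 0,Rel 6 2,Rel 6 4,Rel 2 7,Rel 2 8,Rel 3 0,Rel 6 7,
Rel 6 8]],[(0,2,3),(1,1,0),(2,1,6),(3,0,1),(4,4,5),(5,0,3),(6,0,5)]),
([[New,Rel 2 5,Rel 2 6,Rel 2 7,Rel 3 0,Rel 3 4,Rel 4 5],[Rel 1 3,Rel 5 1,New,Rel 4 2,Rel 5 6,New,Rel 4 5],
[Rel 1 7,Rel 2 5,Rel 2 6,Rel 2 7,New,Rel 3 8,New],[Rel 1 2,Rel 2 0,Rel 3 1,New,Rel 3 0,Rel 3 4,Rel 4 0],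
[Rel 1 3,Rel 2 5,Rel 2 6,Rel 4 2,New,Rel 3 4,Rel 4 5],[Rel 1 3,Rel 5 1,Rel 2 6,Rel 2 7,Rel 5 6,Rel 3 4,
Rel 5 7],[Rel 1 3,Rel 2 5,Rel 6 3,Rel 6 4,Rel 3 0,Rel 3 4,Rel 4 5]],[(0,3,0),(1,2,2),(2,0,0),(3,1,4),(4,0,1),
(5,0,2),(6,4,6)]),
([[Rel 0 0,New,New,Rel 2 4,Rel 2 6,Rel 3 3,Rel 4 4],[Rel 0 3,Rel 1 2,Rel 1 5,New,Rel 4 1,New,Rel 4 4],
[Rel 0 0,Rel 1 6,Claw False 8,Rel 2 4,Rel 2 6,Rel 3 7,New],[Rel 0 0,Rel 1 1,Rel 1 4,Rel 3 1,New,Rel 3 3,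
Rel 4 0],[Rel 0 0,Rel 1 2,Rel 1 5,Rel 2 4,Rel 4 1,Rel 3 2,Rel 4 4],[Rel 0 0,Rel 1 2,Rel 1 5,Rel 5 2,Rel 5 3,
Rel 3 3,Rel 4 6],[Rel 0 0,Rel 6 0,Rel 1 5,Rel 2 4,Rel 2 6,Rel 6 5,Rel 4 4]],[(0,3,1),(1,0,0),(2,2,3),(3,0,1),
(4,1,6),(5,0,3)]),
([[Rel 0 1,Rel 0 2,New,New,Rel 2 6,Rel 3 4],[Rel 0 2,Rel 0 5,Rel 1 3,Rel 1 5,New,New],[Rel 0 1,Rel 0 2,
Rel 1 4,Rel 6 2,Rel 2 6,Rel 3 6],[Rel 0 1,Rel 0 2,Rel 1 1,Rel 1 3,New,Rel 3 4],[Rel 0 1,Rel 0 2,Rel 1 3,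
Rel 1 5,Rel 4 3,Rel 3 1],[Rel 0 1,Rel 0 2,Rel 5 1,Rel 1 5,Rel 2 6,Rel 5 5],[Rel 6 0,Rel 0 2,Rel 1 3,Rel 6 2,
Rel 2 6,Rel 3 4]],[(0,3,2),(1,0,0),(2,2,4),(3,0,2),(4,0,4)]),
([[Rel 0 2,Rel 0 3,New,New,Rel 3 4],[Rel 0 3,Rel 0 5,Rel 1 4,Rel 1 5,New],[Rel 0 2,Rel 0 3,Rel 1 6,Rel 5 3,
Rel 3 6],[Rel 0 2,Rel 0 3,New,Rel 1 4,Rel 3 4],[Rel 0 2,Rel 0 3,Rel 4 2,Rel 1 5,Rel 4 5],[Rel 5 0,Rel 0 3,
Rel 1 4,Rel 5 3,Rel 3 4],[Rel 0 2,Rel 6 1,Rel 1 4,Rel 1 5,Rel 3 4]],[(0,3,2),(1,0,0),(2,0,2),(3,2,4)]),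
([[Rel 0 2,Rel 0 3,New,New],[Rel 0 4,Rel 0 5,Rel 1 4,New],[Rel 0 2,Rel 0 3,Rel 4 3,Claw True 6],[Rel 0 2,
Rel 0 3,Rel 1 4,Rel 3 2],[Rel 4 0,Rel 0 3,Rel 4 3,Rel 3 2],[Rel 0 2,Rel 5 1,Rel 1 4,Rel 3 2],[Rel 0 2,Rel 0 3,
Rel 1 4,Rel 3 2]],[(0,0,0),(1,3,3),(2,0,3)]),
([[Rel 0 2,Rel 0 3,New],[Rel 0 4,New,Rel 1 3],[Rel 0 2,Rel 0 3,New],[Rel 0 2,Rel 3 0,Rel 3 2],[Rel 4 1,
Rel 0 3,Rel 1 3],[Rel 0 2,Rel 0 3,Rel 1 3],[Rel 0 2,Rel 0 3,Rel 1 3]],[(0,0,1),(1,3,2),(2,1,2)]),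
([[Rel 0 2,New,New],[Rel 0 3,Rel 1 1,Rel 2 3],[Rel 0 2,New,Rel 2 2],[Rel 3 0,Rel 1 0,Rel 2 2],[Rel 0 2,
Rel 1 1,Rel 2 2],[Rel 0 2,Rel 1 1,Rel 2 2],[Rel 0 2,Rel 1 1,Rel 2 2]],[(0,0,1),(1,1,0),(2,3,2)]),
([[Rel 0 1,Rel 0 2,New],[Rel 1 0,New,Rel 2 1],[Rel 0 1,Rel 2 0,Rel 2 1],[Rel 0 1,Rel 0 2,Claw False 0],
[Rel 0 1,Rel 0 2,Rel 2 1],[Rel 0 1,Rel 0 2,Rel 2 1],[Rel 0 1,Rel 0 2,Rel 2 1]],[(0,0,2),(1,1,0)]),
([[Rel 0 2,Rel 1 2],[New,Rel 1 1],[Rel 2 0,Rel 1 0],[Rel 0 2,Claw True 0],[Rel 0 2,Rel 1 1],[Rel 0 2,Rel 1 1],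
[Rel 0 2,Rel 1 1]],[(0,1,0)]),
([[Rel 1 2],[Rel 1 0],[Rel 2 1],[New],[Rel 1 0],[Rel 1 0],[Rel 1 0]],[(0,2,0)]),
([[Rel 3 0],[Rel 3 0],[Rel 3 1],[Rel 3 0],[New],[Rel 3 0],[Rel 3 0]],[(0,4,0)]),
([[Rel 4 0],[Rel 4 0],[Rel 4 0],[Rel 4 0],[Rel 4 0],[New],[Rel 4 0]],[(0,5,0)]),
([[Rel 5 0],[Rel 5 0],[Rel 5 0],[Rel 5 0],[Rel 5 0],[Rel 5 0],[New]],[(0,6,0)]),
([[Rel 6 0],[Rel 6 0],[Rel 6 0],[Rel 6 0],[Rel 6 0],[Rel 6 0],[Rel 6 0]],[])]"

lemma check1: "check 1 cert1"
  by code_simp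

lemma check2: "check 2 cert2"
  by code_simp

lemma check3: "check 3 cert3"
  by code_simp

lemma check4: "check 4 cert4"
  by code_simp

lemma check5: "check 5 cert5"
  by code_simp

lemma check6: "check 6 cert6"
  by code_simp

lemma check7: "check 7 cert7"
  by code_simp

section \<open>The trees \<open>E\<^sub>6\<close>, \<open>E\<^sub>7\<close>, \<open>E\<^sub>8\<close>\<close>

definition cert :: "nat \<Rightarrow> certificate" where
  "cert k = [cert1, cert2, cert3, cert4, cert5, cert6, cert7] ! (k - 1)"

definition cert_levels :: "nat \<Rightarrow> nat list list list" where
  "cert_levels k = levels [[]] (cert k)"

lemma stage_cert_levels:
  assumes "0 < k" "k \<le> 7"
  shows "stage k (cert_levels k)"
proof -
  have "k = 1 \<or> k = 2 \<or> k = 3 \<or> k = 4 \<or> k = 5 \<or> k = 6 \<or> k = 7" using assms by linarith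
  then have "check k (cert k)"
    using check1 check2 check3 check4 check5 check6 check7 by (auto simp: cert_def)
  then show ?thesis unfolding cert_levels_def using assms(1) by (rule stage_check)
qed

text \<open>Internally the vertices \<open>p\<^sub>1, p\<^sub>2, p\<^sub>3, q, p\<^sub>4, \<dots>\<close> are numbered \<open>0, 1, 2, 3, 4, \<dots>\<close>, so that the
  trees \<open>E\<^sub>m\<close> are nested.\<close>

definition vertex :: "nat \<Rightarrow> nat \<Rightarrow> nat" where
  "vertex m x = (if x < 3 then Suc x else if x = 3 then m else x)"

definition vertex_inv :: "nat \<Rightarrow> nat \<Rightarrow> nat" where
  "vertex_inv m y = (if y = m then 3 else if y \<le> 3 then y - 1 else y)"

abbreviation Em_letter :: "nat \<Rightarrow> nat \<Rightarrow> nat \<times> nat" where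
  "Em_letter m \<equiv> edge_map (vertex m)"

lemma vertex_inv_vertex: "6 \<le> m \<Longrightarrow> x < m \<Longrightarrow> vertex_inv m (vertex m x) = x"
  by (auto simp: vertex_def vertex_inv_def)

lemma inj_vertex_inv: "6 \<le> m \<Longrightarrow> inj_on (vertex_inv m) {1..m}"
  by (rule inj_onI) (auto simp: vertex_inv_def split: if_splits)

lemma inj_vertex: "6 \<le> m \<Longrightarrow> inj_on (vertex m) {..m - 1}"
  by (rule inj_on_inverseI[of _ "vertex_inv m"]) (auto intro: vertex_inv_vertex)

lemma Em_letter_simps:
  assumes "6 \<le> m" "e < m - 1"
  shows "Em_letter m e = (if e < 2 then (Suc e, Suc (Suc e)) else if e = 2 then (3, m)
    else if e = 3 then (3, 4) else (e, Suc e))"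
  using assms by (auto simp: edge_map_def edge_def vertex_def)

lemma Em_edges_eq:
  assumes m: "6 \<le> m"
  shows "Em_edges m = Em_letter m ` {..<m - 1}"
proof (intro set_eqI iffI)
  fix x assume "x \<in> Em_edges m"
  then consider "x = (3, m)" | i where "x = (i, Suc i)" "1 \<le> i" "i \<le> m - 2"
    by (auto simp: Em_edges_def)
  then show "x \<in> Em_letter m ` {..<m - 1}"
  proof cases
    case 1
    then show ?thesis using m Em_letter_simps[OF m, of 2] by (intro image_eqI[of _ _ 2]) auto
  next
    case 2
    show ?thesis
    proof (cases "i < 3")
      case True
      then show ?thesis using 2 m Em_letter_simps[OF m, of "i - 1"] by (intro image_eqI[of _ _ "i - 1"]) auto
    next
      case False
      then show ?thesis using 2 m Em_letter_simps[OF m, of i] by (intro image_eqI[of _ _ i]) auto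
    qed
  qed
next
  fix x assume "x \<in> Em_letter m ` {..<m - 1}"
  then obtain e where "e < m - 1" "x = Em_letter m e" by auto
  then show "x \<in> Em_edges m" using m by (auto simp: Em_letter_simps Em_edges_def)
qed

lemma Em_edges_oriented: "6 \<le> m \<Longrightarrow> Em_edges m \<subseteq> {(i, j). i < j}"
  by (auto simp: Em_edges_def)

lemma Em_edges_FKL: "6 \<le> m \<Longrightarrow> Em_edges m \<subseteq> FKL m"
  by (auto simp: Em_edges_def FKL_def)

lemma vertex_edge_less: "6 \<le> m \<Longrightarrow> e < m - 1 \<Longrightarrow> vertex m (fst (edge e)) < vertex m (snd (edge e))"
  using Em_letter_simps[of m e] by (auto simp: edge_map_def split: if_splits)

lemma map_prod_Em_letter:
  assumes "6 \<le> m" "e < m - 1"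
  shows "map_prod (vertex_inv m) (vertex_inv m) (Em_letter m e) = edge e"
proof -
  have "fst (edge e) < m" "snd (edge e) < m" using edge_bound[OF assms(2)] assms(1) by auto
  then show ?thesis using assms(1) by (simp add: edge_map_def vertex_inv_vertex)
qed

lemma map_map_prod_Em_letter:
  assumes "6 \<le> m" "w \<in> lists {..<m - 1}"
  shows "map (map_prod (vertex_inv m) (vertex_inv m)) (map (Em_letter m) w) = edge_word w"
  using assms map_prod_Em_letter[OF assms(1)] by (auto simp: lists_eq_set)

lemma inj_map_Em_letter: "6 \<le> m \<Longrightarrow> inj_on (map (Em_letter m)) (lists {..<m - 1})"
proof (rule inj_onI)
  fix v w assume m: "6 \<le> m" and vw: "v \<in> lists {..<m - 1}" "w \<in> lists {..<m - 1}" "map (Em_letter m) v = map (Em_letter m) w"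
  then have "edge_word v = edge_word w" using map_map_prod_Em_letter[OF m] by metis
  moreover have "inj edge" by (rule injI) (metis snd_edge nat.inject)
  ultimately show "v = w" by (simp add: inj_map_eq_map)
qed

abbreviation Em_normal :: "nat \<Rightarrow> nat list set" where
  "Em_normal m \<equiv> normal_forms cert_levels (m - 1)"

lemma stages_Em:
  assumes "m \<in> {6, 7, 8}" "0 < j" "j \<le> m - 1"
  shows "stage j (cert_levels j)"
  using assms by (intro stage_cert_levels) auto

lemma Em_ann_rel:
  assumes m: "m \<in> {6, 7, 8}" and ann: "annihilates (Em_edges m) (G_rels (Em_edges m)) \<phi>"
  shows "ann_rel (m - 1) (\<lambda>w. \<phi> (map (Em_letter m) w))"
proof (rule annihilates_ann_rel[OF ann])
  have 6: "6 \<le> m" using m by auto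
  show "inj_on (vertex m) {..m - 1}" using inj_vertex[OF 6] .
  fix e assume e: "e < m - 1"
  show "Em_letter m e \<in> Em_edges m" using Em_edges_eq[OF 6] e by auto
  show "vertex m (fst (edge e)) < vertex m (snd (edge e))" using vertex_edge_less[OF 6 e] .
qed

lemma Em_span:
  assumes m: "m \<in> {6, 7, 8}" and p: "fin_supp p" "\<forall>w. p w \<noteq> 0 \<longrightarrow> set w \<subseteq> Em_edges m \<and> P (length w)"
  shows "p \<in> fa.span (gen_ideal (Em_edges m) (G_rels (Em_edges m))
    \<union> fword ` map (Em_letter m) ` {w \<in> Em_normal m. P (length w)})"
proof (rule gen_ideal_span_separation[OF fin_supp_G_rels p(1)])
  fix \<phi> assume ann: "annihilates (Em_edges m) (G_rels (Em_edges m)) \<phi>"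
    and zero: "\<And>w. w \<in> map (Em_letter m) ` {w \<in> Em_normal m. P (length w)} \<Longrightarrow> \<phi> w = 0"
  have 6: "6 \<le> m" using m by auto
  have "\<phi> w = 0" if "p w \<noteq> 0" for w
  proof -
    have w: "set w \<subseteq> Em_edges m" "P (length w)" using p(2) that by auto
    then have "w \<in> lists (Em_letter m ` {..<m - 1})" using Em_edges_eq[OF 6] by auto
    then obtain v where v: "v \<in> lists {..<m - 1}" "w = map (Em_letter m) v"
      unfolding lists_image by blast
    have "(\<lambda>v. \<phi> (map (Em_letter m) v)) v = 0"
    proof (rule normal_forms_span_degree[OF _ Em_ann_rel[OF m ann] _ v(1) refl])
      show "stage j (cert_levels j)" if "0 < j" "j \<le> m - 1" for j
        by (rule stages_Em[OF m that])
      show "\<phi> (map (Em_letter m) x) = 0" if "x \<in> Em_normal m" "length x = length v" for x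
        by (rule zero) (use that w(2) v(2) in auto)
    qed
    then show ?thesis by (simp add: v(2))
  qed
  then show "fa_eval \<phi> p = 0" unfolding fa_eval_def by (intro sum.neutral) simp
qed

lemma span_fword_supp:
  assumes "s \<in> fa.span (fword ` N)" "w \<notin> N"
  shows "s w = 0"
  using assms(1)
proof (induction rule: fa.span_induct_alt)
  case (step c x y)
  then have "x w = 0" using assms(2) by (auto simp: fword_def)
  then show ?case using step by (simp add: fsc_def)
qed simp

lemma Em_indep:
  assumes m: "m \<in> {6, 7, 8}" and s: "s \<in> fa.span (fword ` map (Em_letter m) ` Em_normal m)"
    and I: "s \<in> gen_ideal (FKL m) (FK_rels m)"
  shows "s = 0"
proof -
  have 6: "6 \<le> m" using m by auto
  let ?g = "map (Em_letter m)"
  have words: "Em_normal m \<subseteq> lists {..<m - 1}" by (rule normal_forms_words) (rule stages_Em[OF m])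
  have inj: "inj_on ?g (Em_normal m)" by (rule inj_on_subset[OF inj_map_Em_letter[OF 6] words])
  have supp: "{w. s w \<noteq> 0} \<subseteq> ?g ` Em_normal m" using span_fword_supp[OF s] by blast
  have zero: "(\<Sum>w\<in>Em_normal m. s (?g w) * pairing u (edge_word w)) = 0" for u
  proof -
    let ?\<phi> = "\<lambda>w. pairing u (map (map_prod (vertex_inv m) (vertex_inv m)) w)"
    have "FK_fun {1..m} ?\<phi>" by (rule FK_fun_map[OF FK_fun_pairing inj_vertex_inv[OF 6]])
    then have "fa_eval ?\<phi> s = 0"
      using fa_eval_gen_ideal[of "FK_rels m" s "FKL m" ?\<phi>] fin_supp_FK_rels I annihilates_FK_rels_iff by blast
    moreover have "fa_eval ?\<phi> s = (\<Sum>w\<in>?g ` Em_normal m. s w * ?\<phi> w)"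
      by (rule fa_eval_superset[OF _ supp]) simp
    moreover have "\<dots> = (\<Sum>w\<in>Em_normal m. s (?g w) * ?\<phi> (?g w))"
      by (subst sum.reindex[OF inj]) simp
    moreover have "\<dots> = (\<Sum>w\<in>Em_normal m. s (?g w) * pairing u (edge_word w))"
    proof (rule sum.cong)
      fix w assume "w \<in> Em_normal m"
      then have "w \<in> lists {..<m - 1}" using words by blast
      from map_map_prod_Em_letter[OF 6 this]
      show "s (?g w) * ?\<phi> (?g w) = s (?g w) * pairing u (edge_word w)" by (simp only:)
    qed simp
    ultimately show ?thesis by simp
  qed
  have "word_indep (Em_normal m)" by (rule normal_forms_indep) (rule stages_Em[OF m])
  then have "s (?g w) = 0" if "w \<in> Em_normal m" for w
    using word_indepD[where c = "\<lambda>w. s (?g w)", OF _ zero that] by blast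
  then have "s w = 0" for w using supp by blast
  then show ?thesis by (intro ext) simp
qed

lemma Em_kernel:
  assumes m: "m \<in> {6, 7, 8}"
  shows "fk_kernel (Em_edges m) m = gen_ideal (Em_edges m) (G_rels (Em_edges m))"
proof (intro set_eqI iffI)
  let ?J = "gen_ideal (Em_edges m) (G_rels (Em_edges m))" and ?I = "gen_ideal (FKL m) (FK_rels m)"
  have 6: "6 \<le> m" using m by auto
  have JI: "?J \<subseteq> ?I" by (rule G_rels_gen_ideal_subset[OF Em_edges_FKL[OF 6]])
  {
    fix p assume p: "p \<in> ?J"
    have "fin_supp p" using gen_ideal_fin_supp[OF _ p] fin_supp_G_rels by blast
    then show "p \<in> fk_kernel (Em_edges m) m"
      using supp_gen_ideal_G_rels[OF Em_edges_oriented[OF 6] p] JI p by (auto simp: fk_kernel_def)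
  }
  fix p assume p: "p \<in> fk_kernel (Em_edges m) m"
  then have "p \<in> fa.span (?J \<union> fword ` map (Em_letter m) ` {w \<in> Em_normal m. True})"
    by (intro Em_span[OF m, where P = "\<lambda>_. True"]) (auto simp: fk_kernel_def)
  then obtain q s where q: "q \<in> fa.span ?J" and s: "s \<in> fa.span (fword ` map (Em_letter m) ` Em_normal m)" and pq: "p = q + s"
    by (auto simp: fa.span_Un)
  have q': "q \<in> ?J" using q fa.span_minimal[OF subset_refl subspace_gen_ideal] by blast
  have "p \<in> ?I" using p by (simp add: fk_kernel_def)
  then have "p - q \<in> ?I" using q' JI fa.subspace_diff[OF subspace_gen_ideal] by blast
  then have "s = 0" using Em_indep[OF m s] pq by simp
  then show "p \<in> ?J" using q' pq by simp
qed

lemma Em_hdim: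
  assumes m: "m \<in> {6, 7, 8}"
  shows "hdim (Em_edges m) m d = card {w \<in> Em_normal m. length w = d}"
proof -
  let ?J = "gen_ideal (Em_edges m) (G_rels (Em_edges m))" and ?I = "gen_ideal (FKL m) (FK_rels m)"
  let ?N = "{w \<in> Em_normal m. length w = d}"
  let ?B = "fword ` map (Em_letter m) ` ?N"
  have 6: "6 \<le> m" using m by auto
  have JI: "?J \<subseteq> ?I" by (rule G_rels_gen_ideal_subset[OF Em_edges_FKL[OF 6]])
  have words: "Em_normal m \<subseteq> lists {..<m - 1}" by (rule normal_forms_words) (rule stages_Em[OF m])
  have "dim_quot (deg_part (Em_edges m) d) ?I = card ?B"
  proof (rule dim_quot_eq_card[OF subspace_gen_ideal])
    show "?B \<subseteq> deg_part (Em_edges m) d"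
    proof
      fix x assume "x \<in> ?B"
      then obtain w where w: "x = fword (map (Em_letter m) w)" "w \<in> Em_normal m" "length w = d" by auto
      then have sw: "set (map (Em_letter m) w) \<subseteq> Em_edges m" using words Em_edges_eq[OF 6] by auto
      have "set v \<subseteq> Em_edges m \<and> length v = d" if "x v \<noteq> 0" for v
      proof -
        have "v = map (Em_letter m) w" using that w(1) by (simp add: fword_def split: if_splits)
        then show ?thesis using sw w(3) by simp
      qed
      then show "x \<in> deg_part (Em_edges m) d" by (simp add: deg_part_def w(1))
    qed
    show "fa.independent ?B" by (rule independent_fword) simp
    show "s = 0" if "s \<in> fa.span ?B" "s \<in> ?I" for s
    proof (rule Em_indep[OF m _ that(2)])
      show "s \<in> fa.span (fword ` map (Em_letter m) ` Em_normal m)"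
        using that(1) fa.span_mono[of ?B "fword ` map (Em_letter m) ` Em_normal m"] by blast
    qed
    fix v assume "v \<in> deg_part (Em_edges m) d"
    then have "v \<in> fa.span (?J \<union> ?B)"
      by (intro Em_span[OF m, where P = "\<lambda>l. l = d"]) (auto simp: deg_part_def)
    then obtain q s where q: "q \<in> fa.span ?J" and s: "s \<in> fa.span ?B" and vq: "v = q + s"
      by (auto simp: fa.span_Un)
    have "q \<in> ?J" using q fa.span_minimal[OF subset_refl subspace_gen_ideal] by blast
    then have "v - s \<in> ?I" using JI vq by auto
    then show "\<exists>s\<in>fa.span ?B. v - s \<in> ?I" using s by blast
  qed simp
  moreover have "card ?B = card ?N"
  proof -
    have "inj_on (map (Em_letter m)) ?N"
      by (rule inj_on_subset[OF inj_map_Em_letter[OF 6]]) (use words in auto)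
    then show ?thesis by (simp add: card_image inj_on_subset[OF inj_fword])
  qed
  ultimately show ?thesis by (simp add: hdim_def)
qed

lemma Em_hilb:
  assumes "m \<in> {6, 7, 8}"
  shows "hilb (Em_edges m) m = nf_series cert_levels (m - 1)"
  by (simp add: hilb_def nf_series_def Em_hdim[OF assms])

lemma nf_series_cert_Suc:
  assumes "Suc k \<le> 7"
  shows "nf_series cert_levels (Suc k) = list_series (cert_sizes (cert (Suc k))) * nf_series cert_levels k"
proof -
  have "nf_series cert_levels (Suc k) = level_series (cert_levels (Suc k)) * nf_series cert_levels k"
    by (rule nf_series_Suc, rule stage_cert_levels) (use assms in auto)
  then show ?thesis unfolding cert_levels_def[of "Suc k"] level_series_levels .
qed

lemma sizes_E6:
  "list_mul (cert_sizes cert1) (list_mul (cert_sizes cert2) (list_mul (cert_sizes cert3)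
     (list_mul (cert_sizes cert4) (list_mul (cert_sizes cert5) (replicate 3 1)))))
   = list_mul (replicate 4 1) (list_mul (replicate 5 1) (list_mul (replicate 6 1)
     (list_mul (replicate 6 1) (list_mul (replicate 8 1) (replicate 9 1))))) @ replicate 5 0"
  by code_simp

lemma sizes_E7:
  "list_mul (cert_sizes cert6) (list_mul (replicate 4 1) (replicate 5 1))
   = list_mul (replicate 10 1) (list_mul (replicate 12 1) (replicate 14 1)) @ [0]"
  by code_simp

lemma sizes_E8:
  "list_mul (cert_sizes cert7) (list_mul (replicate 5 1) (list_mul (replicate 6 1) (replicate 9 1)))
   = list_mul (replicate 15 1) (list_mul (replicate 18 1) (list_mul (replicate 20 1) (replicate 24 1))) @ [0]"
  by code_simp

theorem mainTheorem17:
  shows "(\<forall>m\<in>{6,7,8::nat}. fk_kernel (Em_edges m) m = gen_ideal (Em_edges m) (G_rels (Em_edges m)))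
    \<and> hilb (Em_edges 6) 6 * qint 3 = qint 4 * qint 5 * qint 6 ^ 2 * qint 8 * qint 9
    \<and> hilb (Em_edges 7) 7 * qint 3 = qint 6 ^ 2 * qint 8 * qint 9 * qint 10 * qint 12 * qint 14
    \<and> hilb (Em_edges 8) 8 * qint 3 * qint 5
        = qint 6 * qint 8 * qint 10 * qint 12 * qint 14 * qint 15 * qint 18 * qint 20 * qint 24"
proof -
  let ?q = "\<lambda>k. list_series (cert_sizes (cert k))"
  have c: "cert 1 = cert1" "cert 2 = cert2" "cert 3 = cert3" "cert 4 = cert4" "cert 5 = cert5"
    "cert 6 = cert6" "cert 7 = cert7"
    by (simp_all add: cert_def)
  have n: "nf_series cert_levels 5 = ?q 5 * (?q 4 * (?q 3 * (?q 2 * ?q 1)))"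
    using nf_series_cert_Suc[of 0] nf_series_cert_Suc[of 1] nf_series_cert_Suc[of 2]
      nf_series_cert_Suc[of 3] nf_series_cert_Suc[of 4]
    by (simp add: nf_series_0 numeral_eq_Suc)
  have n6: "nf_series cert_levels 6 = ?q 6 * nf_series cert_levels 5"
    using nf_series_cert_Suc[of 5] by simp
  have n7: "nf_series cert_levels 7 = ?q 7 * nf_series cert_levels 6"
    using nf_series_cert_Suc[of 6] by simp
  have s6: "?q 1 * (?q 2 * (?q 3 * (?q 4 * (?q 5 * qint 3))))
      = qint 4 * (qint 5 * (qint 6 * (qint 6 * (qint 8 * qint 9))))"
    using arg_cong[OF sizes_E6, of list_series]
    unfolding list_series_mul list_series_zeros c qint_eq_list_series .
  have s7: "?q 6 * (qint 4 * qint 5) = qint 10 * (qint 12 * qint 14)"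
    using arg_cong[OF sizes_E7, of list_series] list_series_zeros[of _ 1]
    unfolding list_series_mul c qint_eq_list_series by (simp add: list_series_mul)
  have s8: "?q 7 * (qint 5 * (qint 6 * qint 9)) = qint 15 * (qint 18 * (qint 20 * qint 24))"
    using arg_cong[OF sizes_E8, of list_series] list_series_zeros[of _ 1]
    unfolding list_series_mul c qint_eq_list_series by (simp add: list_series_mul)
  have h: "hilb (Em_edges 6) 6 = nf_series cert_levels 5" "hilb (Em_edges 7) 7 = nf_series cert_levels 6"
    "hilb (Em_edges 8) 8 = nf_series cert_levels 7"
    using Em_hilb[of 6] Em_hilb[of 7] Em_hilb[of 8] by simp_all
  have e6: "nf_series cert_levels 5 * qint 3 = qint 4 * qint 5 * qint 6 ^ 2 * qint 8 * qint 9"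
    using s6 unfolding n by (simp add: power2_eq_square mult_ac)
  have "nf_series cert_levels 6 * qint 3 = ?q 6 * (nf_series cert_levels 5 * qint 3)"
    by (simp add: n6 mult.assoc)
  also have "\<dots> = (?q 6 * (qint 4 * qint 5)) * (qint 6 ^ 2 * qint 8 * qint 9)"
    unfolding e6 by (simp add: mult_ac)
  finally have e7: "nf_series cert_levels 6 * qint 3
      = qint 6 ^ 2 * qint 8 * qint 9 * qint 10 * qint 12 * qint 14"
    unfolding s7 by (simp add: mult_ac)
  have "nf_series cert_levels 7 * qint 3 * qint 5 = ?q 7 * qint 5 * (nf_series cert_levels 6 * qint 3)"
    by (simp add: n7 mult_ac)
  also have "\<dots> = (?q 7 * (qint 5 * (qint 6 * qint 9))) * (qint 6 * qint 8 * qint 10 * qint 12 * qint 14)"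
    unfolding e7 by (simp add: power2_eq_square mult_ac)
  finally have e8: "nf_series cert_levels 7 * qint 3 * qint 5
      = qint 6 * qint 8 * qint 10 * qint 12 * qint 14 * qint 15 * qint 18 * qint 20 * qint 24"
    unfolding s8 by (simp add: mult_ac)
  show ?thesis
    using Em_kernel e6 e7 e8 unfolding h by blast
qed

end
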